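(* Let $T>0$, $u_0\in\mathcal{M}^+(\mathbb{R})$, and let $\varphi\in C([0,\infty))$, $\varphi(0)=0$, $\varphi'\in L^\infty(0,\infty)$, with $C_\varphi:=\lim_{u\to\infty}\varphi(u)/u$ existing in $\mathbb{R}$. (i) Let $u$ be an entropy subsolution of problem $(P)$ in the sense of Young measures. Then $$u_s(\cdot,t_2)\le\mathcal{T}_{C_\varphi(t_2-t_1)}(u_s(\cdot,t_1))\quad\text{in }\mathcal{M}^+(\mathbb{R})\quad\text{for a.e. }0\le t_1\le t_2\le T .$$ In particular, $u_s(\cdot,t)\le\mathcal{T}_{C_\varphi t}(u_{0s})$ in $\mathcal{M}^+(\mathbb{R})$ for a.e. $t\in(0,T)$, whence $\|u_s(\cdot,t)\|_{\mathcal{M}(\mathbb{R})}\le\|u_{0s}\|_{\mathcal{M}(\mathbb{R})}$ for a.e. $t\in(0,T)$. (ii) Let $u$ be a solution of problem $(P)$. Then there is conservation of mass: $\|u(\cdot,t)\|_{\mathcal{M}(\mathbb{R})}=\|u_0\|_{\mathcal{M}(\mathbb{R})}$ for a.e. $t\in(0,T)$.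
   Context: Problem $(P)$ is the Cauchy problem $u_t+[\varphi(u)]_x=0$ in $S:=\mathbb{R}\times(0,T)$, $u=u_0$ in $\mathbb{R}\times\{0\}$. Measures. $\mathcal{M}(\mathbb{R})$ is the space of finite Radon measures on $\mathbb{R}$ with norm $\|\mu\|_{\mathcal{M}(\mathbb{R})}=|\mu|(\mathbb{R})$, $\mathcal{M}^+(\mathbb{R})$ the cone of nonnegative ones, $\mu_1\le\mu_2$ means $\mu_2-\mu_1\in\mathcal{M}^+(\mathbb{R})$, and $\langle\mu,\rho\rangle_{\mathbb{R}}=\int\rho\,d\mu$. Each $\mu$ decomposes as $\mu=\mu_{ac}+\mu_s$ with respect to Lebesgue measure; $\mu_r\in L^1(\mathbb{R})$ is the density of $\mu_{ac}$. The translate $\mathcal{T}_a(\mu)$ is defined by $\langle\mathcal{T}_a(\mu),\rho\rangle_{\mathbb{R}}=\int\rho(x+a)\,d\mu(x)$. $L^\infty(0,T;\mathcal{M}^+(\mathbb{R}))$ is the set of finite nonnegative Radon measures $u$ on $S$ such that for a.e. $t\in(0,T)$ there is $u(\cdot,t)\in\mathcal{M}^+(\mathbb{R})$ with: for $\zeta\in C([0,T];C_c(\mathbb{R}))$, $t\mapsto\langle u(\cdot,t),\zeta(\cdot,t)\rangle_{\mathbb{R}}$ is in $L^1(0,T)$ and $\int_S\zeta\,du=\int_0^T\langle u(\cdot,t),\zeta(\cdot,t)\rangle_{\mathbb{R}}dt$; and $t\mapsto\|u(\cdot,t)\|_{\mathcal{M}(\mathbb{R})}$ is in $L^\infty(0,T)$.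 For such $u$, $u_s(\cdot,t)=[u(\cdot,t)]_s$ and $u_r(\cdot,t)=[u(\cdot,t)]_r$ for a.e. $t$. Solution of $(P)$: $u\in L^\infty(0,T;\mathcal{M}^+(\mathbb{R}))$ such that for all $\zeta\in C^1([0,T];C^1_c(\mathbb{R}))$ with $\zeta(\cdot,T)=0$, $$\iint_S[u_r\zeta_t+\varphi(u_r)\zeta_x]dxdt+\int_0^T\langle u_s(\cdot,t),\zeta_t(\cdot,t)+C_\varphi\zeta_x(\cdot,t)\rangle_{\mathbb{R}}dt=-\langle u_0,\zeta(\cdot,0)\rangle_{\mathbb{R}}.$$ Young measures: $\mathcal{Y}(S;\mathbb{R})$ is the set of Young measures on $S\times\mathbb{R}$; $\tau$ is identified with its disintegration, a measurable family of probability measures $\tau_{(x,t)}$ on $\mathbb{R}$, $(x,t)\in S$. An entropy subsolution of $(P)$ in the sense of Young measures is a pair $(u,\tau)$ with $u\in L^\infty(0,T;\mathcal{M}^+(\mathbb{R}))$, $\tau\in\mathcal{Y}(S;\mathbb{R})$, $\operatorname{supp}\tau_{(x,t)}\subseteq[0,\infty)$ and $u_r(x,t)=\int_{[0,\infty)}\xi\,d\tau_{(x,t)}(\xi)$ for a.e. $(x,t)\in S$, such that $$\iint_S[E^*\zeta_t+F^*\zeta_x]dxdt+\int_0^T\langle u_s(\cdot,t),C_E\zeta_t(\cdot,t)+C_F\zeta_x(\cdot,t)\rangle_{\mathbb{R}}dt\ge-\int_{\mathbb{R}}E(u_{0r})\zeta(x,0)dx-C_E\langle u_{0s},\zeta(\cdot,0)\rangle_{\mathbb{R}}$$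 for all $\zeta\in C^1([0,T];C^1_c(\mathbb{R}))$ with $\zeta\ge0$ and $\zeta(\cdot,T)=0$, and all $E,F:[0,\infty)\to\mathbb{R}$ with $E$ convex and nondecreasing, $E',F'\in L^\infty(0,\infty)$, $F'=E'\varphi'$, and existing limits $C_E=\lim_{u\to\infty}E(u)/u$, $C_F=\lim_{u\to\infty}F(u)/u$; here $E^*(x,t)=\int_{[0,\infty)}E\,d\tau_{(x,t)}$, $F^*(x,t)=\int_{[0,\infty)}F\,d\tau_{(x,t)}$. *)

theory Defs
  imports "HOL-Probability.Probability"
begin

section \<open>Finite nonnegative Radon measures\<close>

text \<open>
  Only nonnegative measures occur. On the real line and on the strip, which are open subsets of
  Euclidean spaces, finite nonnegative Radon measures are exactly the finite Borel measures. The
  norm is the total variation, that is, the total mass.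
\<close>

definition Mplus :: "'a::topological_space set \<Rightarrow> 'a measure set" where
  "Mplus X = {\<mu>. finite_measure \<mu> \<and> sets \<mu> = sets (restrict_space borel X)}"

definition Mnorm :: "'a measure \<Rightarrow> real" where
  "Mnorm \<mu> = measure \<mu> (space \<mu>)"

definition Mplus_le :: "real measure \<Rightarrow> real measure \<Rightarrow> bool" where
  "Mplus_le \<mu> \<nu> \<longleftrightarrow> \<mu> \<in> Mplus UNIV \<and> \<nu> \<in> Mplus UNIV \<and>
     (\<exists>\<sigma>\<in>Mplus UNIV. \<forall>A\<in>sets borel. measure \<nu> A - measure \<mu> A = measure \<sigma> A)"

text \<open>The push-forward satisfies \<open>\<integral> \<rho> d(translate a \<mu>) = \<integral> \<rho>(x + a) d\<mu>(x)\<close>.\<close>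

definition translate :: "real \<Rightarrow> real measure \<Rightarrow> real measure" where
  "translate a \<mu> = distr \<mu> borel (\<lambda>x. x + a)"

definition mutually_singular :: "'a measure \<Rightarrow> 'a measure \<Rightarrow> bool" where
  "mutually_singular M N \<longleftrightarrow>
     (\<exists>A\<in>sets M. A \<in> sets N \<and> emeasure M A = 0 \<and> emeasure N (space N - A) = 0)"

definition lebesgue_decomposition ::
    "'a measure \<Rightarrow> 'a measure \<Rightarrow> 'a measure \<Rightarrow> 'a measure \<Rightarrow> bool" where
  "lebesgue_decomposition M \<mu> \<alpha> \<sigma> \<longleftrightarrow>
     sets \<alpha> = sets M \<and> sets \<sigma> = sets M \<and>
     absolutely_continuous M \<alpha> \<and> mutually_singular M \<sigma> \<and>
     (\<forall>A\<in>sets M. emeasure \<mu> A = emeasure \<alpha> A + emeasure \<sigma> A)"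

text \<open>
  The decomposition of a finite measure \<open>\<mu>\<close> with respect to \<open>M\<close> exists and is unique if
  \<open>M\<close> is sigma-finite and \<open>sets \<mu> = sets M\<close>.
\<close>

definition ac_part :: "'a measure \<Rightarrow> 'a measure \<Rightarrow> 'a measure" where
  "ac_part M \<mu> = (THE \<alpha>. \<exists>\<sigma>. lebesgue_decomposition M \<mu> \<alpha> \<sigma>)"

definition sing_part :: "'a measure \<Rightarrow> 'a measure \<Rightarrow> 'a measure" where
  "sing_part M \<mu> = (THE \<sigma>. \<exists>\<alpha>. lebesgue_decomposition M \<mu> \<alpha> \<sigma>)"

definition ac_density :: "'a measure \<Rightarrow> 'a measure \<Rightarrow> 'a \<Rightarrow> real" where
  "ac_density M \<mu> p = enn2real (RN_deriv M (ac_part M \<mu>) p)"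

section \<open>Function spaces\<close>

text \<open>Points of the strip are written \<open>(x, t)\<close>.\<close>

definition strip :: "real \<Rightarrow> (real \<times> real) set" where
  "strip T = UNIV \<times> {0<..<T}"

text \<open>
  A function \<open>\<zeta>(x, t)\<close> is represented by the map \<open>t \<mapsto> z t = \<zeta>(\<cdot>, t)\<close>; only its values for
  \<open>t \<in> [0, T]\<close> matter. Spaces of compactly supported functions carry their usual inductive limit
  topology: a map from a compact interval is continuous iff all its values are supported in one
  compact set and it is continuous with respect to the uniform norm (of the function, and of
  its first derivative in the case of continuously differentiable functions).
\<close>

definition C_Cc :: "real \<Rightarrow> (real \<Rightarrow> real \<Rightarrow> real) set" where
  "C_Cc T = {z.
     (\<exists>K. compact K \<and> (\<forall>t\<in>{0..T}. \<forall>x. x \<notin> K \<longrightarrow> z t x = 0)) \<and>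
     (\<forall>t\<in>{0..T}. continuous_on UNIV (z t) \<and>
        uniform_limit UNIV z (z t) (at t within {0..T}))}"

definition C_Cc1 :: "real \<Rightarrow> (real \<Rightarrow> real \<Rightarrow> real) set" where
  "C_Cc1 T = {z. z \<in> C_Cc T \<and>
     (\<forall>t\<in>{0..T}. \<forall>x. z t field_differentiable (at x)) \<and>
     (\<lambda>t. deriv (z t)) \<in> C_Cc T}"

definition C1_Cc1 :: "real \<Rightarrow> (real \<Rightarrow> real \<Rightarrow> real) set" where
  "C1_Cc1 T = {z. z \<in> C_Cc1 T \<and> (\<exists>z'\<in>C_Cc1 T. \<forall>t\<in>{0..T}.
     uniform_limit UNIV (\<lambda>s x. (z s x - z t x) / (s - t)) (z' t) (at t within {0..T}) \<and>
     uniform_limit UNIV (\<lambda>s x. (deriv (z s) x - deriv (z t) x) / (s - t)) (deriv (z' t))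
       (at t within {0..T}))}"

definition dx :: "(real \<Rightarrow> real \<Rightarrow> real) \<Rightarrow> real \<Rightarrow> real \<Rightarrow> real" where
  "dx z t x = deriv (z t) x"

definition dt :: "(real \<Rightarrow> real \<Rightarrow> real) \<Rightarrow> real \<Rightarrow> real \<Rightarrow> real" where
  "dt z t x = deriv (\<lambda>s. z s x) t"

text \<open>
  \<open>g\<close> is the weak derivative of the continuous function \<open>f\<close> on the half-line, and it is
  essentially bounded: \<open>f\<close> is the primitive of \<open>g\<close>.
\<close>

definition Linf_deriv :: "(real \<Rightarrow> real) \<Rightarrow> (real \<Rightarrow> real) \<Rightarrow> bool" where
  "Linf_deriv f g \<longleftrightarrow>
     g \<in> borel_measurable (lebesgue_on {0<..}) \<and>
     (\<exists>C. AE v in lebesgue_on {0<..}. \<bar>g v\<bar> \<le> C) \<and>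
     (\<forall>v\<ge>0. f v = f 0 + (LINT w:{0<..<v}|lebesgue. g w))"

section \<open>Measure-valued functions of time\<close>

text \<open>
  \<open>u\<close> belongs to \<open>L\<^sup>\<infinity>(0,T; M\<^sup>+)\<close> and \<open>v t\<close> is the slice \<open>u(\<cdot>,t)\<close>. The slices are
  determined by \<open>u\<close> for almost every \<open>t\<close> and are otherwise arbitrary, so that integrals over
  time are taken with respect to the complete measure \<open>lebesgue\<close>.
\<close>

definition Linf_Mplus :: "real \<Rightarrow> (real \<times> real) measure \<Rightarrow> (real \<Rightarrow> real measure) \<Rightarrow> bool" where
  "Linf_Mplus T u v \<longleftrightarrow>
     u \<in> Mplus (strip T) \<and>
     (AE t in lebesgue_on {0<..<T}. v t \<in> Mplus UNIV) \<and>
     (\<forall>z\<in>C_Cc T.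
        set_integrable lebesgue {0<..<T} (\<lambda>t. LINT x|v t. z t x) \<and>
        (LINT p|u. z (snd p) (fst p)) = (LINT t:{0<..<T}|lebesgue. LINT x|v t. z t x)) \<and>
     (\<lambda>t. Mnorm (v t)) \<in> borel_measurable (lebesgue_on {0<..<T}) \<and>
     (\<exists>C. AE t in lebesgue_on {0<..<T}. Mnorm (v t) \<le> C)"

text \<open>
  \<open>u\<^sub>r\<close> is the density of \<open>u\<close> with respect to Lebesgue measure on the strip; being jointly
  measurable, it is the representative of \<open>(x, t) \<mapsto> [u(\<cdot>,t)]\<^sub>r(x)\<close> used in the integrals over
  the strip.
\<close>

definition reg :: "real \<Rightarrow> (real \<times> real) measure \<Rightarrow> real \<times> real \<Rightarrow> real" where
  "reg T u = ac_density (restrict_space lborel (strip T)) u"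

section \<open>Solutions and entropy subsolutions\<close>

definition solution_P ::
    "real \<Rightarrow> (real \<Rightarrow> real) \<Rightarrow> real \<Rightarrow> real measure \<Rightarrow>
     (real \<times> real) measure \<Rightarrow> (real \<Rightarrow> real measure) \<Rightarrow> bool" where
  "solution_P T \<phi> C\<phi> u0 u v \<longleftrightarrow>
     Linf_Mplus T u v \<and>
     (\<forall>z\<in>C1_Cc1 T. (\<forall>x. z T x = 0) \<longrightarrow>
        (LINT (x,t):strip T|lebesgue. reg T u (x,t) * dt z t x + \<phi> (reg T u (x,t)) * dx z t x)
        + (LINT t:{0<..<T}|lebesgue. LINT x|sing_part lborel (v t). dt z t x + C\<phi> * dx z t x)
        = - (LINT x|u0. z 0 x))"

definition measure_support :: "'a::topological_space measure \<Rightarrow> 'a set" where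
  "measure_support M = {x. \<forall>U. open U \<and> x \<in> U \<longrightarrow> emeasure M U > 0}"

text \<open>Young measures are represented by their disintegrations.\<close>

definition Young_measures :: "real \<Rightarrow> (real \<times> real \<Rightarrow> real measure) set" where
  "Young_measures T = lebesgue_on (strip T) \<rightarrow>\<^sub>M prob_algebra borel"

definition entropy_pair ::
    "(real \<Rightarrow> real) \<Rightarrow> (real \<Rightarrow> real) \<Rightarrow> (real \<Rightarrow> real) \<Rightarrow> real \<Rightarrow> real \<Rightarrow> bool" where
  "entropy_pair \<phi> E F CE CF \<longleftrightarrow>
     convex_on {0..} E \<and> mono_on {0..} E \<and>
     (\<exists>E' F' \<phi>'. Linf_deriv E E' \<and> Linf_deriv F F' \<and> Linf_deriv \<phi> \<phi>' \<and>
        (AE v in lebesgue_on {0<..}. F' v = E' v * \<phi>' v)) \<and>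
     ((\<lambda>v. E v / v) \<longlongrightarrow> CE) at_top \<and> ((\<lambda>v. F v / v) \<longlongrightarrow> CF) at_top"

definition young_mean :: "(real \<times> real \<Rightarrow> real measure) \<Rightarrow> (real \<Rightarrow> real) \<Rightarrow> real \<times> real \<Rightarrow> real" where
  "young_mean \<tau> f p = (LINT \<xi>:{0..}|\<tau> p. f \<xi>)"

text \<open>
  Integrability of the identity is part of the requirement \<open>u\<^sub>r = \<integral> \<xi> d\<tau>\<close>, because the
  library integral of a nonintegrable function is \<open>0\<close>.
\<close>

definition entropy_subsolution_Y ::
    "real \<Rightarrow> (real \<Rightarrow> real) \<Rightarrow> real measure \<Rightarrow>
     (real \<times> real) measure \<Rightarrow> (real \<Rightarrow> real measure) \<Rightarrow> (real \<times> real \<Rightarrow> real measure) \<Rightarrow> bool" where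
  "entropy_subsolution_Y T \<phi> u0 u v \<tau> \<longleftrightarrow>
     Linf_Mplus T u v \<and> \<tau> \<in> Young_measures T \<and>
     (AE p in lebesgue_on (strip T).
        measure_support (\<tau> p) \<subseteq> {0..} \<and>
        set_integrable (\<tau> p) {0..} (\<lambda>\<xi>. \<xi>) \<and> reg T u p = young_mean \<tau> (\<lambda>\<xi>. \<xi>) p) \<and>
     (\<forall>z\<in>C1_Cc1 T. \<forall>E F CE CF.
        (\<forall>t\<in>{0..T}. \<forall>x. 0 \<le> z t x) \<and> (\<forall>x. z T x = 0) \<and> entropy_pair \<phi> E F CE CF \<longrightarrow>
        (LINT (x,t):strip T|lebesgue.
           young_mean \<tau> E (x,t) * dt z t x + young_mean \<tau> F (x,t) * dx z t x)
        + (LINT t:{0<..<T}|lebesgue. LINT x|sing_part lborel (v t). CE * dt z t x + CF * dx z t x)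
        \<ge> - (LINT x|lebesgue. E (ac_density lborel u0 x) * z 0 x)
          - CE * (LINT x|sing_part lborel u0. z 0 x))"

end

theory Submission
  imports Defs
begin

text \<open>
  \<^bold>\<open>Singular part.\<close> The entropies \<open>(v - k)\<^sup>+\<close> vanish at any given value once \<open>k\<close> is large.
  Along \<open>k \<rightarrow> \<infinity>\<close> all terms with \<open>u\<^sub>r\<close>, \<open>\<tau>\<close> and \<open>u\<^sub>0\<^sub>r\<close> in the entropy inequality tend to zero by
  dominated convergence, while the slopes at infinity, \<open>C\<^sub>E = 1\<close> and \<open>C\<^sub>F = C\<^sub>\<phi>\<close>, stay fixed. What
  remains says that \<open>u\<^sub>s\<close> is a subsolution of a transport equation with the constant speed \<open>C\<^sub>\<phi>\<close>
  (\<open>singular_part_inequality\<close>). Tested along its characteristics with \<open>\<rho>(x - C\<^sub>\<phi> t) g(t)\<close>, it becomes a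
  statement about functions of time: \<open>t \<mapsto> \<integral> \<rho>(x - C\<^sub>\<phi> t) du\<^sub>s(x,t)\<close> is nonincreasing in the sense of
  distributions, and initially at most \<open>\<integral> \<rho> du\<^sub>0\<^sub>s\<close>. Such a function is nonincreasing outside a null set of
  times (\<open>weakly_nonincreasing\<close>). The null set depends on \<open>\<rho>\<close>, but countably many profiles \<open>\<rho>\<close> decide the
  order of two finite measures (\<open>emeasure_le_if_plateau_integrals_le\<close>), so one null set serves all.

  \<^bold>\<open>Mass.\<close> In the equation for a solution, test functions \<open>\<chi>(x) g(t)\<close> with a cutoff \<open>\<chi>\<close> that spreads out
  to \<open>1\<close> lose their flux terms, because \<open>\<bar>\<phi>(u\<^sub>r)\<bar>\<close> is at most a multiple of the integrable \<open>u\<^sub>r\<close> and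
  the masses of the measures \<open>u\<^sub>s(\<cdot>,t)\<close> are bounded. The remaining identity says that the mass has a vanishing derivative in time and the initial
  value \<open>\<parallel>u\<^sub>0\<parallel>\<close> (\<open>mass_identity\<close>).

  \<^bold>\<open>Slices.\<close> Both arguments require that integrals against \<open>u\<^sub>s(\<cdot>,t)\<close> are measurable in \<open>t\<close>, and the second
  one that \<open>u(\<cdot>,t)\<close> splits into \<open>u\<^sub>r(\<cdot>,t)\<close> and \<open>u\<^sub>s(\<cdot>,t)\<close>, where \<open>u\<^sub>r\<close> is the density of \<open>u\<close> on the strip.
  That decomposition and slicing commute for almost every \<open>t\<close> is the theorem \<open>ac_part_slice\<close>.
\<close>

section \<open>The Lebesgue decomposition\<close>

lemma ex_maximal_null_set:
  assumes "finite_measure \<mu>" and sets: "sets \<mu> = sets M"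
  shows "\<exists>C\<in>null_sets M. \<forall>A\<in>null_sets M. A \<inter> C = {} \<longrightarrow> emeasure \<mu> A = 0"
proof -
  interpret finite_measure \<mu> by fact
  define s where "s = (SUP A\<in>null_sets M. measure \<mu> A)"
  have bdd: "bdd_above (measure \<mu> ` null_sets M)"
    by (rule bdd_aboveI[of _ "measure \<mu> (space \<mu>)"]) (auto intro: bounded_measure)
  have ne: "null_sets M \<noteq> {}" by auto
  have "\<exists>A\<in>null_sets M. s - 1 / real (Suc n) < measure \<mu> A" for n
    using less_cSUP_iff[OF ne bdd, of "s - 1 / real (Suc n)"] by (simp add: s_def)
  then obtain A where A: "\<And>n. A n \<in> null_sets M" "\<And>n. s - 1 / real (Suc n) < measure \<mu> (A n)"
    by metis
  define C where "C = (\<Union>n. A n)"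
  have C: "C \<in> null_sets M" unfolding C_def using A(1) by auto
  have "s - 1 / real (Suc n) < measure \<mu> C" for n
  proof -
    have "measure \<mu> (A n) \<le> measure \<mu> C"
      using C sets by (intro finite_measure_mono) (auto simp: C_def)
    then show ?thesis using A(2)[of n] by linarith
  qed
  then have approx: "s - 1 / real (Suc n) < measure \<mu> C" for n .
  have "s \<le> measure \<mu> C"
  proof (rule field_le_epsilon)
    fix e :: real assume "0 < e"
    then obtain n where "1 / real (Suc n) < e" by (auto elim: nat_approx_posE)
    then show "s \<le> measure \<mu> C + e" using approx[of n] by linarith
  qed
  moreover have "emeasure \<mu> A = 0" if "A \<in> null_sets M" "A \<inter> C = {}" "s \<le> measure \<mu> C" for A
  proof -
    have "measure \<mu> A + measure \<mu> C = measure \<mu> (A \<union> C)"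
      using that C sets by (intro finite_measure_Union[symmetric]) auto
    also have "\<dots> \<le> s"
      unfolding s_def using that C by (intro cSUP_upper bdd) auto
    finally have "measure \<mu> A = 0" using that(3) measure_nonneg[of \<mu> A] by linarith
    then show ?thesis by (simp add: emeasure_eq_measure)
  qed
  ultimately show ?thesis using C by auto
qed

lemma lebesgue_decomposition_restrict:
  assumes sets: "sets \<mu> = sets M" and C: "C \<in> null_sets M"
    and ac: "absolutely_continuous M (density \<mu> (indicator (space M - C)))"
  shows "lebesgue_decomposition M \<mu> (density \<mu> (indicator (space M - C))) (density \<mu> (indicator C))"
  unfolding lebesgue_decomposition_def
proof (intro conjI ballI)
  have rest: "C \<in> sets \<mu>" "space M - C \<in> sets \<mu>" using C sets by auto
  show "mutually_singular M (density \<mu> (indicator C))"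
    unfolding mutually_singular_def
    using C emeasure_restricted[OF rest(1), of "space M - C"] rest(2) sets sets_eq_imp_space_eq[OF sets]
    by (intro bexI[of _ C]) auto
  fix A assume A: "A \<in> sets M"
  have "emeasure \<mu> A = emeasure \<mu> ((space M - C) \<inter> A) + emeasure \<mu> (C \<inter> A)"
    using A sets sets.sets_into_space[OF A] C
    by (subst plus_emeasure) (auto intro!: arg_cong[where f = "emeasure \<mu>"])
  then show "emeasure \<mu> A =
    emeasure (density \<mu> (indicator (space M - C))) A + emeasure (density \<mu> (indicator C)) A"
    using A sets emeasure_restricted[OF rest(1), of A] emeasure_restricted[OF rest(2), of A]
    by simp
qed (use sets ac in auto)

text \<open>
  Restricting \<open>\<mu>\<close> to the complement of a null set that exhausts as much of its mass as a null set
  can leaves an absolutely continuous measure; so the decomposition is cut out by a single set.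
\<close>

lemma lebesgue_decomposition_carrier:
  assumes "finite_measure \<mu>" and sets: "sets \<mu> = sets M"
  obtains C where "C \<in> null_sets M"
    "lebesgue_decomposition M \<mu> (density \<mu> (indicator (space M - C))) (density \<mu> (indicator C))"
proof -
  obtain C where C: "C \<in> null_sets M" and
    max: "\<And>A. A \<in> null_sets M \<Longrightarrow> A \<inter> C = {} \<Longrightarrow> emeasure \<mu> A = 0"
    using ex_maximal_null_set[OF assms] by blast
  have rest: "space M - C \<in> sets \<mu>" using C sets by auto
  have "absolutely_continuous M (density \<mu> (indicator (space M - C)))"
    unfolding absolutely_continuous_def
  proof
    fix A assume A: "A \<in> null_sets M"
    then have "(space M - C) \<inter> A \<in> null_sets M"
      using C by (intro null_set_Int1) auto
    then have "emeasure \<mu> ((space M - C) \<inter> A) = 0" by (rule max) auto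
    then show "A \<in> null_sets (density \<mu> (indicator (space M - C)))"
      using A sets emeasure_restricted[OF rest, of A]
      by (intro null_setsI) (simp_all add: null_setsD2)
  qed
  from lebesgue_decomposition_restrict[OF sets C this] show thesis using C that by blast
qed

lemma lebesgue_decomposition_on_carrier:
  assumes d: "lebesgue_decomposition M \<mu> \<alpha> \<sigma>"
    and C: "C \<in> null_sets M" "emeasure \<sigma> (space M - C) = 0" and S: "S \<in> sets M"
  shows "emeasure \<sigma> S = emeasure \<mu> (S \<inter> C)" "emeasure \<alpha> S = emeasure \<mu> (S - C)"
proof -
  have sets: "sets \<alpha> = sets M" "sets \<sigma> = sets M" and ac: "absolutely_continuous M \<alpha>"
    and sum: "\<And>A. A \<in> sets M \<Longrightarrow> emeasure \<mu> A = emeasure \<alpha> A + emeasure \<sigma> A"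
    using d by (auto simp: lebesgue_decomposition_def)
  have CM: "C \<in> sets M" using C by auto
  have \<alpha>0: "emeasure \<alpha> (S \<inter> C) = 0"
    using ac C S null_set_Int1[OF C(1) S] unfolding absolutely_continuous_def by (auto simp: Int_commute)
  have \<sigma>0: "emeasure \<sigma> (S - C) = 0"
  proof -
    have "emeasure \<sigma> (S - C) \<le> emeasure \<sigma> (space M - C)"
      using S CM sets sets.sets_into_space[OF S] by (intro emeasure_mono) auto
    then show ?thesis using C(2) by simp
  qed
  have "emeasure \<sigma> S = emeasure \<sigma> (S \<inter> C) + emeasure \<sigma> (S - C)"
    using S CM sets by (subst plus_emeasure) (auto intro!: arg_cong[where f = "emeasure \<sigma>"])
  then show "emeasure \<sigma> S = emeasure \<mu> (S \<inter> C)"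
    using sum[of "S \<inter> C"] \<alpha>0 \<sigma>0 S CM by simp
  have "emeasure \<alpha> S = emeasure \<alpha> (S \<inter> C) + emeasure \<alpha> (S - C)"
    using S CM sets by (subst plus_emeasure) (auto intro!: arg_cong[where f = "emeasure \<alpha>"])
  then show "emeasure \<alpha> S = emeasure \<mu> (S - C)"
    using sum[of "S - C"] \<alpha>0 \<sigma>0 S CM by simp
qed

text \<open>
  Either singular part, and hence either decomposition, can be read off from \<open>\<mu>\<close> by means of any
  null set that carries it; the union of two carriers serves both.
\<close>

lemma lebesgue_decomposition_unique:
  assumes d: "lebesgue_decomposition M \<mu> \<alpha> \<sigma>" and d': "lebesgue_decomposition M \<mu> \<alpha>' \<sigma>'"
  shows "\<alpha> = \<alpha>'" "\<sigma> = \<sigma>'"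
proof -
  have sets: "sets \<alpha> = sets M" "sets \<sigma> = sets M" "sets \<alpha>' = sets M" "sets \<sigma>' = sets M"
    using d d' by (auto simp: lebesgue_decomposition_def)
  obtain A where A: "A \<in> null_sets M" "emeasure \<sigma> (space M - A) = 0"
    using d sets_eq_imp_space_eq[OF sets(2)]
    by (auto simp: lebesgue_decomposition_def mutually_singular_def)
  obtain A' where A': "A' \<in> null_sets M" "emeasure \<sigma>' (space M - A') = 0"
    using d' sets_eq_imp_space_eq[OF sets(4)]
    by (auto simp: lebesgue_decomposition_def mutually_singular_def)
  define C where "C = A \<union> A'"
  have C: "C \<in> null_sets M" using A A' by (auto simp: C_def)
  have "emeasure \<sigma> (space M - C) \<le> emeasure \<sigma> (space M - A)"
    using A sets by (intro emeasure_mono) (auto simp: C_def)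
  moreover have "emeasure \<sigma>' (space M - C) \<le> emeasure \<sigma>' (space M - A')"
    using A' sets by (intro emeasure_mono) (auto simp: C_def)
  ultimately have C0: "emeasure \<sigma> (space M - C) = 0" "emeasure \<sigma>' (space M - C) = 0"
    using A A' by auto
  note D = lebesgue_decomposition_on_carrier[OF d C C0(1)]
  note D' = lebesgue_decomposition_on_carrier[OF d' C C0(2)]
  show "\<alpha> = \<alpha>'" using D(2) D'(2) sets by (intro measure_eqI) auto
  show "\<sigma> = \<sigma>'" using D(1) D'(1) sets by (intro measure_eqI) auto
qed

lemma sing_part_eqI:
  assumes "lebesgue_decomposition M \<mu> \<alpha> \<sigma>"
  shows "sing_part M \<mu> = \<sigma>"
  unfolding sing_part_def using assms lebesgue_decomposition_unique(2)[OF assms] by blast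

lemma ac_part_eqI:
  assumes "lebesgue_decomposition M \<mu> \<alpha> \<sigma>"
  shows "ac_part M \<mu> = \<alpha>"
  unfolding ac_part_def using assms lebesgue_decomposition_unique(1)[OF assms] by blast

lemma lebesgue_decomposition_parts:
  assumes "finite_measure \<mu>" and sets: "sets \<mu> = sets M"
  shows "lebesgue_decomposition M \<mu> (ac_part M \<mu>) (sing_part M \<mu>)"
proof -
  obtain C where "lebesgue_decomposition M \<mu> (density \<mu> (indicator (space M - C))) (density \<mu> (indicator C))"
    using lebesgue_decomposition_carrier[OF assms] by blast
  then show ?thesis using sing_part_eqI ac_part_eqI by metis
qed

lemma
  assumes "finite_measure \<mu>" and sets: "sets \<mu> = sets M"
  shows finite_sing_part: "finite_measure (sing_part M \<mu>)"
    and finite_ac_part: "finite_measure (ac_part M \<mu>)"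
    and sets_sing_part: "sets (sing_part M \<mu>) = sets M"
    and sets_ac_part: "sets (ac_part M \<mu>) = sets M"
proof -
  interpret finite_measure \<mu> by fact
  note d = lebesgue_decomposition_parts[OF assms]
  then show s: "sets (sing_part M \<mu>) = sets M" "sets (ac_part M \<mu>) = sets M"
    by (auto simp: lebesgue_decomposition_def)
  have "emeasure \<mu> (space M) = emeasure (ac_part M \<mu>) (space M) + emeasure (sing_part M \<mu>) (space M)"
    using d by (auto simp: lebesgue_decomposition_def)
  then have "emeasure (sing_part M \<mu>) (space M) \<noteq> \<infinity> \<and> emeasure (ac_part M \<mu>) (space M) \<noteq> \<infinity>"
    using emeasure_finite[of "space M"] by (metis ennreal_add_eq_top infinity_ennreal_def)
  then show "finite_measure (sing_part M \<mu>)" "finite_measure (ac_part M \<mu>)"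
    using sets_eq_imp_space_eq[OF s(1)] sets_eq_imp_space_eq[OF s(2)]
    by (metis finite_measureI)+
qed

lemma ac_density_nonneg: "0 \<le> ac_density M \<mu> p"
  by (simp add: ac_density_def)

lemma
  assumes M: "sigma_finite_measure M" and \<mu>: "finite_measure \<mu>" "sets \<mu> = sets M"
  shows density_ac_density: "density M (\<lambda>p. ennreal (ac_density M \<mu> p)) = ac_part M \<mu>"
    and integrable_ac_density: "integrable M (ac_density M \<mu>)"
proof -
  interpret M: sigma_finite_measure M by fact
  interpret A: finite_measure "ac_part M \<mu>" using finite_ac_part[OF \<mu>] .
  have ac: "absolutely_continuous M (ac_part M \<mu>)" and s: "sets (ac_part M \<mu>) = sets M"
    using lebesgue_decomposition_parts[OF \<mu>] by (auto simp: lebesgue_decomposition_def)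
  have meas: "ac_density M \<mu> \<in> borel_measurable M" unfolding ac_density_def by measurable
  have "AE p in M. RN_deriv M (ac_part M \<mu>) p \<noteq> \<infinity>"
    using M.RN_deriv_finite[OF A.sigma_finite_measure_axioms ac s] .
  then have "AE p in M. ennreal (ac_density M \<mu> p) = RN_deriv M (ac_part M \<mu>) p"
    by eventually_elim (simp add: ac_density_def less_top)
  then have "density M (\<lambda>p. ennreal (ac_density M \<mu> p)) = density M (RN_deriv M (ac_part M \<mu>))"
    using meas by (intro density_cong) auto
  then show eq: "density M (\<lambda>p. ennreal (ac_density M \<mu> p)) = ac_part M \<mu>"
    using M.density_RN_deriv[OF ac s] by simp
  have "(\<integral>\<^sup>+p. ennreal (ac_density M \<mu> p) \<partial>M) = emeasure (density M (\<lambda>p. ennreal (ac_density M \<mu> p))) (space M)"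
    using meas by (auto simp: emeasure_density intro!: nn_integral_cong)
  also have "\<dots> < \<infinity>"
    unfolding eq using A.emeasure_finite[of "space M"] by (simp add: less_top[symmetric])
  finally show "integrable M (ac_density M \<mu>)"
    using meas ac_density_nonneg by (intro integrableI_nonneg) (simp_all add: ac_density_nonneg)
qed

lemma Mplus_UNIV: "\<mu> \<in> Mplus UNIV \<longleftrightarrow> finite_measure \<mu> \<and> sets \<mu> = sets (borel :: 'a::topological_space measure)"
  by (simp add: Mplus_def sets_restrict_space)

lemma sing_part_Mplus:
  assumes "\<mu> \<in> Mplus UNIV"
  shows "sing_part lborel \<mu> \<in> Mplus UNIV"
  using assms finite_sing_part[of \<mu> lborel] sets_sing_part[of \<mu> lborel] by (auto simp: Mplus_UNIV)

section \<open>Test functions\<close>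

text \<open>
  Uniformity of the limit comes from the uniform continuity of \<open>z\<close> on a compact set, since \<open>z\<close>
  vanishes outside it.
\<close>

lemma C_CcI:
  assumes cont: "continuous_on ({0..T} \<times> UNIV) (\<lambda>p. z (fst p) (snd p))"
    and K: "compact K" "\<And>t x. t \<in> {0..T} \<Longrightarrow> x \<notin> K \<Longrightarrow> z t x = 0"
  shows "z \<in> C_Cc T"
proof -
  have uc: "uniformly_continuous_on ({0..T} \<times> K) (\<lambda>p. z (fst p) (snd p))"
    using K(1) by (intro compact_uniformly_continuous continuous_on_subset[OF cont] compact_Times) auto
  have "uniform_limit UNIV z (z t) (at t within {0..T})" if t: "t \<in> {0..T}" for t
  proof (rule uniform_limitI)
    fix e :: real assume "0 < e"
    then obtain d where d: "0 < d" and D: "\<And>p q. p \<in> {0..T} \<times> K \<Longrightarrow> q \<in> {0..T} \<times> K \<Longrightarrow>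
        dist q p < d \<Longrightarrow> dist (z (fst q) (snd q)) (z (fst p) (snd p)) < e"
      using uc unfolding uniformly_continuous_on_def by metis
    have "dist (z s x) (z t x) < e" if s: "s \<in> {0..T}" "dist s t < d" for s x
    proof (cases "x \<in> K")
      case True
      then show ?thesis using D[of "(t, x)" "(s, x)"] s t by (simp add: dist_Pair_Pair)
    next
      case False
      then show ?thesis using K(2) s(1) t \<open>0 < e\<close> by simp
    qed
    then show "\<forall>\<^sub>F s in at t within {0..T}. \<forall>x\<in>UNIV. dist (z s x) (z t x) < e"
      unfolding eventually_at using d by blast
  qed
  moreover have "continuous_on UNIV (z t)" if "t \<in> {0..T}" for t
    using continuous_on_compose2[OF cont, of UNIV "\<lambda>x. (t, x)"] that
    by (simp add: continuous_on_Pair image_subset_iff)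
  ultimately show ?thesis using K unfolding C_Cc_def by blast
qed

lemma C_Cc_jointly_continuous:
  assumes "z \<in> C_Cc T"
  shows "continuous_on ({0..T} \<times> UNIV) (\<lambda>p. z (fst p) (snd p))"
  unfolding continuous_on_iff
proof (intro ballI allI impI)
  fix p :: "real \<times> real" and e :: real
  assume p: "p \<in> {0..T} \<times> UNIV" and e: "0 < e"
  then obtain t x where tx: "p = (t, x)" "t \<in> {0..T}" by auto
  have "uniform_limit UNIV z (z t) (at t within {0..T})" and c: "continuous_on UNIV (z t)"
    using assms tx by (auto simp: C_Cc_def)
  from uniform_limitD[OF this(1), of "e/2"] e
  obtain d1 where d1: "0 < d1" "\<forall>s\<in>{0..T}. s \<noteq> t \<and> dist s t < d1 \<longrightarrow> (\<forall>y\<in>UNIV. dist (z s y) (z t y) < e/2)"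
    unfolding eventually_at by auto
  obtain d2 where d2: "0 < d2" "\<forall>y. dist y x < d2 \<longrightarrow> dist (z t y) (z t x) < e/2"
    using c[unfolded continuous_on_iff, rule_format, of x "e/2"] e by auto
  have "dist (z s y) (z t x) < e" if s: "s \<in> {0..T}" "dist (s, y) (t, x) < min d1 d2" for s y
  proof -
    have "dist s t < d1" "dist y x < d2"
      using s(2) dist_fst_le[of "(s, y)" "(t, x)"] dist_snd_le[of "(s, y)" "(t, x)"] by auto
    moreover have "dist (z s y) (z t y) < e/2"
    proof (cases "s = t")
      case False
      then show ?thesis using d1(2) s(1) \<open>dist s t < d1\<close> by simp
    qed (use e in simp)
    ultimately show ?thesis
      using d2(2)[rule_format, of y] dist_triangle_half_r[of "z t y" "z s y" e "z t x"]
      by (simp add: dist_commute)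
  qed
  then show "\<exists>d>0. \<forall>q\<in>{0..T} \<times> UNIV. dist q p < d \<longrightarrow> dist (z (fst q) (snd q)) (z (fst p) (snd p)) < e"
    using d1(1) d2(1) tx by (intro exI[of _ "min d1 d2"]) auto
qed

lemma C_Cc_linear:
  fixes a b :: real
  assumes y: "y \<in> C_Cc T" and z: "z \<in> C_Cc T"
  shows "(\<lambda>t x. a * y t x + b * z t x) \<in> C_Cc T"
proof -
  obtain K K' where K: "compact K" "\<And>t x. t \<in> {0..T} \<Longrightarrow> x \<notin> K \<Longrightarrow> y t x = 0"
    and K': "compact K'" "\<And>t x. t \<in> {0..T} \<Longrightarrow> x \<notin> K' \<Longrightarrow> z t x = 0"
    using y z unfolding C_Cc_def by blast
  show ?thesis
  proof (rule C_CcI[of T _ "K \<union> K'"])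
    show "continuous_on ({0..T} \<times> UNIV) (\<lambda>p. a * y (fst p) (snd p) + b * z (fst p) (snd p))"
      by (intro continuous_intros C_Cc_jointly_continuous y z)
  qed (use K K' in auto)
qed

lemma C_Cc_travelling:
  fixes \<rho> w :: "real \<Rightarrow> real"
  assumes \<rho>: "continuous_on UNIV \<rho>" "\<forall>x. R < \<bar>x\<bar> \<longrightarrow> \<rho> x = 0" and w: "continuous_on {0..T} w"
  shows "(\<lambda>t x. \<rho> (x - c * t) * w t) \<in> C_Cc T"
proof (rule C_CcI)
  define K where "K = {- (\<bar>R\<bar> + \<bar>c\<bar> * \<bar>T\<bar>) .. \<bar>R\<bar> + \<bar>c\<bar> * \<bar>T\<bar>}"
  show "continuous_on ({0..T} \<times> UNIV) (\<lambda>p. \<rho> (snd p - c * fst p) * w (fst p))"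
    by (intro continuous_intros continuous_on_compose2[OF \<rho>(1)] continuous_on_compose2[OF w]) auto
  show "compact K" by (simp add: K_def)
  show "\<rho> (x - c * t) * w t = 0" if "t \<in> {0..T}" "x \<notin> K" for t x
  proof -
    have "\<bar>c * t\<bar> \<le> \<bar>c\<bar> * \<bar>T\<bar>" using that by (auto simp: abs_mult intro!: mult_left_mono)
    then have "R < \<bar>x - c * t\<bar>" using that(2) unfolding K_def by auto
    then show ?thesis using \<rho>(2) by simp
  qed
qed

text \<open>
  By the mean value theorem the difference quotient at \<open>x\<close> is a value of \<open>f'\<close> at an intermediate
  time, which may depend on \<open>x\<close>; uniform convergence of \<open>f'\<close> makes this dependence harmless.
\<close>

lemma uniform_limit_difference_quotient:
  fixes f f' :: "real \<Rightarrow> real \<Rightarrow> real"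
  assumes D: "\<And>t x. t \<in> {0..T} \<Longrightarrow> ((\<lambda>s. f s x) has_real_derivative f' t x) (at t)"
    and lim: "uniform_limit UNIV f' (f' t) (at t within {0..T})" and t: "t \<in> {0..T}"
  shows "uniform_limit UNIV (\<lambda>s x. (f s x - f t x) / (s - t)) (f' t) (at t within {0..T})"
proof (rule uniform_limitI)
  fix e :: real assume "0 < e"
  from uniform_limitD[OF lim this]
  obtain d where d: "0 < d"
    and "\<forall>s\<in>{0..T}. s \<noteq> t \<and> dist s t < d \<longrightarrow> (\<forall>x\<in>UNIV. dist (f' s x) (f' t x) < e)"
    unfolding eventually_at by metis
  then have near: "dist (f' s x) (f' t x) < e" if "s \<in> {0..T}" "s \<noteq> t" "dist s t < d" for s x
    using that by simp
  have "dist ((f s x - f t x) / (s - t)) (f' t x) < e"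
    if s: "s \<in> {0..T}" "s \<noteq> t" "dist s t < d" for s x
  proof -
    have "\<exists>r. r \<in> {0..T} \<and> r \<noteq> t \<and> dist r t < d \<and> (f s x - f t x) / (s - t) = f' r x"
    proof (cases "s < t")
      case True
      then obtain r where "s < r" "r < t" "f t x - f s x = (t - s) * f' r x"
        using MVT2[of s t "\<lambda>s. f s x" "\<lambda>s. f' s x"] D s t by auto
      then show ?thesis using s t True
        by (intro exI[of _ r]) (auto simp: dist_real_def field_simps)
    next
      case False
      then obtain r where "t < r" "r < s" "f s x - f t x = (s - t) * f' r x"
        using MVT2[of t s "\<lambda>s. f s x" "\<lambda>s. f' s x"] D s t by force
      then show ?thesis using s t False
        by (intro exI[of _ r]) (auto simp: dist_real_def field_simps)
    qed
    then show ?thesis using near by metis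
  qed
  then show "\<forall>\<^sub>F s in at t within {0..T}. \<forall>x\<in>UNIV. dist ((f s x - f t x) / (s - t)) (f' t x) < e"
    unfolding eventually_at using d by blast
qed

text \<open>
  The mixed derivative enters because the time derivative of a \<open>C\<^sup>1\<close> map into \<open>C\<^sup>1\<^sub>c\<close> again takes
  values in \<open>C\<^sup>1\<^sub>c\<close>.
\<close>

lemma C1_Cc1I:
  fixes z zx zt ztx :: "real \<Rightarrow> real \<Rightarrow> real"
  assumes C: "z \<in> C_Cc T" "zx \<in> C_Cc T" "zt \<in> C_Cc T" "ztx \<in> C_Cc T"
    and zx: "\<And>t x. t \<in> {0..T} \<Longrightarrow> (z t has_real_derivative zx t x) (at x)"
    and ztx: "\<And>t x. t \<in> {0..T} \<Longrightarrow> (zt t has_real_derivative ztx t x) (at x)"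
    and zt: "\<And>t x. t \<in> {0..T} \<Longrightarrow> ((\<lambda>s. z s x) has_real_derivative zt t x) (at t)"
    and zxt: "\<And>t x. t \<in> {0..T} \<Longrightarrow> ((\<lambda>s. zx s x) has_real_derivative ztx t x) (at t)"
  shows "z \<in> C1_Cc1 T"
proof -
  have dz: "deriv (z t) = zx t" "deriv (zt t) = ztx t" if "t \<in> {0..T}" for t
    using zx[OF that] ztx[OF that] by (auto intro!: DERIV_imp_deriv)
  have cong: "(\<lambda>t. deriv (z t)) \<in> C_Cc T" "(\<lambda>t. deriv (zt t)) \<in> C_Cc T"
  proof -
    have *: "w' \<in> C_Cc T" if "w \<in> C_Cc T" and w': "\<And>t. t \<in> {0..T} \<Longrightarrow> w' t = w t" for w w'
    proof -
      have "uniform_limit UNIV w' (w' t) (at t within {0..T})" if "t \<in> {0..T}" for t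
      proof -
        have l: "uniform_limit UNIV w (w t) (at t within {0..T})"
          using \<open>w \<in> C_Cc T\<close> that by (auto simp: C_Cc_def)
        have ev: "\<forall>\<^sub>F s in at t within {0..T}. s \<in> {0..T}" by (simp add: eventually_at_filter)
        show ?thesis
        proof (rule uniform_limitI)
          fix e :: real assume "0 < e"
          from uniform_limitD[OF l this] ev
          show "\<forall>\<^sub>F s in at t within {0..T}. \<forall>x\<in>UNIV. dist (w' s x) (w' t x) < e"
            by eventually_elim (simp add: w' w'[OF that])
        qed
      qed
      then show ?thesis using that unfolding C_Cc_def by auto
    qed
    show "(\<lambda>t. deriv (z t)) \<in> C_Cc T" by (rule *[OF C(2)]) (rule dz)
    show "(\<lambda>t. deriv (zt t)) \<in> C_Cc T" by (rule *[OF C(4)]) (rule dz)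
  qed
  have fd: "\<forall>t\<in>{0..T}. \<forall>x. z t field_differentiable (at x)"
     "\<forall>t\<in>{0..T}. \<forall>x. zt t field_differentiable (at x)"
    using zx ztx unfolding field_differentiable_def by blast+
  have lim: "uniform_limit UNIV (\<lambda>s x. (z s x - z t x) / (s - t)) (zt t) (at t within {0..T})"
    if "t \<in> {0..T}" for t
    using zt that C(3) by (intro uniform_limit_difference_quotient) (auto simp: C_Cc_def)
  have limx: "uniform_limit UNIV (\<lambda>s x. (deriv (z s) x - deriv (z t) x) / (s - t)) (deriv (zt t)) (at t within {0..T})"
    if t: "t \<in> {0..T}" for t
  proof -
    have l: "uniform_limit UNIV (\<lambda>s x. (zx s x - zx t x) / (s - t)) (ztx t) (at t within {0..T})"
      using zxt t C(4) by (intro uniform_limit_difference_quotient) (auto simp: C_Cc_def)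
    have ev: "\<forall>\<^sub>F s in at t within {0..T}. s \<in> {0..T}" by (simp add: eventually_at_filter)
    show ?thesis
    proof (rule uniform_limitI)
      fix e :: real assume "0 < e"
      from uniform_limitD[OF l this] ev
      show "\<forall>\<^sub>F s in at t within {0..T}. \<forall>x\<in>UNIV.
          dist ((deriv (z s) x - deriv (z t) x) / (s - t)) (deriv (zt t) x) < e"
        by eventually_elim (simp add: dz dz[OF t])
    qed
  qed
  have "z \<in> C_Cc1 T" "zt \<in> C_Cc1 T"
    using C cong fd by (auto simp: C_Cc1_def)
  then show ?thesis
    unfolding C1_Cc1_def using lim limx by (intro CollectI conjI bexI[of _ zt] ballI) auto
qed

section \<open>Twice continuously differentiable profiles\<close>

text \<open>
  Profiles of travelling test functions: the time derivative of \<open>\<rho>(x - c t)\<close> contains \<open>\<rho>'\<close> and must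
  be continuously differentiable in \<open>x\<close>, so that \<open>\<rho>\<close> needs two derivatives.
\<close>

definition C2 :: "(real \<Rightarrow> real) \<Rightarrow> bool" where
  "C2 f \<longleftrightarrow> (\<exists>f1 f2. (\<forall>x. (f has_real_derivative f1 x) (at x)) \<and>
     (\<forall>x. (f1 has_real_derivative f2 x) (at x)) \<and> continuous_on UNIV f2)"

lemma C2I:
  assumes "\<And>x. (f has_real_derivative f1 x) (at x)" "\<And>x. (f1 has_real_derivative f2 x) (at x)"
    "continuous_on UNIV f2"
  shows "C2 f"
  unfolding C2_def by (intro exI[of _ f1] exI[of _ f2] conjI allI assms)

lemma C2D:
  assumes "C2 f"
  shows "(f has_real_derivative deriv f x) (at x)"
    "(deriv f has_real_derivative deriv (deriv f) x) (at x)" "continuous_on A (deriv (deriv f))"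
    "continuous_on A f" "continuous_on A (deriv f)"
proof -
  obtain f1 f2 where f: "\<And>x. (f has_real_derivative f1 x) (at x)"
    "\<And>x. (f1 has_real_derivative f2 x) (at x)" "continuous_on UNIV f2"
    using assms unfolding C2_def by blast
  have d: "deriv f = f1" "deriv f1 = f2" using f by (auto intro!: DERIV_imp_deriv)
  show "(f has_real_derivative deriv f x) (at x)"
    "(deriv f has_real_derivative deriv (deriv f) x) (at x)" "continuous_on A (deriv (deriv f))"
    unfolding d by (rule f continuous_on_subset[OF f(3) subset_UNIV])+
  show "continuous_on A f" "continuous_on A (deriv f)"
    unfolding d using f by (meson DERIV_isCont continuous_at_imp_continuous_on)+
qed

lemma C2_affine: "C2 (\<lambda>x. a * x + b)"
  by (rule C2I[of _ "\<lambda>_. a" "\<lambda>_. 0"]) (auto intro!: derivative_eq_intros)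

lemma C2_const: "C2 (\<lambda>x. c)"
  using C2_affine[of 0 c] by simp

lemma C2_exp: "C2 exp"
  by (rule C2I[of _ exp exp]) (auto intro!: continuous_intros)

lemma C2_add:
  assumes "C2 f" "C2 g" shows "C2 (\<lambda>x. f x + g x)"
proof (rule C2I)
  note F = C2D[OF assms(1)] and G = C2D[OF assms(2)]
  show "((\<lambda>x. f x + g x) has_real_derivative deriv f x + deriv g x) (at x)"
    "((\<lambda>x. deriv f x + deriv g x) has_real_derivative deriv (deriv f) x + deriv (deriv g) x) (at x)" for x
    by (intro DERIV_add F G)+
  show "continuous_on UNIV (\<lambda>x. deriv (deriv f) x + deriv (deriv g) x)" by (intro continuous_intros F G)
qed

lemma C2_mult:
  assumes "C2 f" "C2 g" shows "C2 (\<lambda>x. f x * g x)"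
proof (rule C2I)
  note F = C2D[OF assms(1)] and G = C2D[OF assms(2)]
  let ?f2 = "\<lambda>x. (deriv (deriv f) x * g x + deriv g x * deriv f x) + (deriv (deriv g) x * f x + deriv f x * deriv g x)"
  show "((\<lambda>x. f x * g x) has_real_derivative deriv f x * g x + deriv g x * f x) (at x)"
    "((\<lambda>x. deriv f x * g x + deriv g x * f x) has_real_derivative ?f2 x) (at x)" for x
    by (intro DERIV_add DERIV_mult F G)+
  show "continuous_on UNIV ?f2" by (intro continuous_intros F G)
qed

lemma C2_compose:
  assumes "C2 f" "C2 g" shows "C2 (\<lambda>x. f (g x))"
proof (rule C2I)
  note F = C2D[OF assms(1)] and G = C2D[OF assms(2)]
  let ?f2 = "\<lambda>x. (deriv (deriv f) (g x) * deriv g x) * deriv g x + deriv (deriv g) x * deriv f (g x)"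
  show "((\<lambda>x. f (g x)) has_real_derivative deriv f (g x) * deriv g x) (at x)"
    "((\<lambda>x. deriv f (g x) * deriv g x) has_real_derivative ?f2 x) (at x)" for x
    by (intro DERIV_mult DERIV_chain2 F G)+
  show "continuous_on UNIV ?f2"
    by (intro continuous_intros G continuous_on_compose2[OF F(3)] continuous_on_compose2[OF F(5)]) auto
qed

lemma has_derivative_max_0_power:
  "((\<lambda>y::real. max 0 y ^ Suc (Suc n)) has_real_derivative real (Suc (Suc n)) * max 0 y ^ Suc n) (at y)"
proof (cases "y = 0")
  case True
  have "(\<lambda>h::real. \<bar>h\<bar> ^ Suc n) \<midarrow>0\<rightarrow> \<bar>0\<bar> ^ Suc n" by (intro tendsto_intros)
  then have l: "(\<lambda>h::real. \<bar>h\<bar> ^ Suc n) \<midarrow>0\<rightarrow> 0" by simp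
  have "(\<lambda>h::real. max 0 h ^ Suc (Suc n) / h) \<midarrow>0\<rightarrow> 0"
  proof (rule Lim_null_comparison[OF _ l], intro always_eventually allI)
    show "norm (max 0 h ^ Suc (Suc n) / h) \<le> \<bar>h\<bar> ^ Suc n" for h :: real
      by (cases "0 < h") (auto simp: max_def mult_nonpos_nonneg)
  qed
  then show ?thesis using True by (simp add: DERIV_def)
next
  case False
  show ?thesis
  proof (cases "y > 0")
    case True
    have "((\<lambda>y::real. y ^ Suc (Suc n)) has_real_derivative real (Suc (Suc n)) * y ^ Suc n) (at y)"
      using DERIV_pow[of "Suc (Suc n)" y UNIV] by simp
    then have "((\<lambda>y::real. max 0 y ^ Suc (Suc n)) has_real_derivative real (Suc (Suc n)) * y ^ Suc n) (at y)"
      by (rule has_field_derivative_transform_within_open[where S = "{0<..}"]) (use True in auto)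
    then show ?thesis using True by simp
  next
    case neg: False
    have "((\<lambda>y::real. 0) has_real_derivative 0) (at y)" by simp
    then have "((\<lambda>y::real. max 0 y ^ Suc (Suc n)) has_real_derivative 0) (at y)"
      by (rule has_field_derivative_transform_within_open[where S = "{..<0}"]) (use False neg in auto)
    then show ?thesis using neg by simp
  qed
qed

lemma has_derivative_max_0_cube:
  "((\<lambda>y::real. max 0 y ^ 3) has_real_derivative 3 * (max 0 y)\<^sup>2) (at y)"
  using has_derivative_max_0_power[of 1 y] by (simp add: numeral_3_eq_3 numeral_2_eq_2)

lemma C2_max_0_cube: "C2 (\<lambda>y. max 0 y ^ 3)"
proof (rule C2I)
  show "((\<lambda>y::real. 3 * max 0 y ^ 2) has_real_derivative 3 * (2 * max 0 y)) (at y)" for y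
    using has_derivative_max_0_power[of 0 y] by (intro DERIV_cmult) (simp add: numeral_2_eq_2)
qed (intro has_derivative_max_0_cube continuous_intros)+

lemma deriv_eq_0_outside_support:
  fixes f :: "real \<Rightarrow> real"
  assumes f: "\<forall>x. R < \<bar>x\<bar> \<longrightarrow> f x = 0" and D: "\<And>x. (f has_real_derivative f' x) (at x)"
  shows "\<forall>x. R < \<bar>x\<bar> \<longrightarrow> f' x = 0"
proof (intro allI impI)
  fix x assume x: "R < \<bar>x\<bar>"
  have "((\<lambda>_. 0) has_real_derivative f' x) (at x)"
    using x f by (intro has_field_derivative_transform_within_open[OF D, of "{x. R < \<bar>x\<bar>}"])
      (auto intro!: open_Collect_less continuous_intros)
  then show "f' x = 0" using DERIV_const DERIV_unique by blast
qed

text \<open>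
  Test functions that move with speed \<open>c\<close>: for them \<open>\<zeta>\<^sub>t + c \<zeta>\<^sub>x\<close> involves no
  derivative of the profile.
\<close>

lemma travelling_test_function:
  fixes \<rho> g w :: "real \<Rightarrow> real" and c :: real
  assumes \<rho>: "C2 \<rho>" "\<forall>x. R < \<bar>x\<bar> \<longrightarrow> \<rho> x = 0"
    and w: "continuous_on {0..T} w" and g: "\<forall>t\<in>{0..T}. (g has_real_derivative w t) (at t)"
  defines "z \<equiv> (\<lambda>t x. \<rho> (x - c * t) * g t)"
    and "zx \<equiv> (\<lambda>t x. deriv \<rho> (x - c * t) * g t)"
    and "zt \<equiv> (\<lambda>t x. \<rho> (x - c * t) * w t - c * (deriv \<rho> (x - c * t) * g t))"
  shows "z \<in> C1_Cc1 T" "zx \<in> C_Cc T" "zt \<in> C_Cc T"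
    and "dx z t x = zx t x" "t \<in> {0..T} \<Longrightarrow> dt z t x = zt t x"
proof -
  note r = C2D[OF \<rho>(1)]
  note r1_0 = deriv_eq_0_outside_support[OF \<rho>(2) r(1)]
  note r2_0 = deriv_eq_0_outside_support[OF r1_0 r(2)]
  have cg: "continuous_on {0..T} g" using g by (meson DERIV_isCont continuous_at_imp_continuous_on)
  define ztx where "ztx = (\<lambda>t x. deriv \<rho> (x - c * t) * w t - c * (deriv (deriv \<rho>) (x - c * t) * g t))"
  note C = C_Cc_travelling[OF r(4) \<rho>(2) w, where c = c] C_Cc_travelling[OF r(5) r1_0 w, where c = c]
    C_Cc_travelling[OF r(4) \<rho>(2) cg, where c = c] C_Cc_travelling[OF r(5) r1_0 cg, where c = c]
    C_Cc_travelling[OF r(3) r2_0 cg, where c = c]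
  have zC: "z \<in> C_Cc T" unfolding z_def by (rule C(3))
  show zxC: "zx \<in> C_Cc T" unfolding zx_def by (rule C(4))
  show ztC: "zt \<in> C_Cc T" unfolding zt_def using C_Cc_linear[OF C(1) C(4), of 1 "- c"] by simp
  have ztxC: "ztx \<in> C_Cc T" unfolding ztx_def using C_Cc_linear[OF C(2) C(5), of 1 "- c"] by simp
  have lx: "((\<lambda>x. x - c * t) has_real_derivative 1) (at x)"
    and lt: "((\<lambda>t. x - c * t) has_real_derivative - c) (at t)" for x t
    by (auto intro!: derivative_eq_intros)
  note chx = DERIV_chain2[OF r(1) lx] DERIV_chain2[OF r(2) lx]
  note cht = DERIV_chain2[OF r(1) lt] DERIV_chain2[OF r(2) lt]
  have Dz: "(z t has_real_derivative zx t x) (at x)" for t x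
    unfolding z_def zx_def using DERIV_cmult_right[OF chx(1)] by simp
  have Dzt: "((\<lambda>s. z s x) has_real_derivative zt t x) (at t)" if "t \<in> {0..T}" for t x
    unfolding z_def zt_def using DERIV_mult[OF cht(1) bspec[OF g that]] by (simp add: algebra_simps)
  have Dzxt: "((\<lambda>s. zx s x) has_real_derivative ztx t x) (at t)" if "t \<in> {0..T}" for t x
    unfolding zx_def ztx_def using DERIV_mult[OF cht(2) bspec[OF g that]] by (simp add: algebra_simps)
  have Dztx: "(zt t has_real_derivative ztx t x) (at x)" for t x
    unfolding zt_def ztx_def
    using DERIV_diff[OF DERIV_cmult_right[OF chx(1)] DERIV_cmult[OF DERIV_cmult_right[OF chx(2)]]] by simp
  show "z \<in> C1_Cc1 T"
    by (rule C1_Cc1I[OF zC zxC ztC ztxC]) (use Dz Dzt Dzxt Dztx in auto)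
  show "dx z t x = zx t x" using DERIV_imp_deriv[OF Dz] by (simp add: dx_def)
  show "t \<in> {0..T} \<Longrightarrow> dt z t x = zt t x" using DERIV_imp_deriv[OF Dzt] by (simp add: dt_def)
qed

section \<open>Smooth approximations of open sets\<close>

text \<open>
  A twice continuously differentiable function that is positive exactly on an open interval. The map
  \<open>s \<mapsto> 1 - exp (- n s)\<close> then turns sums of humps into functions that tend to the indicator of a finite
  union of intervals and keep the regularity and the support of the sum.
\<close>

definition hump :: "real \<times> real \<Rightarrow> real \<Rightarrow> real" where
  "hump I x = max 0 (x - fst I) ^ 3 * max 0 (snd I - x) ^ 3"

definition plateau :: "nat \<Rightarrow> (real \<times> real) list \<Rightarrow> real \<Rightarrow> real" where
  "plateau n L x = 1 - exp (- (real n * (\<Sum>I\<leftarrow>L. hump I x)))"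

lemma hump_nonneg: "0 \<le> hump I x"
  by (simp add: hump_def)

lemma hump_pos: "0 < hump I x \<longleftrightarrow> x \<in> {fst I<..<snd I}"
  by (auto simp: hump_def zero_less_mult_iff max_def)

lemma C2_hump: "C2 (hump I)"
proof -
  have "C2 (\<lambda>x. max 0 (1 * x + (- fst I)) ^ 3)" "C2 (\<lambda>x. max 0 ((- 1) * x + snd I) ^ 3)"
    by (intro C2_compose[OF C2_max_0_cube] C2_affine)+
  from C2_mult[OF this] show ?thesis unfolding hump_def[abs_def] by simp
qed

lemma C2_plateau: "C2 (plateau n L)"
proof -
  have *: "C2 (\<lambda>x. \<Sum>I\<leftarrow>L. hump I x)"
    by (induction L) (auto intro: C2_const C2_add C2_hump)
  have "C2 (\<lambda>x. exp (- real n * (\<Sum>I\<leftarrow>L. hump I x)))"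
    by (intro C2_compose[OF C2_exp] C2_mult C2_const *)
  then have "C2 (\<lambda>x. 1 + (- 1) * exp (- real n * (\<Sum>I\<leftarrow>L. hump I x)))"
    by (intro C2_add C2_mult C2_const)
  then show ?thesis unfolding plateau_def[abs_def] by simp
qed

lemma plateau_bounds: "0 \<le> plateau n L x" "plateau n L x \<le> 1"
proof -
  have "0 \<le> (\<Sum>I\<leftarrow>L. hump I x)" by (intro sum_list_nonneg) (auto simp: hump_nonneg)
  then show "0 \<le> plateau n L x" "plateau n L x \<le> 1" by (auto simp: plateau_def)
qed

lemma plateau_bounded_support: "\<exists>R. \<forall>x. R < \<bar>x\<bar> \<longrightarrow> plateau n L x = 0"
proof -
  define R where "R = (\<Sum>I\<leftarrow>L. \<bar>fst I\<bar> + \<bar>snd I\<bar>)"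
  have "hump I x = 0" if "R < \<bar>x\<bar>" "I \<in> set L" for x I
  proof -
    have "\<bar>fst I\<bar> + \<bar>snd I\<bar> \<le> R"
      unfolding R_def using that(2) by (intro member_le_sum_list) auto
    then have "x \<notin> {fst I<..<snd I}" using that(1) by auto
    then show ?thesis using hump_pos[of I x] hump_nonneg[of I x] by linarith
  qed
  then have "plateau n L x = 0" if "R < \<bar>x\<bar>" for x
    using that by (simp add: plateau_def cong: map_cong)
  then show ?thesis by blast
qed

lemma plateau_tendsto_1:
  assumes h: "0 < h" and ev: "eventually (\<lambda>n. h \<le> (\<Sum>I\<leftarrow>L n. hump I x)) sequentially"
  shows "(\<lambda>n. plateau n (L n) x) \<longlonglongrightarrow> 1"
proof (rule tendsto_sandwich)
  show "eventually (\<lambda>n. 1 - exp (- (real n * h)) \<le> plateau n (L n) x) sequentially"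
    using ev by eventually_elim (simp add: plateau_def mult_left_mono)
  show "eventually (\<lambda>n. plateau n (L n) x \<le> 1) sequentially" by (simp add: plateau_bounds)
  have "(\<lambda>n. exp (- (real n * h))) \<longlonglongrightarrow> 0"
  proof -
    have "filterlim (\<lambda>n. real n * h) at_top sequentially"
      using h by (intro filterlim_at_top_mult_tendsto_pos[OF tendsto_const] filterlim_real_sequentially)
    then show ?thesis
      by (intro filterlim_compose[OF exp_at_bot]) (simp add: filterlim_uminus_at_bot)
  qed
  from tendsto_diff[OF tendsto_const[of 1] this]
  show "(\<lambda>n. 1 - exp (- (real n * h))) \<longlonglongrightarrow> 1" by simp
qed simp

lemma plateau_tendsto_interval:
  "(\<lambda>n. plateau n [(a, b)] x) \<longlonglongrightarrow> indicator {a<..<b} x"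
proof (cases "x \<in> {a<..<b}")
  case True
  then have "0 < hump (a, b) x" by (simp add: hump_pos)
  from plateau_tendsto_1[OF this, of _ "\<lambda>_. [(a, b)]"] show ?thesis using True by simp
next
  case False
  then have "hump (a, b) x = 0" using hump_pos[of "(a, b)" x] hump_nonneg[of "(a, b)" x] by force
  then show ?thesis using False by (simp add: plateau_def)
qed

text \<open>
  Rational endpoints suffice, so that a countable family of profiles reaches all open sets. This
  countability is what later allows the exceptional sets of times to be united.
\<close>

lemma plateau_tendsto_open:
  assumes U: "open U"
  shows "\<exists>L. (\<forall>n. L n \<in> lists (\<rat> \<times> \<rat>)) \<and> (\<forall>x. (\<lambda>n. plateau n (L n) x) \<longlonglongrightarrow> indicator U x)"
proof -
  define D where "D = {I \<in> \<rat> \<times> \<rat>. {fst I<..<snd I} \<subseteq> U}"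
  have D: "countable D" "D \<noteq> {}"
  proof -
    show "countable D" unfolding D_def
      by (rule countable_subset[of _ "\<rat> \<times> \<rat>"]) (auto intro!: countable_SIGMA countable_rat)
    have "(1, 0) \<in> D" by (auto simp: D_def)
    then show "D \<noteq> {}" by blast
  qed
  define f where "f = from_nat_into D"
  define L where "L n = map f [0..<n]" for n
  have f: "f i \<in> D" for i unfolding f_def using D(2) by (rule from_nat_into)
  have sum: "(\<Sum>I\<leftarrow>L n. hump I x) = (\<Sum>i<n. hump (f i) x)" for n x
    by (simp add: L_def interv_sum_list_conv_sum_set_nat o_def lessThan_atLeast0)
  have "(\<lambda>n. plateau n (L n) x) \<longlonglongrightarrow> indicator U x" for x
  proof (cases "x \<in> U")
    case True
    then obtain e where e: "0 < e" "ball x e \<subseteq> U" using U open_contains_ball by blast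
    obtain a where a: "a \<in> \<rat>" "x - e < a" "a < x" using Rats_dense_in_real[of "x - e" x] e by auto
    obtain b where b: "b \<in> \<rat>" "x < b" "b < x + e" using Rats_dense_in_real[of x "x + e"] e by auto
    have "{a<..<b} \<subseteq> ball x e" using a b by (auto simp: dist_real_def)
    then have "(a, b) \<in> D" using a b e by (auto simp: D_def)
    then obtain i where i: "f i = (a, b)" unfolding f_def using D(1) from_nat_into_surj by metis
    have pos: "0 < hump (f i) x" using i a b by (simp add: hump_pos)
    have "eventually (\<lambda>n. hump (f i) x \<le> (\<Sum>I\<leftarrow>L n. hump I x)) sequentially"
      using eventually_gt_at_top[of i]
      by eventually_elim (auto simp: sum hump_nonneg intro!: member_le_sum)
    from plateau_tendsto_1[OF pos this] show ?thesis using True by simp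
  next
    case False
    then have "hump (f i) x = 0" for i
      using f[of i] hump_pos[of "f i" x] hump_nonneg[of "f i" x] by (auto simp: D_def)
    then show ?thesis using False by (simp add: plateau_def sum)
  qed
  moreover have "L n \<in> lists (\<rat> \<times> \<rat>)" for n
  proof -
    have "f i \<in> \<rat> \<times> \<rat>" for i using f[of i] by (simp add: D_def)
    then show ?thesis by (induction n) (simp_all add: L_def)
  qed
  ultimately show ?thesis by blast
qed

section \<open>Time slices\<close>

lemma AE_strip_time_iff:
  "(AE t in lebesgue_on {0<..<T::real}. P t) \<longleftrightarrow> (AE t in lebesgue. t \<in> {0<..<T} \<longrightarrow> P t)"
  by (rule AE_restrict_space_iff) simp

lemma strip_borel [measurable]: "strip T \<in> sets borel"
  unfolding strip_def by (intro borel_open open_Times) auto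

lemma measurable_Mplus_strip:
  assumes "u \<in> Mplus (strip T)" "f \<in> borel_measurable borel"
  shows "f \<in> borel_measurable u"
proof -
  have "sets u = sets (restrict_space borel (strip T))" using assms by (simp add: Mplus_def)
  then show ?thesis
    using measurable_restrict_space1[OF assms(2)] by (simp cong: measurable_cong_sets)
qed

lemma box_prod_eq: "box p q = {fst p<..<fst q} \<times> {snd p<..<snd q}" for p q :: "real \<times> real"
  by (cases p; cases q) (auto simp: box_def Basis_prod_def)

lemma slice_measurable:
  assumes "A \<in> sets (borel :: (real \<times> real) measure)"
  shows "{x. (x, t) \<in> A} \<in> sets borel"
proof -
  have "(\<lambda>x. (x, t)) -` A \<inter> space borel \<in> sets borel"
    by (rule measurable_sets[OF _ assms]) (auto intro!: borel_measurable_continuous_onI continuous_intros)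
  then show ?thesis by (simp add: vimage_def)
qed

text \<open>
  The defining property of the slices tests against continuous functions only. Tensor products of
  plateau functions extend it to rectangles, and Dynkin's lemma to all Borel sets.
\<close>

lemma slice_kernel:
  assumes L: "Linf_Mplus T u v"
  obtains K :: "real \<Rightarrow> real measure" and C where
    "\<And>t. K t \<in> Mplus UNIV" "\<And>t. Mnorm (K t) \<le> C" "0 \<le> C"
    "AE t in lebesgue. t \<in> {0<..<T} \<longrightarrow> K t = v t"
    "\<And>t. t \<notin> {0<..<T} \<Longrightarrow> emeasure (K t) UNIV = 0"
    "\<And>A. A \<in> sets borel \<Longrightarrow> (\<lambda>t. emeasure (K t) {x. (x, t) \<in> A}) \<in> borel_measurable lebesgue"
    "\<And>A. A \<in> sets borel \<Longrightarrow> (\<integral>\<^sup>+ t. emeasure (K t) {x. (x, t) \<in> A} \<partial>lebesgue) = emeasure u (A \<inter> strip T)"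
proof -
  from L obtain C0 where C0: "AE t in lebesgue_on {0<..<T}. Mnorm (v t) \<le> C0"
    unfolding Linf_Mplus_def by blast
  define C where "C = max C0 0"
  \<comment> \<open>Outside \<open>(0, T)\<close>, and at the negligibly many times where the slice violates its bounds, \<open>K\<close> is zero.\<close>
  define K where "K t = (if t \<in> {0<..<T} \<and> v t \<in> Mplus UNIV \<and> Mnorm (v t) \<le> C then v t else null_measure borel)" for t
  have u: "u \<in> Mplus (strip T)" using L by (simp add: Linf_Mplus_def)
  interpret u: finite_measure u using u by (simp add: Mplus_def)
  have su: "sets u = sets (restrict_space borel (strip T))" using u by (simp add: Mplus_def)
  have spu: "space u = strip T" using sets_eq_imp_space_eq[OF su] by (simp add: space_restrict_space)
  have K: "K t \<in> Mplus UNIV" "Mnorm (K t) \<le> C" for t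
    by (auto simp: K_def Mplus_UNIV Mnorm_def C_def intro!: finite_measureI)
  have fK: "finite_measure (K t)" and sK: "sets (K t) = sets borel" and spK: "space (K t) = UNIV" for t
    using K(1)[of t] sets_eq_imp_space_eq[of "K t" borel] by (auto simp: Mplus_UNIV)
  have Kout: "emeasure (K t) A = 0" if "t \<notin> {0<..<T}" for t A
    using that by (auto simp: K_def)
  have KC: "measure (K t) A \<le> C" for t A
  proof -
    interpret finite_measure "K t" by (rule fK)
    show ?thesis using bounded_measure[of A] K(2)[of t] by (simp add: Mnorm_def)
  qed
  have C: "0 \<le> C" by (simp add: C_def)
  have AEK: "AE t in lebesgue. t \<in> {0<..<T} \<longrightarrow> K t = v t"
  proof -
    have "AE t in lebesgue. t \<in> {0<..<T} \<longrightarrow> v t \<in> Mplus UNIV"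
      "AE t in lebesgue. t \<in> {0<..<T} \<longrightarrow> Mnorm (v t) \<le> C0"
      using L C0 by (simp_all add: Linf_Mplus_def AE_strip_time_iff)
    then show ?thesis by eventually_elim (auto simp: K_def C_def)
  qed
  let ?k = "\<lambda>A t. emeasure (K t) {x. (x, t) \<in> A}"
  define P where "P A \<longleftrightarrow> (\<lambda>t. ?k A t) \<in> borel_measurable lebesgue \<and>
    (\<integral>\<^sup>+ t. ?k A t \<partial>lebesgue) = emeasure u (A \<inter> strip T)" for A
  have basic: "P ({a<..<b} \<times> {c<..<d})" for a b c d :: real
  proof -
    define z where "z n t x = plateau n [(c, d)] t * plateau n [(a, b)] x" for n t x
    define f where "f n t = plateau n [(c, d)] t * (\<integral>x. plateau n [(a, b)] x \<partial>K t)" for n t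
    define F where "F t = indicator {c<..<d} t * measure (K t) {a<..<b}" for t
    have contp: "continuous_on UNIV (plateau n J)" for n J by (rule C2D(4)[OF C2_plateau])
    have mp[measurable]: "plateau n J \<in> borel_measurable borel" for n J
      by (rule borel_measurable_continuous_onI[OF contp])
    have zC: "z n \<in> C_Cc T" for n
    proof -
      obtain R where R: "\<And>x. R < \<bar>x\<bar> \<Longrightarrow> plateau n [(a, b)] x = 0"
        using plateau_bounded_support by blast
      show ?thesis
      proof (rule C_CcI[of T _ "{- \<bar>R\<bar> .. \<bar>R\<bar>}"])
        show "continuous_on ({0..T} \<times> UNIV) (\<lambda>p. z n (fst p) (snd p))"
          unfolding z_def
          by (intro continuous_intros continuous_on_compose2[OF contp]) auto
        show "z n t x = 0" if "x \<notin> {- \<bar>R\<bar> .. \<bar>R\<bar>}" for t x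
        proof -
          have "R < \<bar>x\<bar>" using that by auto
          then show ?thesis by (simp add: z_def R)
        qed
      qed simp
    qed
    have int: "set_integrable lebesgue {0<..<T} (\<lambda>t. LINT x|v t. z n t x)"
      and eq: "(LINT p|u. z n (snd p) (fst p)) = (LINT t:{0<..<T}|lebesgue. LINT x|v t. z n t x)" for n
      using L zC[of n] by (auto simp: Linf_Mplus_def)
    have ae: "AE t in lebesgue. indicator {0<..<T} t *\<^sub>R (LINT x|v t. z n t x) = f n t" for n
      using AEK
    proof eventually_elim
      case (elim t)
      show ?case
      proof (cases "t \<in> {0<..<T}")
        case True
        then show ?thesis using elim by (simp add: f_def z_def)
      next
        case False
        then have "K t = null_measure borel" unfolding K_def by (intro if_not_P) auto
        then show ?thesis using False by (simp add: f_def)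
      qed
    qed
    have mf: "f n \<in> borel_measurable lebesgue" for n
      using borel_measurable_AE[OF _ ae] borel_measurable_integrable[OF int[unfolded set_integrable_def]]
      by blast
    have "(\<lambda>n. \<integral>x. plateau n [(a, b)] x \<partial>K t) \<longlonglongrightarrow> (\<integral>x. indicator {a<..<b} x \<partial>K t)" for t
    proof -
      interpret finite_measure "K t" by (rule fK)
      have [measurable_cong]: "sets (K t) = sets borel" by (rule sK)
      show ?thesis
      proof (rule integral_dominated_convergence[where w = "\<lambda>_. 1"])
        show "AE x in K t. (\<lambda>n. plateau n [(a, b)] x) \<longlonglongrightarrow> indicator {a<..<b} x"
          by (rule AE_I2) (rule plateau_tendsto_interval)
        show "AE x in K t. norm (plateau n [(a, b)] x) \<le> 1" for n
          by (rule AE_I2) (use plateau_bounds[of n] in auto)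
      qed auto
    qed
    then have lim: "(\<lambda>n. f n t) \<longlonglongrightarrow> F t" for t
      unfolding f_def F_def by (intro tendsto_mult plateau_tendsto_interval) (simp add: sK spK)
    have mF: "F \<in> borel_measurable lebesgue"
      by (rule borel_measurable_LIMSEQ_real[OF lim mf])
    have bnd: "norm (f n t) \<le> indicator {0<..<T} t * C" for n t
    proof (cases "t \<in> {0<..<T}")
      case True
      interpret finite_measure "K t" by (rule fK)
      have [measurable_cong]: "sets (K t) = sets borel" by (rule sK)
      have "norm (\<integral>x. plateau n [(a, b)] x \<partial>K t) \<le> (\<integral>x. 1 \<partial>K t)"
        by (intro Bochner_Integration.integral_norm_bound_integral integrable_const_bound[where B = 1])
           (auto simp: plateau_bounds)
      also have "\<dots> \<le> C" using KC[of t UNIV] by (simp add: spK)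
      finally have "norm (\<integral>x. plateau n [(a, b)] x \<partial>K t) \<le> C" .
      then have "norm (f n t) \<le> 1 * C"
        unfolding f_def norm_mult using plateau_bounds[of n] by (intro mult_mono) auto
      then show ?thesis using True by simp
    next
      case False
      then have "K t = null_measure borel" unfolding K_def by (intro if_not_P) auto
      then show ?thesis using False by (simp add: f_def)
    qed
    have iw: "integrable lebesgue (\<lambda>t. indicator {0<..<T} t * C)"
      by (intro integrable_mult_left integrable_real_indicator) (simp, cases "0 \<le> T", auto)
    have c1: "(\<lambda>n. \<integral>t. f n t \<partial>lebesgue) \<longlonglongrightarrow> (\<integral>t. F t \<partial>lebesgue)"
      by (rule integral_dominated_convergence[OF mF mf iw]) (use lim bnd in auto)
    have iF: "integrable lebesgue F"
      by (rule integrable_dominated_convergence[OF mF, of f, OF mf iw]) (use lim bnd in auto)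
    have "(\<integral>t. f n t \<partial>lebesgue) = (LINT p|u. z n (snd p) (fst p))" for n
      unfolding eq set_lebesgue_integral_def
      using borel_measurable_integrable[OF int[unfolded set_integrable_def]] ae[of n] mf
      by (intro integral_cong_AE) (auto simp: eq_commute)
    moreover have "(\<lambda>n. LINT p|u. z n (snd p) (fst p)) \<longlonglongrightarrow> (LINT p|u. indicator ({a<..<b} \<times> {c<..<d}) p)"
    proof (rule integral_dominated_convergence[where w = "\<lambda>_. 1"])
      have [measurable]: "{a<..<b} \<times> {c<..<d} \<in> sets borel" by (intro borel_open open_Times) auto
      show "(\<lambda>p. indicator ({a<..<b} \<times> {c<..<d}) p :: real) \<in> borel_measurable u"
        by (rule measurable_Mplus_strip[OF u]) simp
      show "(\<lambda>p. z n (snd p) (fst p)) \<in> borel_measurable u" for n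
        unfolding z_def by (intro measurable_Mplus_strip[OF u] borel_measurable_continuous_onI
            continuous_intros continuous_on_compose2[OF contp]) auto
      have "(\<lambda>n. z n (snd p) (fst p)) \<longlonglongrightarrow> indicator {c<..<d} (snd p) * indicator {a<..<b} (fst p)" for p
        unfolding z_def by (intro tendsto_mult plateau_tendsto_interval)
      moreover have "indicator {c<..<d} (snd p) * indicator {a<..<b} (fst p) =
        (indicator ({a<..<b} \<times> {c<..<d}) p :: real)" for p
        by (cases p) (auto simp: indicator_def)
      ultimately show "AE p in u. (\<lambda>n. z n (snd p) (fst p)) \<longlonglongrightarrow> indicator ({a<..<b} \<times> {c<..<d}) p"
        by simp
      show "AE p in u. norm (z n (snd p) (fst p)) \<le> 1" for n
        using plateau_bounds[of n] by (auto simp: z_def abs_mult intro!: mult_le_one)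
    qed auto
    ultimately have "(\<integral>t. F t \<partial>lebesgue) = (LINT p|u. indicator ({a<..<b} \<times> {c<..<d}) p)"
      using c1 LIMSEQ_unique by simp
    also have "\<dots> = measure u (({a<..<b} \<times> {c<..<d}) \<inter> strip T)" by (simp add: spu)
    finally have eqF: "(\<integral>t. F t \<partial>lebesgue) = measure u (({a<..<b} \<times> {c<..<d}) \<inter> strip T)" .
    have Fpos: "0 \<le> F t" for t by (simp add: F_def)
    have KF: "emeasure (K t) {x. (x, t) \<in> {a<..<b} \<times> {c<..<d}} = ennreal (F t)" for t
    proof -
      interpret finite_measure "K t" by (rule fK)
      show ?thesis by (auto simp: F_def indicator_def emeasure_eq_measure greaterThanLessThan_def greaterThan_def lessThan_def Int_def)
    qed
    show ?thesis
      unfolding P_def KF using mF nn_integral_eq_integral[OF iF] eqF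
      by (simp add: Fpos u.emeasure_eq_measure)
  qed
  have PU: "P UNIV"
  proof -
    define B where "B n = {- real n<..<real n} \<times> {- real n<..<real n}" for n
    have BU: "(\<Union>n. B n) = UNIV"
    proof safe
      fix x t :: real
      obtain n where "max \<bar>x\<bar> \<bar>t\<bar> < real n" using reals_Archimedean2 by blast
      then have "(x, t) \<in> B n" by (auto simp: B_def)
      then show "(x, t) \<in> (\<Union>n. B n)" by blast
    qed simp
    have inc: "incseq B" by (auto simp: incseq_def B_def)
    have mB: "B n \<in> sets borel" for n unfolding B_def by (intro borel_open open_Times) auto
    have K: "emeasure (K t) UNIV = (SUP n. ?k (B n) t)" for t
    proof -
      have "(\<Union>n. {x. (x, t) \<in> B n}) = UNIV" using BU by blast
      moreover have "incseq (\<lambda>n. {x. (x, t) \<in> B n})" using inc by (auto simp: incseq_def)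
      ultimately show ?thesis
        using SUP_emeasure_incseq[of "\<lambda>n. {x. (x, t) \<in> B n}" "K t"] slice_measurable[OF mB, of t]
        by (simp add: sK image_subset_iff)
    qed
    have m: "(\<lambda>t. ?k (B n) t) \<in> borel_measurable lebesgue"
      and e: "(\<integral>\<^sup>+ t. ?k (B n) t \<partial>lebesgue) = emeasure u (B n \<inter> strip T)" for n
      using basic[of "- real n" "real n" "- real n" "real n"] by (auto simp: P_def B_def)
    have "(\<integral>\<^sup>+ t. emeasure (K t) UNIV \<partial>lebesgue) = (SUP n. \<integral>\<^sup>+ t. ?k (B n) t \<partial>lebesgue)"
      unfolding K
    proof (rule nn_integral_monotone_convergence_SUP)
      show "incseq (\<lambda>n t. ?k (B n) t)"
        using inc slice_measurable[OF mB]
        by (auto simp: incseq_def le_fun_def sK intro!: emeasure_mono)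
    qed (rule m)
    also have "\<dots> = (SUP n. emeasure u (B n \<inter> strip T))" by (simp add: e)
    also have "\<dots> = emeasure u (\<Union>n. B n \<inter> strip T)"
    proof (rule SUP_emeasure_incseq)
      show "range (\<lambda>n. B n \<inter> strip T) \<subseteq> sets u"
        unfolding su using mB by (auto simp: sets_restrict_space Int_commute)
      show "incseq (\<lambda>n. B n \<inter> strip T)" using inc by (auto simp: incseq_def)
    qed
    also have "(\<Union>n. B n \<inter> strip T) = strip T" using BU by blast
    finally show ?thesis using m unfolding P_def by (simp add: K)
  qed
  have "P A" if "A \<in> sets borel" for A
  proof -
    define G where "G = range (\<lambda>(p, q). box p q :: (real \<times> real) set)"
    have "Int_stable G" by (auto simp: Int_stable_def G_def box_Int_box)
    moreover have "G \<subseteq> Pow UNIV" by simp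
    moreover have "A \<in> sigma_sets UNIV G" using that by (simp add: borel_eq_box G_def)
    ultimately show ?thesis
    proof (induction rule: sigma_sets_induct_disjoint)
      case (basic A)
      then obtain p q where "A = box p q" by (auto simp: G_def)
      then show ?case using \<open>\<And>d c b a. P ({a<..<b} \<times> {c<..<d})\<close> by (simp add: box_prod_eq)
    next
      case empty
      show ?case by (simp add: P_def)
    next
      case (compl A)
      then have A: "A \<in> sets borel" by (simp add: borel_eq_box G_def)
      have eq: "?k (UNIV - A) t = emeasure (K t) UNIV - ?k A t" for t
      proof -
        interpret finite_measure "K t" by (rule fK)
        have "{x. (x, t) \<in> UNIV - A} = space (K t) - {x. (x, t) \<in> A}" by (auto simp: spK)
        then show ?thesis
          using emeasure_compl[of "{x. (x, t) \<in> A}" "K t"] slice_measurable[OF A] by (simp add: sK spK)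
      qed
      have fin: "(\<integral>\<^sup>+ t. ?k A t \<partial>lebesgue) \<noteq> \<infinity>"
        using compl(2) u.emeasure_finite by (simp add: P_def)
      have sA: "A \<inter> strip T \<in> sets u"
        unfolding su using A by (auto simp: sets_restrict_space Int_commute)
      have le: "?k A t \<le> emeasure (K t) UNIV" for t
        using emeasure_space[of "K t" "{x. (x, t) \<in> A}"] by (simp add: spK)
      show ?case
        unfolding P_def eq
      proof
        show "(\<lambda>t. emeasure (K t) UNIV - ?k A t) \<in> borel_measurable lebesgue"
          using PU compl(2) by (auto simp: P_def)
        have "(\<integral>\<^sup>+ t. emeasure (K t) UNIV - ?k A t \<partial>lebesgue) =
          (\<integral>\<^sup>+ t. emeasure (K t) UNIV \<partial>lebesgue) - (\<integral>\<^sup>+ t. ?k A t \<partial>lebesgue)"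
          using PU compl(2) fin le by (intro nn_integral_diff) (auto simp: P_def)
        also have "\<dots> = emeasure u (space u) - emeasure u (A \<inter> strip T)"
          using PU compl(2) by (simp add: P_def spu)
        also have "\<dots> = emeasure u (space u - A \<inter> strip T)"
          using sA u.emeasure_finite by (intro emeasure_compl[symmetric]) auto
        also have "space u - A \<inter> strip T = (UNIV - A) \<inter> strip T" by (auto simp: spu)
        finally show "(\<integral>\<^sup>+ t. emeasure (K t) UNIV - ?k A t \<partial>lebesgue) =
          emeasure u ((UNIV - A) \<inter> strip T)" .
      qed
    next
      case (union A)
      then have A: "A i \<in> sets borel" for i by (auto simp: borel_eq_box G_def)
      have eq: "?k (\<Union>i. A i) t = (\<Sum>i. ?k (A i) t)" for t
      proof -
        have "{x. (x, t) \<in> (\<Union>i. A i)} = (\<Union>i. {x. (x, t) \<in> A i})" by auto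
        moreover have "disjoint_family (\<lambda>i. {x. (x, t) \<in> A i})"
          using union(1) unfolding disjoint_family_on_def by blast
        ultimately show ?thesis
          using slice_measurable[OF A] by (subst suminf_emeasure) (auto simp: sK)
      qed
      have sA: "A i \<inter> strip T \<in> sets u" for i
        unfolding su using A by (auto simp: sets_restrict_space Int_commute)
      have m: "(\<lambda>t. ?k (A i) t) \<in> borel_measurable lebesgue"
        and e: "(\<integral>\<^sup>+ t. ?k (A i) t \<partial>lebesgue) = emeasure u (A i \<inter> strip T)" for i
        using union(3)[of i] by (auto simp: P_def)
      show ?case
        unfolding P_def eq
      proof
        show "(\<lambda>t. \<Sum>i. ?k (A i) t) \<in> borel_measurable lebesgue"
          using m by simp
        have "(\<integral>\<^sup>+ t. (\<Sum>i. ?k (A i) t) \<partial>lebesgue) = (\<Sum>i. emeasure u (A i \<inter> strip T))"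
          using m e by (simp add: nn_integral_suminf)
        also have "\<dots> = emeasure u (\<Union>i. A i \<inter> strip T)"
          using sA union(1) by (intro suminf_emeasure) (auto simp: disjoint_family_on_def)
        also have "(\<Union>i. A i \<inter> strip T) = (\<Union>i. A i) \<inter> strip T" by auto
        finally show "(\<integral>\<^sup>+ t. (\<Sum>i. ?k (A i) t) \<partial>lebesgue) =
          emeasure u ((\<Union>i. A i) \<inter> strip T)" .
      qed
    qed
  qed
  then have P: "(\<lambda>t. ?k A t) \<in> borel_measurable lebesgue"
    "(\<integral>\<^sup>+ t. ?k A t \<partial>lebesgue) = emeasure u (A \<inter> strip T)"
    if "A \<in> sets borel" for A
    using that by (simp_all add: P_def)
  show thesis by (rule that[OF K C AEK Kout P])
qed

text \<open>
  Identities that hold for each Borel set at almost every time hold at almost every time for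
  countably many sets at once; these are enough to identify a measure.
\<close>

lemma measure_eqI_rational_rays:
  assumes M: "finite_measure M" "sets M = sets borel" and N: "sets N = sets (borel :: real measure)"
    and eq: "\<And>q. q \<in> \<rat> \<Longrightarrow> emeasure M {..<q} = emeasure N {..<q}"
  shows "M = N"
proof -
  interpret finite_measure M by fact
  define E where "E = (\<lambda>q::real. {..<q}) ` \<rat>"
  have rays: "{..<x} \<in> sigma_sets UNIV E" for x :: real
  proof -
    have "{..<x} = (\<Union>q\<in>\<rat> \<inter> {..<x}. {..<q})"
      using Rats_dense_in_real by fastforce
    also have "\<dots> \<in> sigma_sets UNIV E"
    proof (rule sigma_sets_UNION)
      show "countable ((\<lambda>q. {..<q}) ` (\<rat> \<inter> {..<x}))"
        by (intro countable_image countable_Int1 countable_rat)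
    qed (auto simp: E_def)
    finally show ?thesis .
  qed
  have borel: "sets (borel :: real measure) = sigma_sets UNIV E"
  proof
    have "range lessThan \<subseteq> sigma_sets UNIV E" using rays by auto
    then show "sets (borel :: real measure) \<subseteq> sigma_sets UNIV E"
      unfolding borel_Iio by (simp add: sigma_sets_mono)
    show "sigma_sets UNIV E \<subseteq> sets (borel :: real measure)"
    proof -
      have "E \<subseteq> sets borel" by (auto simp: E_def)
      from sets.sigma_sets_subset[OF this] show ?thesis by simp
    qed
  qed
  show ?thesis
  proof (rule measure_eqI_generator_eq[of E UNIV M N "\<lambda>n::nat. {..<real n}"])
    show "Int_stable E"
    proof (rule Int_stableI)
      fix A B assume "A \<in> E" "B \<in> E"
      then obtain a b where ab: "A = {..<a}" "B = {..<b}" "a \<in> \<rat>" "b \<in> \<rat>" by (auto simp: E_def)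
      have "{..<a} \<inter> {..<b} = {..<min a b}" "min a b \<in> \<rat>" using ab by (auto simp: min_def)
      then show "A \<inter> B \<in> E" unfolding E_def ab by blast
    qed
    show "emeasure M X = emeasure N X" if "X \<in> E" for X
      using that eq by (auto simp: E_def)
    show "range (\<lambda>n. {..<real n}) \<subseteq> E" by (auto simp: E_def)
    show "(\<Union>n. {..<real n}) = UNIV" using reals_Archimedean2 by auto
  qed (use M N borel in auto)
qed

lemma AE_eq_if_set_nn_integrals_eq_lebesgue:
  assumes f: "f \<in> borel_measurable lebesgue" and g: "g \<in> borel_measurable lborel"
    and fin: "(\<integral>\<^sup>+ t. g t \<partial>lborel) \<noteq> \<infinity>"
    and eq: "\<And>S. S \<in> sets borel \<Longrightarrow>
      (\<integral>\<^sup>+ t. f t * indicator S t \<partial>lebesgue) = (\<integral>\<^sup>+ t. g t * indicator S t \<partial>lborel)"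
  shows "AE t in lebesgue. f t = (g t :: ennreal)"
proof -
  \<comment> \<open>\<open>f\<close> is measurable for the completion only; a Borel representative makes densities comparable.\<close>
  obtain f' where f': "f' \<in> borel_measurable lborel" and ff': "AE t in lborel. f t = f' t"
    using completion_ex_borel_measurable[OF f] by blast
  have "density lborel g = density lborel f'"
  proof (rule measure_eqI)
    fix S :: "'a set" assume "S \<in> sets (density lborel g)"
    then have S: "S \<in> sets borel" by simp
    have "emeasure (density lborel g) S = (\<integral>\<^sup>+ t. f t * indicator S t \<partial>lebesgue)"
      using S g eq[OF S] by (simp add: emeasure_density)
    also have "\<dots> = (\<integral>\<^sup>+ t. f' t * indicator S t \<partial>lebesgue)"
      using AE_completion[OF ff'] by (intro nn_integral_cong_AE) auto
    also have "\<dots> = emeasure (density lborel f') S"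
      using S f' by (simp add: emeasure_density nn_integral_completion)
    finally show "emeasure (density lborel g) S = emeasure (density lborel f') S" .
  qed simp
  then have "AE t in lborel. g t = f' t"
    using finite_density_unique[OF g f' _ _ fin] by simp
  with ff' have "AE t in lborel. f t = g t" by eventually_elim simp
  then show ?thesis by (rule AE_completion)
qed

lemma
  assumes "u \<in> Mplus (strip T)"
  shows reg_nonneg: "0 \<le> reg T u p"
    and integrable_reg: "integrable lborel (\<lambda>p. indicator (strip T) p * reg T u p)"
proof -
  have u: "finite_measure u" "sets u = sets (restrict_space lborel (strip T))"
    using assms by (auto simp: Mplus_def sets_restrict_space)
  have sf: "sigma_finite_measure (restrict_space lborel (strip T))"
    by (intro sigma_finite_measure_restrict_space) (auto intro: sigma_finite_lborel)
  show "0 \<le> reg T u p" by (simp add: reg_def ac_density_nonneg)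
  have "integrable (restrict_space lborel (strip T)) (reg T u)"
    unfolding reg_def by (rule integrable_ac_density[OF sf u])
  then show "integrable lborel (\<lambda>p. indicator (strip T) p * reg T u p)"
    by (subst (asm) integrable_restrict_space) auto
qed

text \<open>
  A null set of the strip that carries the singular part of \<open>u\<close> has null slices at almost every
  time, and outside its slices \<open>u(\<cdot>,t)\<close> has the density \<open>reg T u (\<cdot>, t)\<close>. Hence taking the
  absolutely continuous part commutes with taking slices.
\<close>

theorem ac_part_slice:
  assumes L: "Linf_Mplus T u v"
  shows "AE t in lebesgue. t \<in> {0<..<T} \<longrightarrow> v t \<in> Mplus UNIV \<and>
    integrable lborel (\<lambda>x. reg T u (x, t)) \<and>
    ac_part lborel (v t) = density lborel (\<lambda>x. ennreal (reg T u (x, t)))"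
proof (rule slice_kernel[OF L])
  fix K :: "real \<Rightarrow> real measure" and C
  assume K: "\<And>t. K t \<in> Mplus UNIV" "\<And>t. Mnorm (K t) \<le> C" "0 \<le> C"
    and Kv: "AE t in lebesgue. t \<in> {0<..<T} \<longrightarrow> K t = v t"
    and Kout: "\<And>t. t \<notin> {0<..<T} \<Longrightarrow> emeasure (K t) UNIV = 0"
    and Kmeas: "\<And>A. A \<in> sets borel \<Longrightarrow> (\<lambda>t. emeasure (K t) {x. (x, t) \<in> A}) \<in> borel_measurable lebesgue"
    and Kint: "\<And>A. A \<in> sets borel \<Longrightarrow> (\<integral>\<^sup>+ t. emeasure (K t) {x. (x, t) \<in> A} \<partial>lebesgue) = emeasure u (A \<inter> strip T)"
  have uM: "u \<in> Mplus (strip T)" using L by (simp add: Linf_Mplus_def)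
  define M0 where "M0 = restrict_space (lborel :: (real \<times> real) measure) (strip T)"
  have u: "finite_measure u" "sets u = sets M0"
    using uM by (auto simp: Mplus_def sets_restrict_space M0_def)
  have sf: "sigma_finite_measure M0"
    unfolding M0_def by (intro sigma_finite_measure_restrict_space) (auto intro: sigma_finite_lborel)
  have spM0: "space M0 = strip T" by (simp add: M0_def space_restrict_space)
  obtain B where B: "B \<in> null_sets M0"
    and dec: "lebesgue_decomposition M0 u (density u (indicator (space M0 - B))) (density u (indicator B))"
    using lebesgue_decomposition_carrier[OF u] by blast
  have Bnull: "B \<in> null_sets lborel" and Bsub: "B \<subseteq> strip T"
    using B unfolding M0_def by (auto simp: null_sets_restrict_space)
  then have Bb: "B \<in> sets borel" by auto
  define r where "r p = indicator (strip T) p * reg T u p" for p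
  have rint: "integrable lborel r" unfolding r_def by (rule integrable_reg[OF uM])
  have rmeas [measurable]: "r \<in> borel_measurable borel" using borel_measurable_integrable[OF rint] by simp
  have rmeas2 [measurable]: "r \<in> borel_measurable (borel \<Otimes>\<^sub>M borel)" using rmeas by (simp add: borel_prod)
  have rpos: "0 \<le> r p" for p using reg_nonneg[OF uM] by (simp add: r_def)
  have dens: "density M0 (\<lambda>p. ennreal (reg T u p)) = density u (indicator (space M0 - B))"
    using density_ac_density[OF sf u] ac_part_eqI[OF dec] by (simp add: reg_def M0_def)
  have uB: "emeasure u (A \<inter> strip T - B) = (\<integral>\<^sup>+ p. ennreal (r p) * indicator A p \<partial>lborel)"
    if A: "A \<in> sets borel" for A
  proof -
    have A': "A \<inter> strip T \<in> sets M0" using A by (auto simp: M0_def sets_restrict_space)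
    have regm: "reg T u \<in> borel_measurable M0"
      using borel_measurable_integrable[OF integrable_ac_density[OF sf u]] by (simp add: reg_def M0_def)
    have "A \<inter> strip T - B = (space M0 - B) \<inter> (A \<inter> strip T)" by (auto simp: spM0)
    then have "emeasure u (A \<inter> strip T - B) = emeasure (density u (indicator (space M0 - B))) (A \<inter> strip T)"
      using A' B u by (subst emeasure_restricted) auto
    also have "\<dots> = (\<integral>\<^sup>+ p. ennreal (reg T u p) * indicator (A \<inter> strip T) p \<partial>M0)"
      unfolding dens[symmetric] using A' regm by (intro emeasure_density) auto
    also have "\<dots> = (\<integral>\<^sup>+ p. (ennreal (reg T u p) * indicator (A \<inter> strip T) p) * indicator (strip T) p \<partial>lborel)"
      unfolding M0_def by (subst nn_integral_restrict_space) auto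
    also have "\<dots> = (\<integral>\<^sup>+ p. ennreal (r p) * indicator A p \<partial>lborel)"
      by (intro nn_integral_cong) (auto simp: r_def indicator_def)
    finally show ?thesis .
  qed
  have key: "AE t in lebesgue. emeasure (K t) {x \<in> I. (x, t) \<notin> B} = (\<integral>\<^sup>+ x. ennreal (r (x, t)) * indicator I x \<partial>lborel)"
    if I: "I \<in> sets borel" for I
  proof (rule AE_eq_if_set_nn_integrals_eq_lebesgue)
    have IS: "I \<times> S \<in> sets borel" if "S \<in> sets borel" for S :: "real set"
      using I that by (simp add: borel_prod[symmetric] pair_measureI)
    have "(\<lambda>t. emeasure (K t) {x. (x, t) \<in> I \<times> UNIV - B}) \<in> borel_measurable lebesgue"
      using IS[of UNIV] Bb by (intro Kmeas) auto
    then show "(\<lambda>t. emeasure (K t) {x \<in> I. (x, t) \<notin> B}) \<in> borel_measurable lebesgue" by simp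
    show "(\<lambda>t. \<integral>\<^sup>+ x. ennreal (r (x, t)) * indicator I x \<partial>lborel) \<in> borel_measurable lborel"
      using I by measurable
    show eq: "(\<integral>\<^sup>+ t. emeasure (K t) {x \<in> I. (x, t) \<notin> B} * indicator S t \<partial>lebesgue) =
      (\<integral>\<^sup>+ t. (\<integral>\<^sup>+ x. ennreal (r (x, t)) * indicator I x \<partial>lborel) * indicator S t \<partial>lborel)"
      if S: "S \<in> sets borel" for S
    proof -
      have "(\<integral>\<^sup>+ t. emeasure (K t) {x \<in> I. (x, t) \<notin> B} * indicator S t \<partial>lebesgue) =
         (\<integral>\<^sup>+ t. emeasure (K t) {x. (x, t) \<in> I \<times> S - B} \<partial>lebesgue)"
        by (intro nn_integral_cong) (auto simp: indicator_def)
      also have "\<dots> = emeasure u ((I \<times> S - B) \<inter> strip T)"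
        using IS[OF S] Bb by (intro Kint) auto
      also have "(I \<times> S - B) \<inter> strip T = (I \<times> S) \<inter> strip T - B" by auto
      also have "emeasure u \<dots> = (\<integral>\<^sup>+ p. ennreal (r p) * indicator (I \<times> S) p \<partial>lborel)"
        by (rule uB[OF IS[OF S]])
      also have "\<dots> = (\<integral>\<^sup>+ t. (\<integral>\<^sup>+ x. ennreal (r (x, t)) * indicator (I \<times> S) (x, t) \<partial>lborel) \<partial>lborel)"
        using IS[OF S] by (subst lborel_pair.nn_integral_snd) (auto simp: lborel_prod)
      also have "\<dots> = (\<integral>\<^sup>+ t. (\<integral>\<^sup>+ x. ennreal (r (x, t)) * indicator I x \<partial>lborel) * indicator S t \<partial>lborel)"
        by (intro nn_integral_cong) (auto simp: indicator_def)
      finally show ?thesis .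
    qed
    have "(\<integral>\<^sup>+ t. (\<integral>\<^sup>+ x. ennreal (r (x, t)) * indicator I x \<partial>lborel) \<partial>lborel) \<le>
      (\<integral>\<^sup>+ t. (\<integral>\<^sup>+ x. ennreal (r (x, t)) \<partial>lborel) \<partial>lborel)"
      by (intro nn_integral_mono) (auto simp: indicator_def)
    also have "\<dots> = (\<integral>\<^sup>+ p. ennreal (r p) \<partial>lborel)"
      by (subst lborel_pair.nn_integral_snd) (auto simp: lborel_prod)
    also have "\<dots> < \<infinity>" using rint rpos by (simp add: integrable_iff_bounded)
    finally show "(\<integral>\<^sup>+ t. (\<integral>\<^sup>+ x. ennreal (r (x, t)) * indicator I x \<partial>lborel) \<partial>lborel) \<noteq> \<infinity>" by simp
  qed
  have "AE t in lebesgue. \<forall>q\<in>\<rat>. emeasure (K t) {x \<in> {..<q}. (x, t) \<notin> B} = (\<integral>\<^sup>+ x. ennreal (r (x, t)) * indicator {..<q} x \<partial>lborel)"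
    unfolding AE_ball_countable[OF countable_rat] by (intro ballI key) simp
  moreover have "AE t in lebesgue. {x. (x, t) \<in> B} \<in> null_sets lborel"
  proof -
    have Bp: "B \<in> sets (lborel \<Otimes>\<^sub>M lborel)" using Bb by (simp only: lborel_prod sets_lborel)
    have "(\<integral>\<^sup>+ t. emeasure lborel ((\<lambda>x. (x, t)) -` B) \<partial>lborel) = 0"
      using null_setsD1[OF Bnull] lborel_pair.emeasure_pair_measure_alt2[OF Bp] by (simp add: lborel_prod)
    then have "AE t in lborel. emeasure lborel ((\<lambda>x. (x, t)) -` B) = 0"
      using lborel_pair.measurable_emeasure_Pair2[OF Bp] by (subst (asm) nn_integral_0_iff_AE) auto
    then have "AE t in lborel. {x. (x, t) \<in> B} \<in> null_sets lborel"
      by eventually_elim (use slice_measurable[OF Bb] in \<open>auto simp: vimage_def\<close>)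
    then show ?thesis by (rule AE_completion)
  qed
  moreover have "AE t in lebesgue. integrable lborel (\<lambda>x. r (x, t))"
    using rint lborel_pair.AE_integrable_snd[of "\<lambda>x t. r (x, t)"]
    by (intro AE_completion) (simp add: lborel_prod)
  ultimately show ?thesis using Kv
  proof eventually_elim
    case (elim t)
    show ?case
    proof
      assume t: "t \<in> {0<..<T}"
      define Bt where "Bt = {x. (x, t) \<in> B}"
      have Bt: "Bt \<in> null_sets lborel" using elim by (simp add: Bt_def)
      have vK: "v t = K t" and vt: "v t \<in> Mplus UNIV" using elim(4) t K(1)[of t] by auto
      have fv: "finite_measure (v t)" and sv: "sets (v t) = sets lborel"
        using vt by (auto simp: Mplus_UNIV)
      interpret finite_measure "v t" by (rule fv)
      have rt: "r (x, t) = reg T u (x, t)" for x using t by (simp add: r_def strip_def)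
      have mr: "(\<lambda>x. ennreal (reg T u (x, t))) \<in> borel_measurable lborel"
        using elim by (auto simp: rt)
      have comp: "space lborel - Bt \<in> sets (v t)" using null_setsD2[OF Bt] by (simp add: sv)
      have eq: "density (v t) (indicator (space lborel - Bt)) = density lborel (\<lambda>x. ennreal (reg T u (x, t)))"
      proof (rule measure_eqI_rational_rays)
        show "finite_measure (density (v t) (indicator (space lborel - Bt)))"
          by (rule finite_measure_restricted[OF comp])
        show "emeasure (density (v t) (indicator (space lborel - Bt))) {..<q} =
          emeasure (density lborel (\<lambda>x. ennreal (reg T u (x, t)))) {..<q}" if q: "q \<in> \<rat>" for q
        proof -
          have "emeasure (density (v t) (indicator (space lborel - Bt))) {..<q} =
            emeasure (K t) ((space lborel - Bt) \<inter> {..<q})"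
            using emeasure_restricted[OF comp, of "{..<q}"] by (simp add: sv flip: vK)
          also have "(space lborel - Bt) \<inter> {..<q} = {x \<in> {..<q}. (x, t) \<notin> B}" by (auto simp: Bt_def)
          finally show ?thesis using bspec[OF elim(1) q] mr by (simp add: emeasure_density rt)
        qed
      qed (simp_all add: sv)
      from lebesgue_decomposition_restrict[OF sv Bt, unfolded eq, OF absolutely_continuousI_density[OF mr]]
      have "ac_part lborel (v t) = density lborel (\<lambda>x. ennreal (reg T u (x, t)))"
        by (rule ac_part_eqI)
      then show "v t \<in> Mplus UNIV \<and> integrable lborel (\<lambda>x. reg T u (x, t)) \<and>
        ac_part lborel (v t) = density lborel (\<lambda>x. ennreal (reg T u (x, t)))"
        using vt elim(3) by (simp add: rt)
    qed
  qed
qed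

lemma C_Cc_bounded:
  assumes z: "z \<in> C_Cc T"
  obtains b where "0 \<le> b" "\<And>t x. t \<in> {0..T} \<Longrightarrow> \<bar>z t x\<bar> \<le> b"
proof -
  obtain K where K: "compact K" "\<And>t x. t \<in> {0..T} \<Longrightarrow> x \<notin> K \<Longrightarrow> z t x = 0"
    using z unfolding C_Cc_def by blast
  have "compact ((\<lambda>p. z (fst p) (snd p)) ` ({0..T} \<times> K))"
    using K(1) by (intro compact_continuous_image continuous_on_subset[OF C_Cc_jointly_continuous[OF z]] compact_Times) auto
  then obtain b where b: "\<And>y. y \<in> (\<lambda>p. z (fst p) (snd p)) ` ({0..T} \<times> K) \<Longrightarrow> norm y \<le> b"
    using compact_imp_bounded bounded_iff by metis
  have "\<bar>z t x\<bar> \<le> max b 0" if t: "t \<in> {0..T}" for t x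
  proof (cases "x \<in> K")
    case True
    then have "z t x \<in> (\<lambda>p. z (fst p) (snd p)) ` ({0..T} \<times> K)" using t by force
    from b[OF this] show ?thesis by simp
  next
    case False
    then show ?thesis using K(2) t by simp
  qed
  then show thesis using that[of "max b 0"] by simp
qed

lemma integral_density_indicator:
  fixes f :: "'a \<Rightarrow> real"
  assumes "C \<in> sets \<mu>" "f \<in> borel_measurable \<mu>"
  shows "integral\<^sup>L (density \<mu> (indicator C)) f = integral\<^sup>L \<mu> (\<lambda>x. indicator C x * f x)"
proof -
  have "density \<mu> (indicator C) = density \<mu> (\<lambda>x. ennreal (indicator C x))"
    by (intro arg_cong[where f = "density \<mu>"]) (auto simp: indicator_def)
  then show ?thesis using assms by (simp add: integral_real_density)
qed

lemma integral_eq_ac_part_plus_sing_part: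
  fixes f :: "'a \<Rightarrow> real"
  assumes \<mu>: "finite_measure \<mu>" "sets \<mu> = sets M"
    and f: "f \<in> borel_measurable M" "\<And>x. \<bar>f x\<bar> \<le> b"
  shows "integral\<^sup>L \<mu> f = integral\<^sup>L (ac_part M \<mu>) f + integral\<^sup>L (sing_part M \<mu>) f"
proof -
  interpret finite_measure \<mu> by fact
  obtain C where C: "C \<in> null_sets M" and
    d: "lebesgue_decomposition M \<mu> (density \<mu> (indicator (space M - C))) (density \<mu> (indicator C))"
    by (rule lebesgue_decomposition_carrier[OF \<mu>])
  have sp: "space \<mu> = space M" using sets_eq_imp_space_eq[OF \<mu>(2)] .
  have s: "C \<in> sets \<mu>" "space M - C \<in> sets \<mu>" using C \<mu>(2) by auto
  have mf: "f \<in> borel_measurable \<mu>" using f(1) \<mu>(2) by (simp cong: measurable_cong_sets)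
  have i: "integrable \<mu> (\<lambda>x. indicator S x * f x)" if "S \<in> sets \<mu>" for S
    using that mf f(2) by (intro integrable_const_bound[where B = "\<bar>b\<bar>"] AE_I2)
      (auto simp: indicator_def intro: order_trans[OF f(2) abs_ge_self])
  have "integral\<^sup>L \<mu> f = integral\<^sup>L \<mu> (\<lambda>x. indicator (space M - C) x * f x + indicator C x * f x)"
    by (intro Bochner_Integration.integral_cong) (auto simp: indicator_def sp)
  also have "\<dots> = integral\<^sup>L \<mu> (\<lambda>x. indicator (space M - C) x * f x) + integral\<^sup>L \<mu> (\<lambda>x. indicator C x * f x)"
    using i[OF s(1)] i[OF s(2)] by (rule Bochner_Integration.integral_add[rotated])
  finally show ?thesis
    using ac_part_eqI[OF d] sing_part_eqI[OF d] s mf by (simp add: integral_density_indicator)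
qed

lemma slice_integral:
  assumes L: "Linf_Mplus T u v"
  shows "AE t in lebesgue. t \<in> {0<..<T} \<longrightarrow> (\<forall>f b. f \<in> borel_measurable borel \<longrightarrow> (\<forall>x. \<bar>f x\<bar> \<le> b) \<longrightarrow>
    (LINT x|v t. f x) = (LINT x|lborel. f x * reg T u (x, t)) + (LINT x|sing_part lborel (v t). f x))"
  using ac_part_slice[OF L]
proof eventually_elim
  case (elim t)
  show ?case
  proof (intro impI allI)
    fix f :: "real \<Rightarrow> real" and b
    assume t: "t \<in> {0<..<T}" and f: "f \<in> borel_measurable borel" and b: "\<forall>x. \<bar>f x\<bar> \<le> b"
    have v: "finite_measure (v t)" "sets (v t) = sets lborel"
      and r: "integrable lborel (\<lambda>x. reg T u (x, t))"
      and ac: "ac_part lborel (v t) = density lborel (\<lambda>x. ennreal (reg T u (x, t)))"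
      using elim t by (auto simp: Mplus_UNIV)
    have uM: "u \<in> Mplus (strip T)" using L by (simp add: Linf_Mplus_def)
    have "(LINT x|v t. f x) = (LINT x|ac_part lborel (v t). f x) + (LINT x|sing_part lborel (v t). f x)"
      using f b by (intro integral_eq_ac_part_plus_sing_part[OF v, of f b]) auto
    also have "(LINT x|ac_part lborel (v t). f x) = (LINT x|lborel. reg T u (x, t) * f x)"
      unfolding ac using r f reg_nonneg[OF uM] by (intro integral_real_density) auto
    finally show "(LINT x|v t. f x) = (LINT x|lborel. f x * reg T u (x, t)) + (LINT x|sing_part lborel (v t). f x)"
      by (simp add: mult.commute)
  qed
qed

lemma integrable_bounded_times_reg:
  assumes u: "u \<in> Mplus (strip T)" and f: "continuous_on (strip T) f" "\<And>p. p \<in> strip T \<Longrightarrow> \<bar>f p\<bar> \<le> b"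
  shows "integrable lborel (\<lambda>p. indicator (strip T) p * (f p * reg T u p))"
proof (rule Bochner_Integration.integrable_bound)
  note ir = integrable_reg[OF u]
  have mf: "(\<lambda>p. indicator (strip T) p * f p) \<in> borel_measurable borel"
    using borel_measurable_continuous_on_indicator[OF strip_borel f(1)] by simp
  have eq: "indicator (strip T) p * (f p * reg T u p) =
     (indicator (strip T) p * f p) * (indicator (strip T) p * reg T u p)" for p
    by (simp add: indicator_def)
  show "integrable lborel (\<lambda>p. b * (indicator (strip T) p * reg T u p))" by (rule integrable_mult_right[OF ir])
  show "(\<lambda>p. indicator (strip T) p * (f p * reg T u p)) \<in> borel_measurable lborel"
    unfolding eq
    by (rule borel_measurable_times[OF _ borel_measurable_integrable[OF ir]])
       (simp only: measurable_lborel1 measurable_lborel2 mf)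
  have "norm (indicator (strip T) p * (f p * reg T u p)) \<le> norm (b * (indicator (strip T) p * reg T u p))" for p
  proof (cases "p \<in> strip T")
    case True
    then have "\<bar>f p\<bar> * \<bar>reg T u p\<bar> \<le> \<bar>b\<bar> * \<bar>reg T u p\<bar>"
      using f(2)[OF True] by (intro mult_right_mono) auto
    then show ?thesis using True by (simp add: abs_mult)
  qed simp
  then show "AE p in lborel. norm (indicator (strip T) p * (f p * reg T u p)) \<le>
      norm (b * (indicator (strip T) p * reg T u p))" by simp
qed

lemma C_Cc_continuous_on_strip:
  assumes z: "z \<in> C_Cc T"
  shows "continuous_on (strip T) (\<lambda>p. z (snd p) (fst p))"
  by (rule continuous_on_compose2[OF C_Cc_jointly_continuous[OF z], of _ "\<lambda>p. (snd p, fst p)", simplified])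
     (auto simp: strip_def intro!: continuous_intros)

text \<open>
  The singular part of a slice is the slice, against which the integrals are measurable by definition,
  minus its absolutely continuous part, for which Fubini's theorem applies.
\<close>

lemma measurable_sing_part_slice:
  assumes L: "Linf_Mplus T u v" and z: "z \<in> C_Cc T"
  shows "(\<lambda>t. LINT x|sing_part lborel (v t). z t x) \<in> borel_measurable (lebesgue_on {0<..<T})"
proof -
  let ?s = "\<lambda>t. sing_part lborel (v t)"
  let ?M = "lebesgue_on {0<..<T}"
  obtain b where b: "0 \<le> b" "\<And>t x. t \<in> {0..T} \<Longrightarrow> \<bar>z t x\<bar> \<le> b" using C_Cc_bounded[OF z] by blast
  have uM: "u \<in> Mplus (strip T)" using L by (simp add: Linf_Mplus_def)
  have "integrable lborel (\<lambda>p. indicator (strip T) p * (z (snd p) (fst p) * reg T u p))"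
    by (rule integrable_bounded_times_reg[OF uM C_Cc_continuous_on_strip[OF z] b(2)]) (auto simp: strip_def)
  then have "integrable (lborel \<Otimes>\<^sub>M lborel) (\<lambda>(x, t). indicator (strip T) (x, t) * (z t x * reg T u (x, t)))"
    by (simp add: lborel_prod case_prod_beta')
  from lborel_pair.integrable_snd[OF this]
  have "integrable lborel (\<lambda>t. LINT x|lborel. indicator (strip T) (x, t) * (z t x * reg T u (x, t)))" .
  then have m1: "(\<lambda>t. LINT x|lborel. indicator (strip T) (x, t) * (z t x * reg T u (x, t))) \<in> borel_measurable lebesgue"
    by (intro measurable_completion) auto
  have "set_integrable lebesgue {0<..<T} (\<lambda>t. LINT x|v t. z t x)"
    using L z by (auto simp: Linf_Mplus_def)
  then have m2: "(\<lambda>t. indicator {0<..<T} t * (LINT x|v t. z t x)) \<in> borel_measurable lebesgue"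
    by (auto simp: set_integrable_def dest: borel_measurable_integrable)
  have "AE t in lebesgue. indicator {0<..<T} t * (LINT x|v t. z t x) -
      (LINT x|lborel. indicator (strip T) (x, t) * (z t x * reg T u (x, t))) =
      indicator {0<..<T} t * (LINT x|?s t. z t x)"
    using slice_integral[OF L]
  proof eventually_elim
    case (elim t)
    show ?case
    proof (cases "t \<in> {0<..<T}")
      case True
      then have "continuous_on UNIV (z t)" using z by (auto simp: C_Cc_def)
      then have "z t \<in> borel_measurable borel" by (rule borel_measurable_continuous_onI)
      moreover have "\<forall>x. \<bar>z t x\<bar> \<le> b" using b True by auto
      ultimately have "(LINT x|v t. z t x) = (LINT x|lborel. z t x * reg T u (x, t)) + (LINT x|?s t. z t x)"
        using elim True by blast
      then show ?thesis using True by (simp add: strip_def)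
    next
      case False
      then have "indicator (strip T) (x, t) = (0::real)" for x by (simp add: strip_def)
      then show ?thesis using False by simp
    qed
  qed
  from borel_measurable_AE[OF borel_measurable_diff[OF m2 m1] this]
  have "(\<lambda>t. indicator {0<..<T} t *\<^sub>R (LINT x|?s t. z t x)) \<in> borel_measurable lebesgue"
    by simp
  then show ?thesis by (subst borel_measurable_restrict_space_iff) auto
qed

lemma sing_part_slice_bound:
  assumes L: "Linf_Mplus T u v"
  obtains C where "0 \<le> C" "AE t in lebesgue_on {0<..<T}. sing_part lborel (v t) \<in> Mplus UNIV \<and> Mnorm (sing_part lborel (v t)) \<le> C"
proof -
  let ?s = "\<lambda>t. sing_part lborel (v t)"
  let ?M = "lebesgue_on {0<..<T}"
  obtain C where C: "AE t in ?M. Mnorm (v t) \<le> C"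
    using L unfolding Linf_Mplus_def by blast
  have "AE t in ?M. v t \<in> Mplus UNIV" using L unfolding Linf_Mplus_def by blast
  then have "AE t in ?M. ?s t \<in> Mplus UNIV \<and> Mnorm (?s t) \<le> max C 0"
    using C
  proof eventually_elim
    case (elim t)
    have v: "finite_measure (v t)" "sets (v t) = sets lborel" using elim by (auto simp: Mplus_UNIV)
    have "emeasure (v t) UNIV = emeasure (ac_part lborel (v t)) UNIV + emeasure (?s t) UNIV"
      using lebesgue_decomposition_parts[OF v] by (auto simp: lebesgue_decomposition_def)
    then have "emeasure (?s t) UNIV \<le> emeasure (v t) UNIV" by simp
    then have "measure (?s t) UNIV \<le> measure (v t) UNIV"
      using finite_measure.emeasure_finite[OF v(1)] unfolding measure_def by (intro enn2real_mono) (auto simp: less_top)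
    then have "Mnorm (?s t) \<le> Mnorm (v t)"
      using sets_eq_imp_space_eq[OF v(2)] sets_eq_imp_space_eq[OF sets_sing_part[OF v]] by (simp add: Mnorm_def)
    then show ?case using elim sing_part_Mplus by auto
  qed
  then show thesis using that[of "max C 0"] by simp
qed

section \<open>Comparison of measures\<close>

text \<open>
  The hypothesis passes to open sets by dominated convergence and to Borel sets by outer regularity.
\<close>

lemma emeasure_le_if_plateau_integrals_le:
  assumes \<mu>: "\<mu> \<in> Mplus UNIV" and \<nu>: "\<nu> \<in> Mplus (UNIV :: real set)"
    and le: "\<And>n L. L \<in> lists (\<rat> \<times> \<rat>) \<Longrightarrow> (LINT x|\<mu>. plateau n L x) \<le> (LINT x|\<nu>. plateau n L x)"
    and A: "A \<in> sets borel"
  shows "emeasure \<mu> A \<le> emeasure \<nu> A"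
proof -
  have op: "emeasure \<mu> U \<le> emeasure \<nu> U" if U: "open U" for U
  proof -
    obtain L where L: "\<And>n. L n \<in> lists (\<rat> \<times> \<rat>)" "\<And>x. (\<lambda>n. plateau n (L n) x) \<longlonglongrightarrow> indicator U x"
      using plateau_tendsto_open[OF U] by blast
    have lim: "(\<lambda>n. LINT x|\<kappa>. plateau n (L n) x) \<longlonglongrightarrow> measure \<kappa> U" if "\<kappa> \<in> Mplus UNIV" for \<kappa>
    proof -
      interpret finite_measure \<kappa> using that by (simp add: Mplus_UNIV)
      have s: "sets \<kappa> = sets borel" using that by (simp add: Mplus_UNIV)
      have "(\<lambda>n. LINT x|\<kappa>. plateau n (L n) x) \<longlonglongrightarrow> (LINT x|\<kappa>. indicator U x)"
      proof (rule integral_dominated_convergence[where w = "\<lambda>_. 1"])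
        show "plateau n (L n) \<in> borel_measurable \<kappa>" for n
          using borel_measurable_continuous_onI[OF C2D(4)[OF C2_plateau]] s by (simp cong: measurable_cong_sets)
        show "AE x in \<kappa>. norm (plateau n (L n) x) \<le> 1" for n
          using plateau_bounds[of n "L n"] by auto
        have "U \<in> sets \<kappa>" using U s by simp
        then show "(indicator U :: real \<Rightarrow> real) \<in> borel_measurable \<kappa>" by simp
      qed (use L in auto)
      also have "(LINT x|\<kappa>. indicator U x) = measure \<kappa> U"
        using sets_eq_imp_space_eq[OF s] by simp
      finally show ?thesis .
    qed
    have "measure \<mu> U \<le> measure \<nu> U"
      by (rule LIMSEQ_le[OF lim[OF \<mu>] lim[OF \<nu>]]) (use le L in auto)
    then show ?thesis
      using \<mu> \<nu> by (simp add: Mplus_UNIV finite_measure.emeasure_eq_measure)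
  qed
  have "emeasure \<nu> A = (INF U\<in>{U. A \<subseteq> U \<and> open U}. emeasure \<nu> U)"
    using \<nu> A by (intro outer_regular) (auto simp: Mplus_UNIV finite_measure.emeasure_finite)
  moreover have "emeasure \<mu> A \<le> (INF U\<in>{U. A \<subseteq> U \<and> open U}. emeasure \<nu> U)"
  proof (rule INF_greatest)
    fix U assume U: "U \<in> {U. A \<subseteq> U \<and> open U}"
    then have "emeasure \<mu> A \<le> emeasure \<mu> U"
      using \<mu> by (intro emeasure_mono) (auto simp: Mplus_UNIV)
    also have "\<dots> \<le> emeasure \<nu> U" using U op by auto
    finally show "emeasure \<mu> A \<le> emeasure \<nu> U" .
  qed
  ultimately show ?thesis by simp
qed

lemma Mplus_leI:
  assumes \<mu>: "\<mu> \<in> Mplus UNIV" and \<nu>: "\<nu> \<in> Mplus UNIV"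
    and le: "\<And>A. A \<in> sets borel \<Longrightarrow> emeasure \<mu> A \<le> emeasure \<nu> A"
  shows "Mplus_le \<mu> \<nu>"
proof -
  interpret m: finite_measure \<mu> using \<mu> by (simp add: Mplus_UNIV)
  interpret n: finite_measure \<nu> using \<nu> by (simp add: Mplus_UNIV)
  have s: "sets \<mu> = sets borel" "sets \<nu> = sets borel" using \<mu> \<nu> by (auto simp: Mplus_UNIV)
  define \<sigma> where "\<sigma> = diff_measure \<nu> \<mu>"
  have e: "emeasure \<sigma> A = emeasure \<nu> A - emeasure \<mu> A" if "A \<in> sets borel" for A
    unfolding \<sigma>_def using that s le
    by (intro emeasure_diff_measure) (auto intro: m.finite_measure_axioms n.finite_measure_axioms)
  have s\<sigma>: "sets \<sigma> = sets borel" by (simp add: \<sigma>_def s)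
  have "measure \<nu> A - measure \<mu> A = measure \<sigma> A" if A: "A \<in> sets borel" for A
  proof -
    have l: "measure \<mu> A \<le> measure \<nu> A"
      using le[OF A] by (simp add: m.emeasure_eq_measure n.emeasure_eq_measure)
    have "measure \<sigma> A = enn2real (ennreal (measure \<nu> A - measure \<mu> A))"
      unfolding measure_def[of \<sigma>] e[OF A] m.emeasure_eq_measure n.emeasure_eq_measure
      using l by (subst ennreal_minus) auto
    then show ?thesis using l by simp
  qed
  moreover have "\<sigma> \<in> Mplus UNIV"
  proof -
    have "emeasure \<sigma> UNIV \<le> emeasure \<nu> UNIV" by (simp add: e)
    then have "emeasure \<sigma> (space \<sigma>) \<noteq> \<infinity>"
      using sets_eq_imp_space_eq[OF s\<sigma>] n.emeasure_finite[of UNIV] by (auto simp: top_unique)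
    then show ?thesis using s\<sigma> by (auto simp: Mplus_UNIV intro!: finite_measureI)
  qed
  ultimately show ?thesis unfolding Mplus_le_def using \<mu> \<nu> by blast
qed

lemma translate_Mplus:
  assumes "\<mu> \<in> Mplus UNIV"
  shows "translate a \<mu> \<in> Mplus UNIV"
proof -
  interpret finite_measure \<mu> using assms by (simp add: Mplus_UNIV)
  have "(\<lambda>x. x + a) \<in> measurable \<mu> borel" using assms by (simp add: Mplus_UNIV cong: measurable_cong_sets)
  then show ?thesis
    unfolding translate_def Mplus_UNIV by (auto intro: finite_measure_distr)
qed

lemma integral_translate:
  assumes \<mu>: "\<mu> \<in> Mplus UNIV" and f: "f \<in> borel_measurable borel"
  shows "(LINT x|translate a \<mu>. f x) = (LINT x|\<mu>. (f (x + a) :: real))"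
proof -
  have "(\<lambda>x. x + a) \<in> measurable \<mu> borel" using \<mu> by (simp add: Mplus_UNIV cong: measurable_cong_sets)
  then show ?thesis unfolding translate_def using f by (intro integral_distr) auto
qed

lemma emeasure_translate:
  assumes \<mu>: "\<mu> \<in> Mplus UNIV" and A: "A \<in> sets borel"
  shows "emeasure (translate a \<mu>) A = emeasure \<mu> ((\<lambda>x. x + a) -` A)"
proof -
  have "(\<lambda>x. x + a) \<in> measurable \<mu> borel" using \<mu> by (simp add: Mplus_UNIV cong: measurable_cong_sets)
  moreover have "space \<mu> = UNIV" using \<mu> sets_eq_imp_space_eq[of \<mu> borel] by (simp add: Mplus_UNIV)
  ultimately show ?thesis unfolding translate_def using A by (simp add: emeasure_distr)
qed

section \<open>Monotonicity from a weak differential inequality\<close>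

lemma indicator_limit_of_continuous:
  assumes A: "A \<in> sets (lebesgue :: real measure)" and U: "open U" "U \<noteq> UNIV" "A \<subseteq> U"
  shows "\<exists>p :: nat \<Rightarrow> real \<Rightarrow> real. (\<forall>n. continuous_on UNIV (p n)) \<and> (\<forall>n t. 0 \<le> p n t) \<and> (\<forall>n t. p n t \<le> 1) \<and>
    (\<forall>n t. t \<notin> U \<longrightarrow> p n t = 0) \<and> (AE t in lebesgue. (\<lambda>n. p n t) \<longlonglongrightarrow> indicator A t)"
proof -
  have "(indicator A :: real \<Rightarrow> real) measurable_on UNIV"
    using A by (intro lebesgue_measurable_imp_measurable_on) auto
  then obtain N and g :: "nat \<Rightarrow> real \<Rightarrow> real" where N: "negligible N"
    and g: "\<And>n. continuous_on UNIV (g n)" "\<And>x. x \<notin> N \<Longrightarrow> (\<lambda>n. g n x) \<longlonglongrightarrow> indicator A x"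
    unfolding measurable_on_def by auto
  have cU: "closed (- U)" "- U \<noteq> {}" using U by (auto simp: closed_def)
  \<comment> \<open>The second factor confines the approximation to \<open>U\<close> and tends to \<open>1\<close> there.\<close>
  define k where "k n t = min 1 (real n * infdist t (- U))" for n t
  have k0: "0 \<le> k n t" "k n t \<le> 1" for n t by (auto simp: k_def infdist_nonneg)
  have k1: "(\<lambda>n. k n t) \<longlonglongrightarrow> 1" if "t \<in> U" for t
  proof (rule tendsto_eventually)
    have d: "0 < infdist t (- U)" using infdist_pos_not_in_closed[OF cU] that by simp
    obtain m where m: "1 / infdist t (- U) < real m" using reals_Archimedean2 by blast
    show "eventually (\<lambda>n. k n t = 1) sequentially"
      using eventually_ge_at_top[of m]
    proof eventually_elim
      case (elim n)
      then have "1 / infdist t (- U) \<le> real n" using m by linarith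
      then show ?case using d by (simp add: k_def field_simps)
    qed
  qed
  define p where "p n t = max 0 (min 1 (g n t)) * k n t" for n t
  have out: "p n t = 0" if "t \<notin> U" for n t using that by (simp add: p_def k_def)
  show ?thesis
  proof (intro exI[of _ p] conjI allI impI out)
    show "continuous_on UNIV (p n)" for n unfolding p_def k_def by (intro continuous_intros g)
    show "0 \<le> p n t" "p n t \<le> 1" for n t using k0[of n t] by (auto simp: p_def intro!: mult_le_one)
    have "N \<in> null_sets lebesgue" using N by (simp add: negligible_iff_null_sets)
    then have "AE t in lebesgue. t \<notin> N" by (rule AE_not_in)
    then show "AE t in lebesgue. (\<lambda>n. p n t) \<longlonglongrightarrow> indicator A t"
    proof eventually_elim
      case (elim t)
      show ?case
      proof (cases "t \<in> U")
        case True
        have "(\<lambda>n. p n t) \<longlonglongrightarrow> max 0 (min 1 (indicator A t)) * 1"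
          unfolding p_def by (intro tendsto_intros g elim k1 True)
        then show ?thesis by (simp add: indicator_def split: if_splits)
      next
        case False
        then show ?thesis using out U(3) by (simp add: indicator_def subset_iff) blast
      qed
    qed
  qed
qed

lemma antiderivative_vanishing_at_end:
  fixes w :: "real \<Rightarrow> real"
  assumes w: "continuous_on UNIV w"
  shows "\<exists>g. \<forall>t\<in>{0..T}. (g has_real_derivative w t) (at t) \<and> g t = - integral {t..T} w"
proof -
  have int: "w integrable_on {a..b}" for a b
    using w by (intro integrable_continuous_real continuous_on_subset[OF w]) auto
  define g where "g t = integral {-1..t} w - integral {-1..T} w" for t
  show ?thesis
  proof (intro exI[of _ g] ballI conjI)
    fix t assume t: "t \<in> {0..T}"
    have "((\<lambda>t. integral {-1..t} w) has_vector_derivative w t) (at t within {-1..T+1})"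
      using t by (intro integral_has_vector_derivative continuous_on_subset[OF w]) auto
    then have "((\<lambda>t. integral {-1..t} w) has_vector_derivative w t) (at t)"
      using t by (subst (asm) at_within_interior) auto
    then show "(g has_real_derivative w t) (at t)"
      unfolding g_def has_real_derivative_iff_has_vector_derivative
      by (auto intro!: derivative_eq_intros)
    have "integral {-1..t} w + integral {t..T} w = integral {-1..T} w"
      using t int by (intro Henstock_Kurzweil_Integration.integral_combine) auto
    then show "g t = - integral {t..T} w" by (simp add: g_def)
  qed
qed

lemma integral_lebesgue_on_open_interval:
  fixes w :: "real \<Rightarrow> real"
  assumes w: "continuous_on UNIV w"
  shows "integral\<^sup>L (lebesgue_on {0<..<T}) w = integral {0..T} w"
proof -
  have "set_integrable lborel {0..T} w"
    using w by (intro borel_integrable_atLeastAtMost') (auto intro: continuous_on_subset)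
  then have "set_integrable lebesgue {0..T} w"
    unfolding set_integrable_def by (simp add: integrable_completion)
  then have "set_integrable lebesgue {0<..<T} w"
    by (rule set_integrable_subset) auto
  then have "integrable (lebesgue_on {0<..<T}) w"
    by (simp add: integrable_restrict_space set_integrable_def)
  then have "integral\<^sup>L (lebesgue_on {0<..<T}) w = integral {0<..<T} w"
    by (intro lebesgue_integral_eq_integral) auto
  also have "\<dots> = integral {0..T} w"
    using integral_open_interval[of 0 T w] by simp
  finally show ?thesis .
qed

lemma finite_measure_lebesgue_on_interval: "finite_measure (lebesgue_on {a<..<b::real})"
proof (rule finite_measureI)
  have "emeasure lebesgue {a<..<b} < \<infinity>" by (cases "a \<le> b") auto
  then show "emeasure (lebesgue_on {a<..<b}) (space (lebesgue_on {a<..<b})) \<noteq> \<infinity>"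
    by (simp add: emeasure_restrict_space)
qed

lemma continuous_borel_measurable_lebesgue_on:
  fixes w :: "real \<Rightarrow> real"
  assumes "continuous_on UNIV w"
  shows "w \<in> borel_measurable (lebesgue_on S)"
  using assms by (intro measurable_restrict_space1 measurable_completion) (simp add: borel_measurable_continuous_onI)

text \<open>
  The hypothesis \<open>weak\<close> says that \<open>h\<close> is nonincreasing in the sense of distributions on
  \<open>(0, T)\<close> and at most \<open>h0\<close> initially.
\<close>

locale weakly_nonincreasing =
  fixes T h0 B :: real and h :: "real \<Rightarrow> real"
  assumes meas: "h \<in> borel_measurable (lebesgue_on {0<..<T})"
    and bounded: "AE t in lebesgue_on {0<..<T}. \<bar>h t\<bar> \<le> B"
    and weak: "\<And>w g. continuous_on UNIV w \<Longrightarrow> (\<And>t. t \<in> {0..T} \<Longrightarrow> (g has_real_derivative w t) (at t)) \<Longrightarrow>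
      (\<And>t. t \<in> {0..T} \<Longrightarrow> 0 \<le> g t) \<Longrightarrow> g T = 0 \<Longrightarrow>
      - g 0 * h0 \<le> integral\<^sup>L (lebesgue_on {0<..<T}) (\<lambda>t. h t * w t)"
begin

sublocale finite_measure "lebesgue_on {0<..<T}"
  by (rule finite_measure_lebesgue_on_interval)

lemma integrable_times_bounded:
  assumes "p \<in> borel_measurable (lebesgue_on {0<..<T})" "\<And>t. \<bar>p t\<bar> \<le> 1"
  shows "integrable (lebesgue_on {0<..<T}) (\<lambda>t. h t * p t)" "integrable (lebesgue_on {0<..<T}) p"
proof -
  have "AE t in lebesgue_on {0<..<T}. norm (h t * p t) \<le> B"
    using bounded
  proof eventually_elim
    case (elim t)
    have "\<bar>h t\<bar> * \<bar>p t\<bar> \<le> \<bar>h t\<bar> * 1" by (intro mult_left_mono assms) auto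
    then show ?case using elim by (simp add: abs_mult)
  qed
  then show "integrable (lebesgue_on {0<..<T}) (\<lambda>t. h t * p t)"
    using meas assms by (intro integrable_const_bound) auto
  show "integrable (lebesgue_on {0<..<T}) p"
    using assms by (intro integrable_const_bound[where B = 1]) auto
qed

lemma integrals_against_approximations:
  assumes cont: "\<And>n. continuous_on UNIV (p n)" and bnd: "\<And>n t. \<bar>p n t\<bar> \<le> 1" and A: "A \<in> sets lebesgue"
    and lim: "AE t in lebesgue_on {0<..<T}. (\<lambda>n. p n t) \<longlonglongrightarrow> indicator A t"
  shows "(\<lambda>n. integral\<^sup>L (lebesgue_on {0<..<T}) (\<lambda>t. h t * p n t)) \<longlonglongrightarrow>
      integral\<^sup>L (lebesgue_on {0<..<T}) (\<lambda>t. h t * indicator A t)" (is ?l1)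
    and "(\<lambda>n. integral\<^sup>L (lebesgue_on {0<..<T}) (p n)) \<longlonglongrightarrow> integral\<^sup>L (lebesgue_on {0<..<T}) (indicator A)" (is ?l2)
proof -
  have mp: "p n \<in> borel_measurable (lebesgue_on {0<..<T})" for n
    by (rule continuous_borel_measurable_lebesgue_on[OF cont])
  have mA: "(indicator A :: real \<Rightarrow> real) \<in> borel_measurable (lebesgue_on {0<..<T})"
    using A by (intro measurable_restrict_space1) auto
  show ?l1
  proof (rule integral_dominated_convergence[where w = "\<lambda>_. B"])
    show "AE t in lebesgue_on {0<..<T}. norm (h t * p n t) \<le> B" for n
      using bounded
    proof eventually_elim
      case (elim t)
      have "\<bar>h t\<bar> * \<bar>p n t\<bar> \<le> \<bar>h t\<bar> * 1" by (intro mult_left_mono bnd) auto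
      then show ?case using elim by (simp add: abs_mult)
    qed
    show "AE t in lebesgue_on {0<..<T}. (\<lambda>n. h t * p n t) \<longlonglongrightarrow> h t * indicator A t"
      using lim by eventually_elim (intro tendsto_mult tendsto_const)
  qed (use meas mp mA in auto)
  show ?l2
    by (rule integral_dominated_convergence[where w = "\<lambda>_. 1"]) (use mp mA bnd lim in auto)
qed

text \<open>
  The test functions have \<open>- g'\<close> close to the indicator of the set where \<open>h\<close> exceeds \<open>h0\<close>.
\<close>

lemma AE_le_initial: "AE t in lebesgue_on {0<..<T}. h t \<le> h0"
proof -
  let ?M = "lebesgue_on {0<..<T}"
  define A where "A = {t \<in> space ?M. h0 < h t}"
  have AM: "A \<in> sets ?M" unfolding A_def using meas by measurable
  then have A: "A \<in> sets lebesgue" by (auto simp: sets_restrict_space)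
  have AT: "open {0<..<T}" "{0<..<T} \<noteq> UNIV" "A \<subseteq> {0<..<T}"
    by (auto simp: A_def set_eq_iff intro: exI[of _ 0])
  obtain p :: "nat \<Rightarrow> real \<Rightarrow> real" where p: "\<And>n. continuous_on UNIV (p n)" "\<And>n t. 0 \<le> p n t" "\<And>n t. p n t \<le> 1"
    and lim: "AE t in lebesgue. (\<lambda>n. p n t) \<longlonglongrightarrow> indicator A t"
    using indicator_limit_of_continuous[OF A, of "{0<..<T}"] AT by blast
  have lim': "AE t in ?M. (\<lambda>n. p n t) \<longlonglongrightarrow> indicator A t"
    using lim by (subst AE_restrict_space_iff) auto
  have bp: "\<bar>p n t\<bar> \<le> 1" for n t using p by (simp add: abs_le_iff order_trans[of _ 0])
  have le: "integral\<^sup>L ?M (\<lambda>t. h t * p n t) \<le> h0 * integral\<^sup>L ?M (p n)" for n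
  proof -
    have cw: "continuous_on UNIV (\<lambda>t. - p n t)" by (intro continuous_intros p)
    obtain g where g: "\<And>t. t \<in> {0..T} \<Longrightarrow> (g has_real_derivative - p n t) (at t)"
      "\<And>t. t \<in> {0..T} \<Longrightarrow> g t = - integral {t..T} (\<lambda>t. - p n t)"
      using antiderivative_vanishing_at_end[OF cw, of T] by blast
    have g': "g t = integral {t..T} (p n)" if "t \<in> {0..T}" for t
      using g(2)[OF that] by simp
    show ?thesis
    proof (cases "0 \<le> T")
      case True
      have "- g 0 * h0 \<le> integral\<^sup>L ?M (\<lambda>t. h t * - p n t)"
      proof (rule weak[OF cw g(1)])
        show "0 \<le> g t" if "t \<in> {0..T}" for t
          unfolding g'[OF that] using p by (intro Henstock_Kurzweil_Integration.integral_nonneg integrable_continuous_real)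
             (auto intro: continuous_on_subset)
        show "g T = 0" using g'[of T] True by simp
      qed
      moreover have "g 0 = integral\<^sup>L ?M (p n)"
        using g'[of 0] True integral_lebesgue_on_open_interval[OF p(1)] by simp
      ultimately show ?thesis by (simp add: mult.commute)
    next
      case False
      then have "{0<..<T} = {}" by auto
      then show ?thesis by (simp add: integral_restrict_space)
    qed
  qed
  note l = integrals_against_approximations[OF p(1) bp A lim']
  have "integral\<^sup>L ?M (\<lambda>t. h t * indicator A t) \<le> h0 * integral\<^sup>L ?M (indicator A)"
    by (rule LIMSEQ_le[OF l(1) tendsto_mult[OF tendsto_const l(2)]]) (use le in auto)
  moreover have mA: "(indicator A :: real \<Rightarrow> real) \<in> borel_measurable ?M" using AM by simp
  ultimately have le0: "integral\<^sup>L ?M (\<lambda>t. h t * indicator A t - h0 * indicator A t) \<le> 0"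
    using integrable_times_bounded[OF mA] by (simp add: indicator_abs_le_1)
  have i: "integrable ?M (\<lambda>t. h t * indicator A t - h0 * indicator A t)"
    using integrable_times_bounded[OF mA] by (simp add: indicator_abs_le_1)
  have nn: "AE t in ?M. 0 \<le> h t * indicator A t - h0 * indicator A t"
    by (rule AE_I2) (auto simp: A_def indicator_def)
  have "integral\<^sup>L ?M (\<lambda>t. h t * indicator A t - h0 * indicator A t) = 0"
    using integral_nonneg_AE[OF nn] le0 by simp
  then have "AE t in ?M. h t * indicator A t - h0 * indicator A t = 0"
    using integral_nonneg_eq_0_iff_AE[OF i nn] by simp
  with AE_space show ?thesis
    by eventually_elim (auto simp: A_def indicator_def split: if_splits)
qed

text \<open>
  Testing with \<open>g' = \<beta> P - \<alpha> Q\<close>, where \<open>P\<close> and \<open>Q\<close> approximate the indicators of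
  a set before \<open>s\<close> and of a set after \<open>s\<close> and \<open>\<alpha>\<close>, \<open>\<beta>\<close> are their integrals, compares the averages
  of \<open>h\<close> over the two sets.
\<close>

lemma level_sets_null:
  assumes s: "0 < s" "s < T"
  shows "{t \<in> {0<..<s}. h t < c} \<in> null_sets lebesgue \<or> {t \<in> {s<..<T}. c < h t} \<in> null_sets lebesgue"
proof -
  let ?M = "lebesgue_on {0<..<T}"
  have spM: "space ?M = {0<..<T}" by simp
  define A where "A = {t \<in> {0<..<s}. h t < c}"
  define A' where "A' = {t \<in> {s<..<T}. c < h t}"
  have sM: "X \<in> sets lebesgue" if "X \<in> sets ?M" for X
    using that by (simp add: sets_restrict_space_iff)
  have lev: "{t \<in> space ?M. h t < c} \<in> sets ?M" "{t \<in> space ?M. c < h t} \<in> sets ?M"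
    using meas by measurable
  have "A = {t \<in> space ?M. h t < c} \<inter> {0<..<s}" using s by (auto simp: A_def)
  also have "\<dots> \<in> sets lebesgue"
    by (intro sets.Int sM[OF lev(1)]) simp
  finally have A: "A \<in> sets lebesgue" .
  have "A' = {t \<in> space ?M. c < h t} \<inter> {s<..<T}" using s by (auto simp: A'_def)
  also have "\<dots> \<in> sets lebesgue"
    by (intro sets.Int sM[OF lev(2)]) simp
  finally have A': "A' \<in> sets lebesgue" .
  have "open {..<s}" "{..<s} \<noteq> UNIV" "A \<subseteq> {..<s}" by (auto simp: A_def set_eq_iff intro: exI[of _ s])
  from indicator_limit_of_continuous[OF A this]
  obtain P :: "nat \<Rightarrow> real \<Rightarrow> real" where "\<forall>n. continuous_on UNIV (P n)" "\<forall>n t. 0 \<le> P n t"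
    "\<forall>n t. P n t \<le> 1" "\<forall>n t. t \<notin> {..<s} \<longrightarrow> P n t = 0"
    and limP: "AE t in lebesgue. (\<lambda>n. P n t) \<longlonglongrightarrow> indicator A t"
    by blast
  then have P: "continuous_on UNIV (P n)" "0 \<le> P n t" "P n t \<le> 1" "s \<le> t \<Longrightarrow> P n t = 0" for n t
    by simp_all
  have "open {s<..}" "{s<..} \<noteq> UNIV" "A' \<subseteq> {s<..}" by (auto simp: A'_def set_eq_iff intro: exI[of _ s])
  from indicator_limit_of_continuous[OF A' this]
  obtain Q :: "nat \<Rightarrow> real \<Rightarrow> real" where "\<forall>n. continuous_on UNIV (Q n)" "\<forall>n t. 0 \<le> Q n t"
    "\<forall>n t. Q n t \<le> 1" "\<forall>n t. t \<notin> {s<..} \<longrightarrow> Q n t = 0"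
    and limQ: "AE t in lebesgue. (\<lambda>n. Q n t) \<longlonglongrightarrow> indicator A' t"
    by blast
  then have Q: "continuous_on UNIV (Q n)" "0 \<le> Q n t" "Q n t \<le> 1" "t \<le> s \<Longrightarrow> Q n t = 0" for n t
    by simp_all
  have bP: "\<bar>P n t\<bar> \<le> 1" and bQ: "\<bar>Q n t\<bar> \<le> 1" for n t
    using P(2,3)[of n t] Q(2,3)[of n t] by auto
  have limP: "AE t in ?M. (\<lambda>n. P n t) \<longlonglongrightarrow> indicator A t" and limQ: "AE t in ?M. (\<lambda>n. Q n t) \<longlonglongrightarrow> indicator A' t"
    using limP limQ by (subst AE_restrict_space_iff; auto)+
  define a where "a n = integral\<^sup>L ?M (P n)" for n
  define b where "b n = integral\<^sup>L ?M (Q n)" for n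
  have mP: "P n \<in> borel_measurable ?M" and mQ: "Q n \<in> borel_measurable ?M" for n
    using P(1) Q(1) by (auto intro: continuous_borel_measurable_lebesgue_on)
  have aI: "a n = integral {0..T} (P n)" and bI: "b n = integral {0..T} (Q n)" for n
    unfolding a_def b_def by (rule integral_lebesgue_on_open_interval[OF P(1)] integral_lebesgue_on_open_interval[OF Q(1)])+
  have iP: "P n integrable_on {x..y}" and iQ: "Q n integrable_on {x..y}" for n x y
    using P(1) Q(1) by (auto intro!: integrable_continuous_real intro: continuous_on_subset)
  have a0: "0 \<le> a n" and b0: "0 \<le> b n" for n
    unfolding aI bI using P Q iP iQ by (auto intro!: Henstock_Kurzweil_Integration.integral_nonneg)
  have le: "a n * integral\<^sup>L ?M (\<lambda>t. h t * Q n t) \<le> b n * integral\<^sup>L ?M (\<lambda>t. h t * P n t)" for n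
  proof -
    define w where "w t = b n * P n t - a n * Q n t" for t
    have cw: "continuous_on UNIV w" unfolding w_def by (intro continuous_intros P Q)
    obtain g where g: "\<And>t. t \<in> {0..T} \<Longrightarrow> (g has_real_derivative w t) (at t)"
      "\<And>t. t \<in> {0..T} \<Longrightarrow> g t = - integral {t..T} w"
      using antiderivative_vanishing_at_end[OF cw, of T] by blast
    have iw: "integral {x..y} w = b n * integral {x..y} (P n) - a n * integral {x..y} (Q n)" for x y
      unfolding w_def using iP iQ
      by (subst Henstock_Kurzweil_Integration.integral_diff) (auto intro!: integrable_on_mult_right)
    have w_int: "w integrable_on {x..y}" for x y
      using cw by (auto intro!: integrable_continuous_real intro: continuous_on_subset)
    have w0: "integral {0..T} w = 0" by (simp add: iw aI bI)
    have "- g 0 * h0 \<le> integral\<^sup>L ?M (\<lambda>t. h t * w t)"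
    proof (rule weak[OF cw g(1)])
      fix t assume t: "t \<in> {0..T}"
      show "0 \<le> g t"
      proof (cases "s \<le> t")
        case True
        have "integral {t..T} (P n) = integral {t..T} (\<lambda>_. 0)"
          using True P(4) by (intro Henstock_Kurzweil_Integration.integral_cong) auto
        moreover have "0 \<le> integral {t..T} (Q n)"
          using Q iQ by (intro Henstock_Kurzweil_Integration.integral_nonneg) auto
        ultimately show ?thesis using a0[of n] by (simp add: g(2)[OF t] iw)
      next
        case False
        have "integral {0..t} (Q n) = integral {0..t} (\<lambda>_. 0)"
          using False Q(4) by (intro Henstock_Kurzweil_Integration.integral_cong) auto
        moreover have "0 \<le> integral {0..t} (P n)"
          using P iP by (intro Henstock_Kurzweil_Integration.integral_nonneg) auto
        ultimately have "0 \<le> integral {0..t} w" using b0[of n] by (simp add: iw)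
        moreover have "integral {0..t} w + integral {t..T} w = integral {0..T} w"
          using t w_int by (intro Henstock_Kurzweil_Integration.integral_combine) auto
        ultimately show ?thesis by (simp add: g(2)[OF t] w0)
      qed
    next
      show "g T = 0" using g(2)[of T] s by simp
    qed
    moreover have "g 0 = 0" using g(2)[of 0] s w0 by simp
    moreover have "integral\<^sup>L ?M (\<lambda>t. h t * w t) =
      b n * integral\<^sup>L ?M (\<lambda>t. h t * P n t) - a n * integral\<^sup>L ?M (\<lambda>t. h t * Q n t)"
    proof -
      have "h t * w t = b n * (h t * P n t) - a n * (h t * Q n t)" for t
        by (simp add: w_def algebra_simps)
      then show ?thesis
        using integrable_times_bounded(1)[OF mP bP] integrable_times_bounded(1)[OF mQ bQ] by simp
    qed
    ultimately show ?thesis by simp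
  qed
  note lP = integrals_against_approximations[OF P(1) bP A limP] and lQ = integrals_against_approximations[OF Q(1) bQ A' limQ]
  define \<alpha> where "\<alpha> = integral\<^sup>L ?M (indicator A :: real \<Rightarrow> real)"
  define \<beta> where "\<beta> = integral\<^sup>L ?M (indicator A' :: real \<Rightarrow> real)"
  have main: "\<alpha> * integral\<^sup>L ?M (\<lambda>t. h t * indicator A' t) \<le> \<beta> * integral\<^sup>L ?M (\<lambda>t. h t * indicator A t)"
    by (rule LIMSEQ_le[OF tendsto_mult[OF lP(2) lQ(1)] tendsto_mult[OF lQ(2) lP(1)], folded \<alpha>_def \<beta>_def])
       (use le in \<open>auto simp: a_def b_def\<close>)
  have mA: "(indicator A :: real \<Rightarrow> real) \<in> borel_measurable ?M" "(indicator A' :: real \<Rightarrow> real) \<in> borel_measurable ?M"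
    using A A' by (auto intro!: measurable_restrict_space1)
  note iA = integrable_times_bounded[OF mA(1) indicator_abs_le_1] and iA' = integrable_times_bounded[OF mA(2) indicator_abs_le_1]
  have ab0: "0 \<le> \<alpha>" "0 \<le> \<beta>" unfolding \<alpha>_def \<beta>_def by (auto intro!: integral_nonneg_AE)
  have "A \<in> null_sets lebesgue \<or> A' \<in> null_sets lebesgue"
  proof (cases "\<beta> = 0")
    case True
    have "AE t in ?M. indicator A' t = (0::real)"
      using integral_nonneg_eq_0_iff_AE[OF iA'(2)] True by (simp add: \<beta>_def)
    then have "AE t in lebesgue. t \<notin> A'"
      by (subst (asm) AE_restrict_space_iff) (auto elim!: eventually_mono simp: A'_def indicator_def split: if_splits dest: less_trans[OF s(1)])
    then show ?thesis using A' by (simp add: AE_iff_null_sets)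
  next
    case False
    define X where "X = integral\<^sup>L ?M (\<lambda>t. c * indicator A t - h t * indicator A t)"
    define Y where "Y = integral\<^sup>L ?M (\<lambda>t. h t * indicator A' t - c * indicator A' t)"
    have X: "integral\<^sup>L ?M (\<lambda>t. h t * indicator A t) = c * \<alpha> - X"
      unfolding X_def \<alpha>_def using iA by simp
    have Y: "integral\<^sup>L ?M (\<lambda>t. h t * indicator A' t) = c * \<beta> + Y"
      unfolding Y_def \<beta>_def using iA' by simp
    have nnX: "AE t in ?M. 0 \<le> c * indicator A t - h t * indicator A t"
      by (rule AE_I2) (auto simp: A_def indicator_def)
    have X0: "0 \<le> X" unfolding X_def by (rule integral_nonneg_AE[OF nnX])
    have Y0: "0 \<le> Y" unfolding Y_def by (rule integral_nonneg_AE, rule AE_I2) (auto simp: A'_def indicator_def)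
    have "\<alpha> * Y + \<beta> * X \<le> 0" using main unfolding X Y by (simp add: algebra_simps)
    moreover have "0 \<le> \<alpha> * Y" "0 \<le> \<beta> * X" using ab0 X0 Y0 by auto
    ultimately have "\<beta> * X = 0" by linarith
    then have "X = 0" using False by simp
    then have "AE t in ?M. c * indicator A t - h t * indicator A t = 0"
      unfolding X_def using iA by (subst (asm) integral_nonneg_eq_0_iff_AE[OF _ nnX]) auto
    then have "AE t in lebesgue. t \<notin> A"
      using s by (subst (asm) AE_restrict_space_iff) (auto elim!: eventually_mono simp: A_def indicator_def split: if_splits)
    then show ?thesis using A by (simp add: AE_iff_null_sets)
  qed
  then show ?thesis by (simp add: A_def A'_def)
qed

text \<open>
  If \<open>h\<close> increases from \<open>t1\<close> to \<open>t2\<close>, then rational numbers \<open>s\<close> and \<open>c\<close> separate the two times and the two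
  values, and one of the two corresponding level sets is null. There are countably many of
  these null sets.
\<close>

lemma AE_antimono:
  "\<exists>N\<in>null_sets lebesgue. \<forall>t1\<in>{0<..<T} - N. \<forall>t2\<in>{0<..<T} - N. t1 \<le> t2 \<longrightarrow> h t2 \<le> h t1"
proof -
  define L where "L s c = {t \<in> {0<..<s}. h t < c}" for s c
  define U where "U s c = {t \<in> {s<..<T}. c < h t}" for s c
  define Z where "Z s c = (if L s c \<in> null_sets lebesgue then L s c else U s c)" for s c
  define I where "I = (\<rat> \<inter> {0<..<T}) \<times> (\<rat> :: real set)"
  define N where "N = (\<Union>(s, c)\<in>I. Z s c)"
  have Z: "Z s c \<in> null_sets lebesgue" if "s \<in> {0<..<T}" for s c
    using level_sets_null[of s c] that by (auto simp: Z_def L_def U_def)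
  have "N \<in> null_sets lebesgue"
    unfolding N_def
  proof (rule null_sets_UN')
    show "countable I" unfolding I_def by (intro countable_SIGMA countable_Int1 countable_rat)
  qed (auto simp: I_def intro!: Z)
  moreover have "h t2 \<le> h t1" if t: "t1 \<in> {0<..<T} - N" "t2 \<in> {0<..<T} - N" "t1 \<le> t2" for t1 t2
  proof (rule ccontr)
    assume "\<not> h t2 \<le> h t1"
    then have less: "h t1 < h t2" "t1 < t2" using t(3) by (auto simp: less_le)
    obtain s where s: "s \<in> \<rat>" "t1 < s" "s < t2" using Rats_dense_in_real[OF less(2)] by blast
    obtain c where c: "c \<in> \<rat>" "h t1 < c" "c < h t2" using Rats_dense_in_real[OF less(1)] by blast
    have "t1 \<in> L s c" "t2 \<in> U s c" using t s c by (auto simp: L_def U_def)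
    moreover have "(s, c) \<in> I" using s c t by (auto simp: I_def)
    ultimately have "t1 \<in> N \<or> t2 \<in> N" unfolding N_def Z_def by (force split: if_splits)
    then show False using t by blast
  qed
  ultimately show ?thesis by blast
qed

end

section \<open>Entropies\<close>

lemma Linf_deriv_increment:
  assumes fg: "Linf_deriv f g" and ab: "0 \<le> a" "a \<le> b"
  shows "set_integrable lebesgue {a<..<b} g" "f b - f a = (LINT w:{a<..<b}|lebesgue. g w)"
proof -
  obtain C where C: "AE v in lebesgue_on {0<..}. \<bar>g v\<bar> \<le> C" and m: "g \<in> borel_measurable (lebesgue_on {0<..})"
    and f: "\<And>v. 0 \<le> v \<Longrightarrow> f v = f 0 + (LINT w:{0<..<v}|lebesgue. g w)"
    using fg unfolding Linf_deriv_def by blast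
  have i: "set_integrable lebesgue {x<..<y} g" if "0 \<le> x" for x y
  proof -
    interpret finite_measure "lebesgue_on {x<..<y}" by (rule finite_measure_lebesgue_on_interval)
    have sub: "{x<..<y} \<subseteq> {0<..}" using that by auto
    have "AE w in lebesgue_on {x<..<y}. norm (g w) \<le> C"
    proof -
      have "AE w in lebesgue. w \<in> {0<..} \<longrightarrow> \<bar>g w\<bar> \<le> C"
        using C by (subst (asm) AE_restrict_space_iff) auto
      then have "AE w in lebesgue. w \<in> {x<..<y} \<longrightarrow> norm (g w) \<le> C"
        by eventually_elim (use sub in auto)
      then show ?thesis by (subst AE_restrict_space_iff) auto
    qed
    moreover have "g \<in> borel_measurable (lebesgue_on {x<..<y})"
      using measurable_restrict_mono[OF m sub] .
    ultimately have "integrable (lebesgue_on {x<..<y}) g" by (rule integrable_const_bound)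
    then show ?thesis by (simp add: integrable_restrict_space set_integrable_def)
  qed
  show "set_integrable lebesgue {a<..<b} g" using i ab by simp
  have "AE w in lebesgue. w \<noteq> a" using AE_completion[OF AE_lborel_singleton[of a]] .
  then have "AE w in lebesgue. indicator {0<..<b} w *\<^sub>R g w = indicator {0<..<a} w *\<^sub>R g w + indicator {a<..<b} w *\<^sub>R g w"
    by eventually_elim (use ab in \<open>auto simp: indicator_def\<close>)
  then have "(LINT w:{0<..<b}|lebesgue. g w) = integral\<^sup>L lebesgue (\<lambda>w. indicator {0<..<a} w *\<^sub>R g w + indicator {a<..<b} w *\<^sub>R g w)"
    using i[of 0 a] i[of 0 b] i[of a b] ab unfolding set_lebesgue_integral_def set_integrable_def
    by (intro integral_cong_AE borel_measurable_add) (auto dest: borel_measurable_integrable)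
  also have "\<dots> = (LINT w:{0<..<a}|lebesgue. g w) + (LINT w:{a<..<b}|lebesgue. g w)"
    using i[of 0 a] i[of a b] ab unfolding set_lebesgue_integral_def set_integrable_def
    by (intro Bochner_Integration.integral_add) auto
  finally show "f b - f a = (LINT w:{a<..<b}|lebesgue. g w)" using f[of a] f[of b] ab by simp
qed

lemma set_integral_const_interval:
  fixes c :: real
  assumes "a \<le> b"
  shows "(LINT w:{a<..<b}|lebesgue. c) = c * (b - a)"
  using assms by (simp add: set_lebesgue_integral_def)

lemma Linf_deriv_Lipschitz:
  assumes fg: "Linf_deriv f g"
  obtains L where "0 \<le> L" "\<And>a b. 0 \<le> a \<Longrightarrow> a \<le> b \<Longrightarrow> \<bar>f b - f a\<bar> \<le> L * (b - a)"
proof -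
  obtain C where C: "AE v in lebesgue_on {0<..}. \<bar>g v\<bar> \<le> C"
    using fg unfolding Linf_deriv_def by blast
  have "\<bar>f b - f a\<bar> \<le> max C 0 * (b - a)" if ab: "0 \<le> a" "a \<le> b" for a b
  proof -
    have i: "set_integrable lebesgue {a<..<b} g" and e: "f b - f a = (LINT w:{a<..<b}|lebesgue. g w)"
      using Linf_deriv_increment[OF fg ab] by auto
    have ae: "AE w in lebesgue. w \<in> {0<..} \<longrightarrow> \<bar>g w\<bar> \<le> C"
      using C by (subst (asm) AE_restrict_space_iff) auto
    have i1: "integrable lebesgue (\<lambda>w. indicator {a<..<b} w *\<^sub>R g w)" using i by (simp add: set_integrable_def)
    have i2: "integrable lebesgue (\<lambda>w. indicator {a<..<b} w *\<^sub>R max C 0)"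
      using ab by (intro integrable_scaleR_left integrable_real_indicator) auto
    have "norm (LINT w:{a<..<b}|lebesgue. g w) \<le> integral\<^sup>L lebesgue (\<lambda>w. norm (indicator {a<..<b} w *\<^sub>R g w))"
      unfolding set_lebesgue_integral_def by (rule integral_norm_bound)
    also have "\<dots> \<le> (LINT w:{a<..<b}|lebesgue. max C 0)"
      unfolding set_lebesgue_integral_def
    proof (rule integral_mono_AE[OF integrable_norm[OF i1] i2])
      show "AE w in lebesgue. norm (indicator {a<..<b} w *\<^sub>R g w) \<le> indicator {a<..<b} w *\<^sub>R max C 0"
        using ae by eventually_elim (use ab in \<open>auto simp: indicator_def\<close>)
    qed
    finally have "norm (LINT w:{a<..<b}|lebesgue. g w) \<le> (LINT w:{a<..<b}|lebesgue. max C 0)" .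
    then show ?thesis using e set_integral_const_interval[OF ab(2), of "max C 0"] by simp
  qed
  then show thesis using that[of "max C 0"] by simp
qed

text \<open>
  The flux that belongs to an entropy with derivative \<open>indicator {k<..}\<close>; for the identity in place
  of \<open>f\<close> it is that entropy itself, \<open>(v - k)\<^sup>+ = max v k - k\<close>.
\<close>

lemma Linf_deriv_truncation:
  assumes fg: "Linf_deriv f g" and k: "0 \<le> k"
  shows "Linf_deriv (\<lambda>v. f (max v k) - f k) (\<lambda>w. indicator {k<..} w * g w)"
  unfolding Linf_deriv_def
proof (intro conjI allI impI)
  obtain C where C: "AE v in lebesgue_on {0<..}. \<bar>g v\<bar> \<le> C" and m: "g \<in> borel_measurable (lebesgue_on {0<..})"
    using fg unfolding Linf_deriv_def by blast
  have "(indicator {k<..} :: real \<Rightarrow> real) \<in> borel_measurable (lebesgue_on {0<..})"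
    by (intro measurable_restrict_space1 measurable_completion) simp
  then show "(\<lambda>w. indicator {k<..} w * g w) \<in> borel_measurable (lebesgue_on {0<..})"
    using m by (rule borel_measurable_times)
  have "AE v in lebesgue_on {0<..}. \<bar>indicator {k<..} v * g v\<bar> \<le> C"
    using C by eventually_elim (auto simp: indicator_def)
  then show "\<exists>C. AE v in lebesgue_on {0<..}. \<bar>indicator {k<..} v * g v\<bar> \<le> C" by blast
  fix v :: real assume v: "0 \<le> v"
  have e: "indicator {0<..<v} w *\<^sub>R (indicator {k<..} w * g w) = indicator {k<..<v} w *\<^sub>R g w" for w
    using k by (auto simp: indicator_def)
  have "(LINT w:{0<..<v}|lebesgue. indicator {k<..} w * g w) = f (max v k) - f k"
  proof (cases "k \<le> v")
    case True
    then show ?thesis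
      using Linf_deriv_increment(2)[OF fg k True] unfolding set_lebesgue_integral_def e by simp
  next
    case False
    then have "{k<..<v} = {}" by auto
    then show ?thesis using False unfolding set_lebesgue_integral_def e by simp
  qed
  then show "f (max v k) - f k = f (max 0 k) - f k + (LINT w:{0<..<v}|lebesgue. indicator {k<..} w * g w)"
    using k by simp
qed

lemma Linf_deriv_id: "Linf_deriv (\<lambda>v. v) (\<lambda>_. 1)"
  unfolding Linf_deriv_def
proof (intro conjI allI impI)
  show "\<exists>C. AE v in lebesgue_on {0<..}. \<bar>1 :: real\<bar> \<le> C" by (intro exI[of _ 1]) simp
  show "v = 0 + (LINT w:{0<..<v}|lebesgue. 1)" if "0 \<le> v" for v :: real
    using set_integral_const_interval[OF that, of 1] by simp
qed simp

lemma entropy_pair_truncation: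
  assumes \<phi>: "Linf_deriv \<phi> \<phi>'" "((\<lambda>v. \<phi> v / v) \<longlongrightarrow> C\<phi>) at_top" and k: "0 \<le> k"
  shows "entropy_pair \<phi> (\<lambda>v. max v k - k) (\<lambda>v. \<phi> (max v k) - \<phi> k) 1 C\<phi>"
proof -
  have "convex_on {0..} (\<lambda>v. max v k - k)"
  proof (rule convex_onI)
    fix t x y :: real assume t: "0 < t" "t < 1"
    have "(1 - t) * x + t * y \<le> (1 - t) * max x k + t * max y k"
      using t by (intro add_mono mult_left_mono) auto
    moreover have "(1 - t) * k + t * k \<le> (1 - t) * max x k + t * max y k"
      using t by (intro add_mono mult_left_mono) auto
    moreover have "(1 - t) * k + t * k = k" by (simp add: algebra_simps)
    moreover have "(1 - t) * (max x k - k) + t * (max y k - k) = (1 - t) * max x k + t * max y k - k"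
      by (simp add: algebra_simps)
    ultimately show "max ((1 - t) *\<^sub>R x + t *\<^sub>R y) k - k \<le> (1 - t) * (max x k - k) + t * (max y k - k)"
      by simp
  qed simp
  moreover have "mono_on {0..} (\<lambda>v. max v k - k)" by (auto intro!: mono_onI)
  moreover have "Linf_deriv (\<lambda>v. max v k - k) (\<lambda>w. indicator {k<..} w * 1)"
    by (rule Linf_deriv_truncation[OF Linf_deriv_id k])
  moreover have "Linf_deriv (\<lambda>v. \<phi> (max v k) - \<phi> k) (\<lambda>w. indicator {k<..} w * \<phi>' w)"
    by (rule Linf_deriv_truncation[OF \<phi>(1) k])
  moreover have "((\<lambda>v. (max v k - k) / v) \<longlongrightarrow> 1) at_top"
  proof -
    have "((\<lambda>v. 1 - k / v) \<longlongrightarrow> 1 - 0) at_top"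
      by (intro tendsto_intros tendsto_divide_0[OF tendsto_const] filterlim_at_top_imp_at_infinity filterlim_ident)
    moreover have "eventually (\<lambda>v. 1 - k / v = (max v k - k) / v) at_top"
      using eventually_gt_at_top[of k] eventually_gt_at_top[of 0]
      by eventually_elim (simp add: field_simps)
    ultimately show ?thesis using tendsto_cong by force
  qed
  moreover have "((\<lambda>v. (\<phi> (max v k) - \<phi> k) / v) \<longlongrightarrow> C\<phi>) at_top"
  proof -
    have "((\<lambda>v. \<phi> v / v - \<phi> k / v) \<longlongrightarrow> C\<phi> - 0) at_top"
      by (intro tendsto_intros \<phi> tendsto_divide_0[OF tendsto_const] filterlim_at_top_imp_at_infinity filterlim_ident)
    moreover have "eventually (\<lambda>v. \<phi> v / v - \<phi> k / v = (\<phi> (max v k) - \<phi> k) / v) at_top"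
      using eventually_gt_at_top[of k]
      by eventually_elim (simp add: diff_divide_distrib)
    ultimately show ?thesis using tendsto_cong by force
  qed
  ultimately show ?thesis
    unfolding entropy_pair_def using \<phi>(1)
    by (intro conjI exI[of _ "\<lambda>w. indicator {k<..} w * 1"] exI[of _ "\<lambda>w. indicator {k<..} w * \<phi>' w"] exI[of _ \<phi>']) auto
qed

lemma Linf_deriv_continuous:
  assumes "Linf_deriv f g"
  shows "continuous_on {0..} f"
proof -
  obtain L where L: "0 \<le> L" "\<And>a b. 0 \<le> a \<Longrightarrow> a \<le> b \<Longrightarrow> \<bar>f b - f a\<bar> \<le> L * (b - a)"
    using Linf_deriv_Lipschitz[OF assms] by blast
  have "L-lipschitz_on {0..} f"
  proof (rule lipschitz_onI)
    fix x y :: real assume xy: "x \<in> {0..}" "y \<in> {0..}"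
    show "dist (f x) (f y) \<le> L * dist x y"
    proof (cases "x \<le> y")
      case True
      then show ?thesis using L(2)[of x y] xy by (simp add: dist_real_def abs_minus_commute)
    next
      case False
      then show ?thesis using L(2)[of y x] xy by (simp add: dist_real_def)
    qed
  qed (rule L)
  then show ?thesis by (rule lipschitz_on_continuous_on)
qed

section \<open>Young measures at high truncation levels\<close>

lemma measurable_young_mean:
  assumes \<tau>: "\<tau> \<in> Young_measures T" and f: "continuous_on {0..} f"
  shows "young_mean \<tau> f \<in> borel_measurable (lebesgue_on (strip T))"
proof -
  have "\<tau> \<in> lebesgue_on (strip T) \<rightarrow>\<^sub>M subprob_algebra borel"
    using \<tau> unfolding Young_measures_def by (rule measurable_prob_algebraD)
  moreover have "(\<lambda>\<xi>. indicator {0..} \<xi> *\<^sub>R f \<xi>) \<in> borel_measurable borel"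
    using f by (intro borel_measurable_continuous_on_indicator) auto
  ultimately show ?thesis
    unfolding young_mean_def[abs_def] set_lebesgue_integral_def
    by (rule measurable_compose[OF _ integral_measurable_subprob_algebra])
qed

text \<open>
  The truncated functions vanish pointwise as \<open>k \<rightarrow> \<infinity>\<close> and are dominated by a multiple of the
  identity, whose mean is finite.
\<close>

lemma young_mean_truncation:
  fixes f :: "real \<Rightarrow> real"
  assumes s: "sets (\<tau> p) = sets borel" and i: "set_integrable (\<tau> p) {0..} (\<lambda>\<xi>. \<xi>)"
    and f: "continuous_on {0..} f" and L: "0 \<le> L" "\<And>a b. 0 \<le> a \<Longrightarrow> a \<le> b \<Longrightarrow> \<bar>f b - f a\<bar> \<le> L * (b - a)"
  shows "(\<lambda>k::nat. young_mean \<tau> (\<lambda>v. f (max v (real k)) - f (real k)) p) \<longlonglongrightarrow> 0"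
    and "\<bar>young_mean \<tau> (\<lambda>v. f (max v (real k)) - f (real k)) p\<bar> \<le> L * young_mean \<tau> (\<lambda>\<xi>. \<xi>) p"
proof -
  have m: "(\<lambda>v. indicator {0..} v *\<^sub>R (f (max v (real k)) - f (real k))) \<in> borel_measurable (\<tau> p)" for k :: nat
  proof -
    have "continuous_on {0..} (\<lambda>v. f (max v (real k)) - f (real k))"
      by (intro continuous_intros continuous_on_compose2[OF f]) auto
    from borel_measurable_continuous_on_indicator[OF _ this]
    show ?thesis using s by (simp cong: measurable_cong_sets)
  qed
  have b: "norm (indicator {0..} v *\<^sub>R (f (max v (real k)) - f (real k))) \<le> L * (indicator {0..} v *\<^sub>R v)" for v and k :: nat
  proof (cases "0 \<le> v")
    case True
    have "\<bar>f (max v (real k)) - f (real k)\<bar> \<le> L * (max v (real k) - real k)" by (intro L) auto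
    also have "\<dots> \<le> L * v" using L True by (intro mult_left_mono) auto
    finally show ?thesis using True by simp
  qed simp
  have iL: "integrable (\<tau> p) (\<lambda>v. L * (indicator {0..} v *\<^sub>R v))"
    using i by (intro integrable_mult_right) (simp add: set_integrable_def)
  have lim: "(\<lambda>k::nat. indicator {0..} v *\<^sub>R (f (max v (real k)) - f (real k))) \<longlonglongrightarrow> 0" for v
  proof (rule tendsto_eventually)
    obtain N where N: "v < real N" using reals_Archimedean2 by blast
    show "eventually (\<lambda>k. indicator {0..} v *\<^sub>R (f (max v (real k)) - f (real k)) = 0) sequentially"
      using eventually_ge_at_top[of N]
    proof eventually_elim
      case (elim k)
      then have "max v (real k) = real k" using N by simp
      then show ?case by simp
    qed
  qed
  have "(\<lambda>k. integral\<^sup>L (\<tau> p) (\<lambda>v. indicator {0..} v *\<^sub>R (f (max v (real k)) - f (real k)))) \<longlonglongrightarrow> integral\<^sup>L (\<tau> p) (\<lambda>_. 0)"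
    by (rule integral_dominated_convergence[OF _ m iL]) (use lim b in auto)
  then show "(\<lambda>k::nat. young_mean \<tau> (\<lambda>v. f (max v (real k)) - f (real k)) p) \<longlonglongrightarrow> 0"
    by (simp add: young_mean_def set_lebesgue_integral_def)
  have "norm (integral\<^sup>L (\<tau> p) (\<lambda>v. indicator {0..} v *\<^sub>R (f (max v (real k)) - f (real k)))) \<le>
     integral\<^sup>L (\<tau> p) (\<lambda>v. L * (indicator {0..} v *\<^sub>R v))"
  proof (rule Bochner_Integration.integral_norm_bound_integral[OF _ iL])
    show "integrable (\<tau> p) (\<lambda>v. indicator {0..} v *\<^sub>R (f (max v (real k)) - f (real k)))"
      by (rule Bochner_Integration.integrable_bound[OF iL m]) (use b in \<open>auto intro: order_trans[OF _ abs_ge_self]\<close>)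
    show "norm (indicator {0..} v *\<^sub>R (f (max v (real k)) - f (real k))) \<le> L * (indicator {0..} v *\<^sub>R v)" for v
      by (rule b)
  qed
  also have "\<dots> = L * young_mean \<tau> (\<lambda>\<xi>. \<xi>) p"
    using i by (simp add: young_mean_def set_lebesgue_integral_def)
  finally show "\<bar>young_mean \<tau> (\<lambda>v. f (max v (real k)) - f (real k)) p\<bar> \<le> L * young_mean \<tau> (\<lambda>\<xi>. \<xi>) p"
    by (simp add: young_mean_def set_lebesgue_integral_def)
qed

section \<open>Decay of the singular part\<close>

lemma integral_le_bound_times_Mnorm:
  assumes \<mu>: "\<mu> \<in> Mplus UNIV" and f: "f \<in> borel_measurable borel" "\<And>x. \<bar>f x\<bar> \<le> b"
  shows "\<bar>integral\<^sup>L \<mu> f\<bar> \<le> b * Mnorm \<mu>"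
proof -
  interpret finite_measure \<mu> using \<mu> by (simp add: Mplus_UNIV)
  have m: "f \<in> borel_measurable \<mu>" using \<mu> f(1) by (simp add: Mplus_UNIV cong: measurable_cong_sets)
  have i: "integrable \<mu> f"
    by (rule integrable_const_bound[where B = b]) (simp_all add: f(2) m)
  have "norm (integral\<^sup>L \<mu> f) \<le> (\<integral>x. norm (f x) \<partial>\<mu>)" by (rule integral_norm_bound)
  also have "\<dots> \<le> (\<integral>x. b \<partial>\<mu>)"
    using i by (intro integral_mono) (simp_all add: f(2))
  finally have "norm (integral\<^sup>L \<mu> f) \<le> (\<integral>x. b \<partial>\<mu>)" .
  then show ?thesis by (simp add: Mnorm_def mult.commute)
qed

lemma measurable_C_Cc_on_strip:
  assumes z: "z \<in> C_Cc T"
  shows "(\<lambda>p. z (snd p) (fst p)) \<in> borel_measurable (lebesgue_on (strip T))"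
  using strip_borel by (intro continuous_imp_measurable_on_sets_lebesgue C_Cc_continuous_on_strip z) auto

lemma integrable_reg_lebesgue:
  assumes "u \<in> Mplus (strip T)"
  shows "integrable lebesgue (\<lambda>p. indicator (strip T) p * reg T u p)"
  using integrable_reg[OF assms] by (subst integrable_completion) auto

text \<open>
  The entropies \<open>(v - k)\<^sup>+\<close> see only large values: as \<open>k \<rightarrow> \<infinity>\<close> the terms that involve \<open>u\<^sub>r\<close> and
  \<open>u\<^sub>0\<^sub>r\<close> disappear, whereas \<open>C\<^sub>E = 1\<close> and \<open>C\<^sub>F = C\<^sub>\<phi>\<close> for every \<open>k\<close>.
\<close>

lemma singular_part_inequality:
  assumes u0: "u0 \<in> Mplus UNIV" and \<phi>: "Linf_deriv \<phi> \<phi>'" "((\<lambda>v. \<phi> v / v) \<longlongrightarrow> C\<phi>) at_top"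
    and S: "entropy_subsolution_Y T \<phi> u0 u v \<tau>" and T: "0 \<le> T"
    and z: "z \<in> C1_Cc1 T" "\<And>t x. t \<in> {0..T} \<Longrightarrow> 0 \<le> z t x" "\<And>x. z T x = 0"
    and Z: "ZT \<in> C_Cc T" "ZX \<in> C_Cc T" "\<And>t x. t \<in> {0..T} \<Longrightarrow> dt z t x = ZT t x"
      "\<And>t x. t \<in> {0..T} \<Longrightarrow> dx z t x = ZX t x"
  shows "- (LINT x|sing_part lborel u0. z 0 x) \<le>
    (LINT t|lebesgue_on {0<..<T}. LINT x|sing_part lborel (v t). ZT t x + C\<phi> * ZX t x)"
proof -
  let ?s = "\<lambda>t. sing_part lborel (v t)"
  let ?M = "lebesgue_on {0<..<T}"
  have L: "Linf_Mplus T u v" and \<tau>: "\<tau> \<in> Young_measures T"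
    and mean: "AE p in lebesgue_on (strip T). set_integrable (\<tau> p) {0..} (\<lambda>\<xi>. \<xi>) \<and> reg T u p = young_mean \<tau> (\<lambda>\<xi>. \<xi>) p"
    using S unfolding entropy_subsolution_Y_def by (auto elim: eventually_mono)
  have uM: "u \<in> Mplus (strip T)" using L by (simp add: Linf_Mplus_def)
  define E where "E k v = max v (real k) - real k" for k :: nat and v
  define F where "F k v = \<phi> (max v (real k)) - \<phi> (real k)" for k :: nat and v
  define D where "D k p = indicator (strip T) p *
    (young_mean \<tau> (E k) p * ZT (snd p) (fst p) + young_mean \<tau> (F k) p * ZX (snd p) (fst p))" for k p
  define A where "A k = (LINT x|lebesgue. E k (ac_density lborel u0 x) * z 0 x)" for k
  define J where "J = (LINT t|?M. LINT x|?s t. ZT t x + C\<phi> * ZX t x)"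
  define S0 where "S0 = (LINT x|sing_part lborel u0. z 0 x)"
  have ep: "entropy_pair \<phi> (E k) (F k) 1 C\<phi>" for k
    unfolding E_def[abs_def] F_def[abs_def] by (rule entropy_pair_truncation[OF \<phi>]) simp
  have ineq: "integral\<^sup>L lebesgue (D k) + J \<ge> - A k - S0" for k
  proof -
    have "(LINT (x,t):strip T|lebesgue. young_mean \<tau> (E k) (x,t) * dt z t x + young_mean \<tau> (F k) (x,t) * dx z t x)
        + (LINT t:{0<..<T}|lebesgue. LINT x|?s t. 1 * dt z t x + C\<phi> * dx z t x)
        \<ge> - A k - 1 * S0"
      using S z ep unfolding entropy_subsolution_Y_def A_def S0_def by blast
    moreover have "(LINT (x,t):strip T|lebesgue. young_mean \<tau> (E k) (x,t) * dt z t x + young_mean \<tau> (F k) (x,t) * dx z t x)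
        = integral\<^sup>L lebesgue (D k)"
      unfolding set_lebesgue_integral_def
      by (intro Bochner_Integration.integral_cong) (auto simp: D_def strip_def Z indicator_def)
    moreover have "(LINT t:{0<..<T}|lebesgue. LINT x|?s t. 1 * dt z t x + C\<phi> * dx z t x) = J"
      unfolding set_lebesgue_integral_def J_def
      by (subst integral_restrict_space) (auto simp: Z indicator_def intro!: Bochner_Integration.integral_cong)
    ultimately show ?thesis by simp
  qed
  have "(\<lambda>k. integral\<^sup>L lebesgue (D k)) \<longlonglongrightarrow> integral\<^sup>L lebesgue (\<lambda>p::real \<times> real. 0)"
  proof -
    obtain L where L: "0 \<le> L" "\<And>a b. 0 \<le> a \<Longrightarrow> a \<le> b \<Longrightarrow> \<bar>\<phi> b - \<phi> a\<bar> \<le> L * (b - a)"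
      using Linf_deriv_Lipschitz[OF \<phi>(1)] by blast
    have cid: "continuous_on {0..} (\<lambda>v::real. v)" by (rule continuous_on_id)
    note c\<phi> = Linf_deriv_continuous[OF \<phi>(1)]
    obtain bT where bT: "0 \<le> bT" "\<And>t x. t \<in> {0..T} \<Longrightarrow> \<bar>ZT t x\<bar> \<le> bT" using C_Cc_bounded[OF Z(1)] by blast
    obtain bX where bX: "0 \<le> bX" "\<And>t x. t \<in> {0..T} \<Longrightarrow> \<bar>ZX t x\<bar> \<le> bX" using C_Cc_bounded[OF Z(2)] by blast
    have st: "snd p \<in> {0..T}" if "p \<in> strip T" for p using that by (auto simp: strip_def)
    have mE: "continuous_on {0..} (E k)" for k unfolding E_def by (intro continuous_intros)
    have mF: "continuous_on {0..} (F k)" for k unfolding F_def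
      by (intro continuous_intros continuous_on_compose2[OF c\<phi>]) auto
    have mean': "AE p in lebesgue. p \<in> strip T \<longrightarrow> set_integrable (\<tau> p) {0..} (\<lambda>\<xi>. \<xi>) \<and> reg T u p = young_mean \<tau> (\<lambda>\<xi>. \<xi>) p"
      using mean strip_borel by (subst (asm) AE_restrict_space_iff) auto
    have bounds: "AE p in lebesgue. p \<in> strip T \<longrightarrow>
       (\<lambda>k. young_mean \<tau> (E k) p) \<longlonglongrightarrow> 0 \<and> (\<lambda>k. young_mean \<tau> (F k) p) \<longlonglongrightarrow> 0 \<and>
       (\<forall>k. \<bar>young_mean \<tau> (E k) p\<bar> \<le> reg T u p \<and> \<bar>young_mean \<tau> (F k) p\<bar> \<le> L * reg T u p)"
      using mean'
    proof eventually_elim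
      case (elim p)
      show ?case
      proof
        assume p: "p \<in> strip T"
        then have i: "set_integrable (\<tau> p) {0..} (\<lambda>\<xi>. \<xi>)" and r: "reg T u p = young_mean \<tau> (\<lambda>\<xi>. \<xi>) p"
          using elim by auto
        have "\<tau> p \<in> space (prob_algebra borel)"
          using \<tau> p unfolding Young_measures_def by (intro measurable_space[of \<tau>]) (auto simp: space_restrict_space)
        then have s: "sets (\<tau> p) = sets borel" by (simp add: space_prob_algebra)
        have L1: "\<bar>b - a\<bar> \<le> 1 * (b - a)" if "0 \<le> a" "a \<le> b" for a b :: real using that by simp
        note e = young_mean_truncation[where \<tau> = \<tau> and p = p and f = "\<lambda>v. v", OF s i cid zero_le_one L1]
        note f = young_mean_truncation[where \<tau> = \<tau> and p = p, OF s i c\<phi> L]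
        show "(\<lambda>k. young_mean \<tau> (E k) p) \<longlonglongrightarrow> 0 \<and> (\<lambda>k. young_mean \<tau> (F k) p) \<longlonglongrightarrow> 0 \<and>
          (\<forall>k. \<bar>young_mean \<tau> (E k) p\<bar> \<le> reg T u p \<and> \<bar>young_mean \<tau> (F k) p\<bar> \<le> L * reg T u p)"
          unfolding E_def F_def r using e f by simp
      qed
    qed
    show ?thesis
    proof (rule integral_dominated_convergence[where w = "\<lambda>p. (bT + L * bX) * (indicator (strip T) p * reg T u p)"])
      show "integrable lebesgue (\<lambda>p. (bT + L * bX) * (indicator (strip T) p * reg T u p))"
        by (rule integrable_mult_right[OF integrable_reg_lebesgue[OF uM]])
      show "D k \<in> borel_measurable lebesgue" for k
      proof -
        have "(\<lambda>p. young_mean \<tau> (E k) p * ZT (snd p) (fst p) + young_mean \<tau> (F k) p * ZX (snd p) (fst p))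
          \<in> borel_measurable (lebesgue_on (strip T))"
          by (intro borel_measurable_add borel_measurable_times measurable_young_mean[OF \<tau> mE]
             measurable_young_mean[OF \<tau> mF] measurable_C_Cc_on_strip Z)
        then show ?thesis
          using strip_borel unfolding D_def[abs_def] by (subst (asm) borel_measurable_restrict_space_iff) auto
      qed
      show "AE p in lebesgue. (\<lambda>k. D k p) \<longlonglongrightarrow> 0"
        using bounds
      proof eventually_elim
        case (elim p)
        show ?case
        proof (cases "p \<in> strip T")
          case True
          then have "(\<lambda>k. D k p) \<longlonglongrightarrow> indicator (strip T) p * (0 * ZT (snd p) (fst p) + 0 * ZX (snd p) (fst p))"
            unfolding D_def using elim by (intro tendsto_intros) auto
          then show ?thesis by simp
        qed (simp add: D_def)
      qed
      show "AE p in lebesgue. norm (D k p) \<le> (bT + L * bX) * (indicator (strip T) p * reg T u p)" for k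
        using bounds
      proof eventually_elim
        case (elim p)
        show ?case
        proof (cases "p \<in> strip T")
          case True
          then have e: "\<bar>young_mean \<tau> (E k) p\<bar> \<le> reg T u p" and f: "\<bar>young_mean \<tau> (F k) p\<bar> \<le> L * reg T u p"
            using elim by auto
          have "\<bar>young_mean \<tau> (E k) p * ZT (snd p) (fst p)\<bar> \<le> reg T u p * bT"
            unfolding abs_mult using e bT st[OF True] reg_nonneg[OF uM] by (intro mult_mono) auto
          moreover have "\<bar>young_mean \<tau> (F k) p * ZX (snd p) (fst p)\<bar> \<le> (L * reg T u p) * bX"
            unfolding abs_mult using f bX st[OF True] reg_nonneg[OF uM] L(1) by (intro mult_mono) auto
          ultimately show ?thesis using True by (simp add: D_def algebra_simps)
        qed (simp add: D_def)
      qed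
    qed simp
  qed
  then have I0: "(\<lambda>k. integral\<^sup>L lebesgue (D k)) \<longlonglongrightarrow> 0" by simp
  have "(\<lambda>k. A k) \<longlonglongrightarrow> integral\<^sup>L lebesgue (\<lambda>x::real. 0)"
  proof -
    define r where "r = ac_density lborel u0"
    have fu: "finite_measure u0" "sets u0 = sets lborel" using u0 by (auto simp: Mplus_UNIV)
    have ir: "integrable lborel r" unfolding r_def by (rule integrable_ac_density[OF sigma_finite_lborel fu])
    have r0: "0 \<le> r x" for x by (simp add: r_def ac_density_nonneg)
    have zC: "z \<in> C_Cc T" using z(1) by (simp add: C1_Cc1_def C_Cc1_def)
    obtain b where b: "0 \<le> b" "\<And>t x. t \<in> {0..T} \<Longrightarrow> \<bar>z t x\<bar> \<le> b" using C_Cc_bounded[OF zC] by blast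
    have "continuous_on UNIV (z 0)" using zC T by (auto simp: C_Cc_def)
    then have mz: "z 0 \<in> borel_measurable borel" by (rule borel_measurable_continuous_onI)
    have mr: "r \<in> borel_measurable borel" using borel_measurable_integrable[OF ir] by simp
    have ir': "integrable lebesgue r" using ir by (subst integrable_completion) auto
    show ?thesis
      unfolding A_def r_def[symmetric]
    proof (rule integral_dominated_convergence[where w = "\<lambda>x. b * r x"])
      show "integrable lebesgue (\<lambda>x. b * r x)" by (rule integrable_mult_right[OF ir'])
      show "(\<lambda>x. E k (r x) * z 0 x) \<in> borel_measurable lebesgue" for k
      proof (rule measurable_completion)
        show "(\<lambda>x. E k (r x) * z 0 x) \<in> borel_measurable lborel"
          using mz mr unfolding E_def by simp
      qed
      show "AE x in lebesgue. norm (E k (r x) * z 0 x) \<le> b * r x" for k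
      proof (rule AE_I2)
        fix x
        have "\<bar>E k (r x)\<bar> \<le> r x" using r0[of x] by (auto simp: E_def)
        then have "\<bar>E k (r x)\<bar> * \<bar>z 0 x\<bar> \<le> r x * b" using b(2)[of 0 x] T r0[of x] by (intro mult_mono) auto
        then show "norm (E k (r x) * z 0 x) \<le> b * r x" by (simp add: abs_mult mult.commute)
      qed
      show "AE x in lebesgue. (\<lambda>k. E k (r x) * z 0 x) \<longlonglongrightarrow> 0"
      proof (rule AE_I2, rule tendsto_eventually)
        fix x
        obtain N where N: "r x < real N" using reals_Archimedean2 by blast
        show "eventually (\<lambda>k. E k (r x) * z 0 x = 0) sequentially"
          using eventually_ge_at_top[of N]
        proof eventually_elim
          case (elim k)
          then have "max (r x) (real k) = real k" using N by simp
          then show ?case by (simp add: E_def)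
        qed
      qed
    qed simp
  qed
  then have A0: "(\<lambda>k. A k) \<longlonglongrightarrow> 0" by simp
  have l: "(\<lambda>k. - A k - S0) \<longlonglongrightarrow> - 0 - S0" "(\<lambda>k. integral\<^sup>L lebesgue (D k) + J) \<longlonglongrightarrow> 0 + J"
    by (intro tendsto_intros A0 I0)+
  have "- 0 - S0 \<le> 0 + J"
    by (rule LIMSEQ_le[OF l]) (use ineq in auto)
  then show ?thesis unfolding S0_def J_def by simp
qed


text \<open>
  With the test function \<open>\<rho>(x - C\<^sub>\<phi> t) g(t)\<close> the derivatives of \<open>\<rho>\<close> cancel in
  \<open>\<zeta>\<^sub>t + C\<^sub>\<phi> \<zeta>\<^sub>x = \<rho>(x - C\<^sub>\<phi> t) g'(t)\<close>, so that only time remains as a variable.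
\<close>

lemma singular_part_weakly_nonincreasing:
  assumes u0: "u0 \<in> Mplus UNIV" and \<phi>: "Linf_deriv \<phi> \<phi>'" "((\<lambda>v. \<phi> v / v) \<longlongrightarrow> C\<phi>) at_top"
    and S: "entropy_subsolution_Y T \<phi> u0 u v \<tau>" and T: "0 \<le> T"
    and \<rho>: "C2 \<rho>" "\<And>x. 0 \<le> \<rho> x" "\<And>x. \<rho> x \<le> 1" "\<forall>x. R < \<bar>x\<bar> \<longrightarrow> \<rho> x = 0"
  shows "\<exists>B. weakly_nonincreasing T (LINT x|sing_part lborel u0. \<rho> x) B
    (\<lambda>t. LINT x|sing_part lborel (v t). \<rho> (x - C\<phi> * t))"
proof -
  let ?s = "\<lambda>t. sing_part lborel (v t)"
  let ?M = "lebesgue_on {0<..<T}"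
  have L: "Linf_Mplus T u v" using S unfolding entropy_subsolution_Y_def by blast
  have c\<rho>: "continuous_on UNIV \<rho>" by (rule C2D(4)[OF \<rho>(1)])
  have m\<rho>: "(\<lambda>x. \<rho> (x - a)) \<in> borel_measurable borel" for a
    by (intro borel_measurable_continuous_onI continuous_on_compose2[OF c\<rho>] continuous_intros) auto
  have zC: "(\<lambda>t x. \<rho> (x - C\<phi> * t) * 1) \<in> C_Cc T"
    using \<rho>(4) by (intro C_Cc_travelling[OF c\<rho>]) auto
  obtain C where C: "AE t in ?M.
      ?s t \<in> Mplus UNIV \<and> Mnorm (?s t) \<le> C"
    using sing_part_slice_bound[OF L] by blast
  show ?thesis
  proof (intro exI[of _ C] weakly_nonincreasing.intro)
    show "(\<lambda>t. LINT x|?s t. \<rho> (x - C\<phi> * t)) \<in> borel_measurable (?M)"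
      using measurable_sing_part_slice[OF L zC] by simp
    show "AE t in ?M. \<bar>LINT x|?s t. \<rho> (x - C\<phi> * t)\<bar> \<le> C"
      using C
    proof eventually_elim
      case (elim t)
      have "\<bar>LINT x|?s t. \<rho> (x - C\<phi> * t)\<bar> \<le> 1 * Mnorm (?s t)"
        using elim \<rho> by (intro integral_le_bound_times_Mnorm m\<rho>) auto
      then show ?case using elim by simp
    qed
    fix w g :: "real \<Rightarrow> real"
    assume w: "continuous_on UNIV w" and g: "\<And>t. t \<in> {0..T} \<Longrightarrow> (g has_real_derivative w t) (at t)"
      and g0: "\<And>t. t \<in> {0..T} \<Longrightarrow> 0 \<le> g t" and gT: "g T = 0"
    have cw: "continuous_on {0..T} w" using w by (rule continuous_on_subset) simp
    have g': "\<forall>t\<in>{0..T}. (g has_real_derivative w t) (at t)" using g by blast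
    define z where "z = (\<lambda>t x. \<rho> (x - C\<phi> * t) * g t)"
    define ZT where "ZT = (\<lambda>t x. \<rho> (x - C\<phi> * t) * w t - C\<phi> * (deriv \<rho> (x - C\<phi> * t) * g t))"
    define ZX where "ZX = (\<lambda>t x. deriv \<rho> (x - C\<phi> * t) * g t)"
    note test = travelling_test_function[OF \<rho>(1,4) cw g', where c = C\<phi>]
    have "- (LINT x|sing_part lborel u0. z 0 x) \<le>
      (LINT t|?M. LINT x|?s t. ZT t x + C\<phi> * ZX t x)"
    proof (rule singular_part_inequality[OF u0 \<phi> S T])
      show "0 \<le> z t x" if "t \<in> {0..T}" for t x using \<rho>(2) g0[OF that] by (simp add: z_def)
      show "z T x = 0" for x by (simp add: z_def gT)
      show "z \<in> C1_Cc1 T" "ZT \<in> C_Cc T" "ZX \<in> C_Cc T" unfolding z_def ZT_def ZX_def by (rule test)+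
      show "dx z t x = ZX t x" for t x unfolding z_def ZX_def by (rule test(4))
      show "dt z t x = ZT t x" if "t \<in> {0..T}" for t x unfolding z_def ZT_def using that by (rule test(5))
    qed
    moreover have "ZT t x + C\<phi> * ZX t x = w t * \<rho> (x - C\<phi> * t)" for t x
      by (simp add: ZT_def ZX_def algebra_simps)
    moreover have "(LINT x|sing_part lborel u0. z 0 x) = g 0 * (LINT x|sing_part lborel u0. \<rho> x)"
      by (simp add: z_def mult.commute)
    ultimately show "- g 0 * (LINT x|sing_part lborel u0. \<rho> x) \<le>
      integral\<^sup>L (?M) (\<lambda>t. (LINT x|?s t. \<rho> (x - C\<phi> * t)) * w t)"
      by (simp add: mult.commute)
  qed
qed

text \<open>
  Both measures are transported back to time \<open>0\<close>, where they are compared on the same profiles.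
\<close>

lemma Mplus_le_translateI:
  assumes \<mu>: "\<mu> \<in> Mplus UNIV" and \<nu>: "\<nu> \<in> Mplus UNIV"
    and le: "\<And>n L. L \<in> lists (\<rat> \<times> \<rat>) \<Longrightarrow> (LINT x|\<mu>. plateau n L (x - a)) \<le> (LINT x|\<nu>. plateau n L (x - b))"
  shows "Mplus_le \<mu> (translate (a - b) \<nu>)"
proof (rule Mplus_leI[OF \<mu> translate_Mplus[OF \<nu>]])
  fix A :: "real set" assume A: "A \<in> sets borel"
  define A' where "A' = (\<lambda>x. x + a) -` A"
  have "(\<lambda>x. x + a) \<in> borel_measurable borel" by simp
  from measurable_sets[OF this A] have mA: "A' \<in> sets borel" by (simp add: A'_def)
  have mp: "plateau n L \<in> borel_measurable borel" for n L
    by (rule borel_measurable_continuous_onI[OF C2D(4)[OF C2_plateau]])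
  have "emeasure (translate (- a) \<mu>) A' \<le> emeasure (translate (- b) \<nu>) A'"
  proof (rule emeasure_le_if_plateau_integrals_le[OF translate_Mplus[OF \<mu>] translate_Mplus[OF \<nu>] _ mA])
    show "(LINT x|translate (- a) \<mu>. plateau n L x) \<le> (LINT x|translate (- b) \<nu>. plateau n L x)"
      if "L \<in> lists (\<rat> \<times> \<rat>)" for n L
      using le[OF that, of n] by (simp add: integral_translate[OF \<mu> mp] integral_translate[OF \<nu> mp])
  qed
  moreover have "emeasure (translate (- a) \<mu>) A' = emeasure \<mu> A"
    by (subst emeasure_translate[OF \<mu> mA]) (simp add: A'_def vimage_def)
  moreover have "emeasure (translate (- b) \<nu>) A' = emeasure (translate (a - b) \<nu>) A"
    by (subst emeasure_translate[OF \<nu> mA], subst emeasure_translate[OF \<nu> A])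
       (simp add: A'_def vimage_def algebra_simps)
  ultimately show "emeasure \<mu> A \<le> emeasure (translate (a - b) \<nu>) A" by simp
qed

lemma Mplus_le_translate_Mnorm:
  assumes le: "Mplus_le \<mu> (translate a \<nu>)" and \<nu>: "\<nu> \<in> Mplus UNIV"
  shows "Mnorm \<mu> \<le> Mnorm \<nu>"
proof -
  obtain \<sigma> where "\<And>A. A \<in> sets borel \<Longrightarrow> measure (translate a \<nu>) A - measure \<mu> A = measure \<sigma> A"
    and \<mu>: "\<mu> \<in> Mplus UNIV"
    using le unfolding Mplus_le_def by blast
  from this(1)[of UNIV] have "measure \<mu> UNIV \<le> measure (translate a \<nu>) UNIV"
    using measure_nonneg[of \<sigma> UNIV] by (simp del: measure_nonneg)
  also have "\<dots> = measure \<nu> UNIV"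
    using emeasure_translate[OF \<nu>, of UNIV a] by (simp add: measure_def)
  finally show ?thesis
    using \<mu> \<nu> sets_eq_imp_space_eq[of \<mu> borel] sets_eq_imp_space_eq[of \<nu> borel]
    by (simp add: Mnorm_def Mplus_UNIV)
qed

theorem entropy_subsolution_singular_part:
  assumes u0: "u0 \<in> Mplus UNIV" and \<phi>: "Linf_deriv \<phi> \<phi>'" "((\<lambda>v. \<phi> v / v) \<longlongrightarrow> C\<phi>) at_top"
    and S: "entropy_subsolution_Y T \<phi> u0 u v \<tau>" and T: "0 \<le> T"
  shows "\<exists>N\<in>null_sets lebesgue. \<forall>t1\<in>{0..T} - N. \<forall>t2\<in>{0..T} - N. t1 \<le> t2 \<longrightarrow>
      Mplus_le (sing_part lborel (v t2)) (translate (C\<phi> * (t2 - t1)) (sing_part lborel (v t1)))"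
    and "AE t in lebesgue_on {0<..<T}. Mplus_le (sing_part lborel (v t)) (translate (C\<phi> * t) (sing_part lborel u0))"
proof -
  let ?s = "\<lambda>t. sing_part lborel (v t)"
  let ?M = "lebesgue_on {0<..<T}"
  define I where "I = (UNIV :: nat set) \<times> lists ((\<rat> :: real set) \<times> (\<rat> :: real set))"
  have cI: "countable I"
    unfolding I_def by (intro countable_SIGMA countable_lists countable_rat) auto
  define h where "h i t = (LINT x|?s t. plateau (fst i) (snd i) (x - C\<phi> * t))" for i t
  define h0 where "h0 i = (LINT x|sing_part lborel u0. plateau (fst i) (snd i) x)" for i
  have L: "Linf_Mplus T u v" using S unfolding entropy_subsolution_Y_def by blast
  have wn: "\<exists>B. weakly_nonincreasing T (h0 i) B (h i)" for i
  proof -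
    obtain R where R: "\<forall>x. R < \<bar>x\<bar> \<longrightarrow> plateau (fst i) (snd i) x = 0" using plateau_bounded_support by blast
    show ?thesis
      unfolding h_def[abs_def] h0_def
      by (rule singular_part_weakly_nonincreasing[OF u0 \<phi> S T C2_plateau plateau_bounds R])
  qed
  obtain C where "AE t in ?M.
      ?s t \<in> Mplus UNIV \<and> Mnorm (?s t) \<le> C"
    using sing_part_slice_bound[OF L] by blast
  then have M: "AE t in ?M. ?s t \<in> Mplus UNIV"
    by eventually_elim simp
  have u0s: "sing_part lborel u0 \<in> Mplus UNIV" by (rule sing_part_Mplus[OF u0])
  have "AE t in ?M. \<forall>i\<in>I. h i t \<le> h0 i"
    unfolding AE_ball_countable[OF cI] using wn weakly_nonincreasing.AE_le_initial by blast
  with M show "AE t in ?M. Mplus_le (?s t) (translate (C\<phi> * t) (sing_part lborel u0))"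
  proof eventually_elim
    case (elim t)
    have "Mplus_le (?s t) (translate (C\<phi> * t - 0) (sing_part lborel u0))"
    proof (rule Mplus_le_translateI[OF elim(1) u0s])
      show "(LINT x|?s t. plateau n L (x - C\<phi> * t)) \<le> (LINT x|sing_part lborel u0. plateau n L (x - 0))"
        if "L \<in> lists (\<rat> \<times> \<rat>)" for n L
        using bspec[OF elim(2), of "(n, L)"] that by (simp add: h_def h0_def I_def)
    qed
    then show ?case by simp
  qed
  have "\<forall>i. \<exists>N\<in>null_sets lebesgue. \<forall>t1\<in>{0<..<T} - N. \<forall>t2\<in>{0<..<T} - N. t1 \<le> t2 \<longrightarrow> h i t2 \<le> h i t1"
    using wn weakly_nonincreasing.AE_antimono by blast
  then obtain N where N: "\<And>i. N i \<in> null_sets lebesgue"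
    "\<And>i t1 t2. t1 \<in> {0<..<T} - N i \<Longrightarrow> t2 \<in> {0<..<T} - N i \<Longrightarrow> t1 \<le> t2 \<Longrightarrow> h i t2 \<le> h i t1"
    by metis
  obtain N0 where N0: "N0 \<in> null_sets lebesgue" "\<And>t. t \<in> {0<..<T} - N0 \<Longrightarrow> ?s t \<in> Mplus UNIV"
  proof -
    have "AE t in lebesgue. t \<in> {0<..<T} \<longrightarrow> ?s t \<in> Mplus UNIV"
      using M by (simp add: AE_strip_time_iff)
    then obtain N0 where N0: "{t \<in> space lebesgue. \<not> (t \<in> {0<..<T} \<longrightarrow> ?s t \<in> Mplus UNIV)} \<subseteq> N0"
      "emeasure lebesgue N0 = 0" "N0 \<in> sets lebesgue"
      by (rule AE_E)
    then show thesis by (intro that[of N0]) auto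
  qed
  \<comment> \<open>The slices at the times \<open>0\<close> and \<open>T\<close> are arbitrary.\<close>
  define Z where "Z = (\<Union>i\<in>I. N i) \<union> N0 \<union> {0} \<union> {T}"
  have "Z \<in> null_sets lebesgue"
  proof -
    have "(\<Union>i\<in>I. N i) \<in> null_sets lebesgue" using cI N(1) by (intro null_sets_UN') auto
    moreover have "{a} \<in> null_sets lebesgue" for a :: real
      by (intro null_sets_completionI finite_imp_null_set_lborel) simp
    ultimately show ?thesis unfolding Z_def using N0(1) by (intro null_sets.Un) auto
  qed
  moreover have "Mplus_le (?s t2) (translate (C\<phi> * (t2 - t1)) (?s t1))"
    if t: "t1 \<in> {0..T} - Z" "t2 \<in> {0..T} - Z" "t1 \<le> t2" for t1 t2
  proof -
    have t': "t1 \<in> {0<..<T}" "t2 \<in> {0<..<T}" "t1 \<notin> N0" "t2 \<notin> N0"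
      using t by (auto simp: Z_def less_le)
    have "Mplus_le (?s t2) (translate (C\<phi> * t2 - C\<phi> * t1) (?s t1))"
    proof (rule Mplus_le_translateI)
      show "(LINT x|?s t2. plateau n L (x - C\<phi> * t2)) \<le> (LINT x|?s t1. plateau n L (x - C\<phi> * t1))"
        if "L \<in> lists (\<rat> \<times> \<rat>)" for n L
      proof -
        have "(n, L) \<in> I" using that by (simp add: I_def)
        then have "t1 \<notin> N (n, L)" "t2 \<notin> N (n, L)" using t by (auto simp: Z_def)
        then show ?thesis using N(2)[of t1 "(n, L)" t2] t' t(3) by (simp add: h_def)
      qed
    qed (use N0(2) t' in auto)
    then show ?thesis by (simp add: right_diff_distrib)
  qed
  ultimately show "\<exists>N\<in>null_sets lebesgue. \<forall>t1\<in>{0..T} - N. \<forall>t2\<in>{0..T} - N. t1 \<le> t2 \<longrightarrow>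
      Mplus_le (?s t2) (translate (C\<phi> * (t2 - t1)) (?s t1))"
    by blast
qed

section \<open>Conservation of mass\<close>

text \<open>
  The third power makes the cutoff twice continuously differentiable.
\<close>

definition cutoff :: "nat \<Rightarrow> real \<Rightarrow> real" where
  "cutoff n x = max 0 (1 - (x / real (Suc n))\<^sup>2) ^ 3"

lemma C2_cutoff: "C2 (cutoff n)"
proof -
  let ?a = "1 / real (Suc n)"
  have "C2 (\<lambda>x. 1 + (- 1) * ((?a * x + 0) * (?a * x + 0)))"
    by (intro C2_add C2_mult C2_const C2_affine)
  from C2_compose[OF C2_max_0_cube this] show ?thesis
    unfolding cutoff_def[abs_def] by (simp add: power2_eq_square)
qed

lemma cutoff_bounds: "0 \<le> cutoff n x" "cutoff n x \<le> 1"
  unfolding cutoff_def by (auto intro!: power_le_one)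

lemma cutoff_support: "\<forall>x. real (Suc n) < \<bar>x\<bar> \<longrightarrow> cutoff n x = 0"
proof (intro allI impI)
  fix x assume "real (Suc n) < \<bar>x\<bar>"
  then have "1 < \<bar>x / real (Suc n)\<bar>" by (simp add: field_simps)
  then have "1 < (x / real (Suc n))\<^sup>2" by (metis one_less_power power2_abs zero_less_numeral)
  then show "cutoff n x = 0" by (simp add: cutoff_def)
qed

lemma cutoff_tendsto: "(\<lambda>n. cutoff n x) \<longlonglongrightarrow> 1"
proof -
  have l: "(\<lambda>n. x / real (Suc n)) \<longlonglongrightarrow> 0"
    using LIMSEQ_Suc[OF lim_const_over_n[of x]] by simp
  have "(\<lambda>n. max 0 (1 - (x / real (Suc n))\<^sup>2) ^ 3) \<longlonglongrightarrow> max 0 (1 - 0\<^sup>2) ^ 3"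
    by (intro tendsto_intros l)
  then show ?thesis by (simp add: cutoff_def)
qed

lemma cutoff_deriv_bound: "\<bar>deriv (cutoff n) x\<bar> \<le> 6 / real (Suc n)"
proof (cases "real (Suc n) < \<bar>x\<bar>")
  case True
  have "deriv (cutoff n) x = 0"
    using deriv_eq_0_outside_support[OF cutoff_support C2D(1)[OF C2_cutoff]] True by blast
  then show ?thesis by simp
next
  case False
  define N where "N = real (Suc n)"
  have N: "0 < N" "\<bar>x\<bar> \<le> N" using False by (auto simp: N_def)
  define y where "y = 1 - (x / N)\<^sup>2"
  have d2: "((\<lambda>x. 1 - (x / N)\<^sup>2) has_real_derivative - (2 * x / N\<^sup>2)) (at x)"
    using N by (auto intro!: derivative_eq_intros simp: power2_eq_square)
  have "(cutoff n has_real_derivative 3 * (max 0 y)\<^sup>2 * - (2 * x / N\<^sup>2)) (at x)"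
    unfolding cutoff_def[abs_def] N_def[symmetric] using DERIV_chain2[OF has_derivative_max_0_cube d2] by (simp add: y_def)
  then have "deriv (cutoff n) x = 3 * (max 0 y)\<^sup>2 * - (2 * x / N\<^sup>2)" by (rule DERIV_imp_deriv)
  then have "\<bar>deriv (cutoff n) x\<bar> = (max 0 y)\<^sup>2 * (6 * \<bar>x\<bar> / N\<^sup>2)" by (simp add: abs_mult)
  also have "\<dots> \<le> 1 * (6 * N / N\<^sup>2)"
  proof (intro mult_mono divide_right_mono mult_left_mono N)
    show "(max 0 y)\<^sup>2 \<le> 1" by (intro power_le_one) (auto simp: y_def)
  qed auto
  also have "\<dots> = 6 / N" using N by (simp add: power2_eq_square)
  finally show ?thesis by (simp add: N_def)
qed

lemma cutoff_deriv_tendsto: "(\<lambda>n. deriv (cutoff n) x) \<longlonglongrightarrow> 0"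
proof (rule Lim_null_comparison)
  show "eventually (\<lambda>n. norm (deriv (cutoff n) x) \<le> 6 / real (Suc n)) sequentially"
    using cutoff_deriv_bound by (intro always_eventually) auto
  show "(\<lambda>n. 6 / real (Suc n)) \<longlonglongrightarrow> 0"
    using LIMSEQ_Suc[OF lim_const_over_n[of 6]] by simp
qed

lemma cutoff_deriv_bound_6: "\<bar>deriv (cutoff n) x\<bar> \<le> 6"
proof -
  have "6 / real (Suc n) \<le> 6 / 1" by (intro divide_left_mono) auto
  then show ?thesis using cutoff_deriv_bound[of n x] by simp
qed

lemma integral_cutoff_tendsto:
  assumes \<mu>: "\<mu> \<in> Mplus UNIV"
  shows "(\<lambda>n. LINT x|\<mu>. cutoff n x * a + deriv (cutoff n) x * b) \<longlonglongrightarrow> a * Mnorm \<mu>"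
proof -
  interpret finite_measure \<mu> using \<mu> by (simp add: Mplus_UNIV)
  have mc: "(\<lambda>x. cutoff n x * a + deriv (cutoff n) x * b) \<in> borel_measurable \<mu>" for n
  proof -
    have "(\<lambda>x. cutoff n x * a + deriv (cutoff n) x * b) \<in> borel_measurable borel"
      by (intro borel_measurable_continuous_onI continuous_intros C2D(4)[OF C2_cutoff]
          C2D(5)[OF C2_cutoff])
    then show ?thesis using \<mu> by (simp add: Mplus_UNIV cong: measurable_cong_sets)
  qed
  have "(\<lambda>n. LINT x|\<mu>. cutoff n x * a + deriv (cutoff n) x * b) \<longlonglongrightarrow> (LINT x|\<mu>. 1 * a + 0 * b)"
  proof (rule integral_dominated_convergence[where w = "\<lambda>_. \<bar>a\<bar> + 6 * \<bar>b\<bar>"])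
    show "AE x in \<mu>. (\<lambda>n. cutoff n x * a + deriv (cutoff n) x * b) \<longlonglongrightarrow> 1 * a + 0 * b"
      by (intro AE_I2 tendsto_intros cutoff_tendsto cutoff_deriv_tendsto)
    show "AE x in \<mu>. norm (cutoff n x * a + deriv (cutoff n) x * b) \<le> \<bar>a\<bar> + 6 * \<bar>b\<bar>" for n
    proof (rule AE_I2)
      fix x
      have "\<bar>cutoff n x\<bar> * \<bar>a\<bar> \<le> 1 * \<bar>a\<bar>" using cutoff_bounds[of n x] by (intro mult_right_mono) auto
      moreover have "\<bar>deriv (cutoff n) x\<bar> * \<bar>b\<bar> \<le> 6 * \<bar>b\<bar>"
        using cutoff_deriv_bound_6[of n x] by (intro mult_right_mono) auto
      ultimately show "norm (cutoff n x * a + deriv (cutoff n) x * b) \<le> \<bar>a\<bar> + 6 * \<bar>b\<bar>"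
        using abs_triangle_ineq[of "cutoff n x * a" "deriv (cutoff n) x * b"] by (simp add: abs_mult)
    qed
  qed (use mc in auto)
  then show ?thesis by (simp add: Mnorm_def mult.commute)
qed

lemma integral_reg_slices:
  assumes u: "u \<in> Mplus (strip T)" and w: "continuous_on UNIV w"
  shows "integrable (lebesgue_on {0<..<T}) (\<lambda>t. (LINT x|lborel. reg T u (x, t)) * w t)" (is ?I)
    and "integral\<^sup>L lebesgue (\<lambda>p. indicator (strip T) p * (reg T u p * w (snd p))) =
      (LINT t|lebesgue_on {0<..<T}. (LINT x|lborel. reg T u (x, t)) * w t)" (is ?E)
proof -
  define f where "f p = indicator (strip T) p * (reg T u p * w (snd p))" for p
  have "bounded (w ` {0..T})"
    using w by (intro compact_imp_bounded compact_continuous_image continuous_on_subset[OF w]) auto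
  then obtain b where b: "\<forall>t\<in>{0..T}. \<bar>w t\<bar> \<le> b" unfolding bounded_iff by auto
  have "integrable lborel (\<lambda>p. indicator (strip T) p * (w (snd p) * reg T u p))"
  proof (rule integrable_bounded_times_reg[OF u])
    show "continuous_on (strip T) (\<lambda>p. w (snd p))"
      by (intro continuous_on_compose2[OF w] continuous_intros) auto
    show "\<bar>w (snd p)\<bar> \<le> b" if "p \<in> strip T" for p using bspec[OF b, of "snd p"] that by (auto simp: strip_def)
  qed
  then have "integrable lborel f" by (simp add: f_def[abs_def] mult.commute)
  then have "integrable (lborel \<Otimes>\<^sub>M lborel) (\<lambda>(x, t). f (x, t))"
    by (simp add: lborel_prod)
  note i = lborel_pair.integrable_snd[OF this] and e = lborel_pair.integral_snd[OF this]
  have ft: "(LINT x|lborel. f (x, t)) = indicator {0<..<T} t *\<^sub>R ((LINT x|lborel. reg T u (x, t)) * w t)" for t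
    by (simp add: f_def strip_def indicator_def)
  have i': "integrable lebesgue (\<lambda>t. indicator {0<..<T} t *\<^sub>R ((LINT x|lborel. reg T u (x, t)) * w t))"
    using i unfolding ft by (subst integrable_completion) auto
  then show ?I by (simp add: integrable_restrict_space)
  have "integral\<^sup>L lebesgue f = integral\<^sup>L lborel f"
    using \<open>integrable lborel f\<close> by (intro integral_completion) auto
  also have "\<dots> = (LINT t|lborel. indicator {0<..<T} t *\<^sub>R ((LINT x|lborel. reg T u (x, t)) * w t))"
    using e unfolding ft by (simp add: lborel_prod)
  also have "\<dots> = (LINT t|lebesgue. indicator {0<..<T} t *\<^sub>R ((LINT x|lborel. reg T u (x, t)) * w t))"
    using i unfolding ft by (intro integral_completion[symmetric]) auto
  also have "\<dots> = (LINT t|lebesgue_on {0<..<T}. (LINT x|lborel. reg T u (x, t)) * w t)"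
    by (simp add: integral_restrict_space)
  finally show ?E unfolding f_def .
qed

text \<open>
  Testing with \<open>\<chi>(x) g(t)\<close> and letting the cutoff \<open>\<chi>\<close> tend to \<open>1\<close> removes the flux, because
  \<open>\<chi>'\<close> tends to \<open>0\<close>, \<open>\<phi>(u\<^sub>r)\<close> is integrable and \<open>u\<^sub>s(\<cdot>,t)\<close> has bounded mass.
\<close>

lemma mass_identity:
  assumes u0: "u0 \<in> Mplus UNIV" and \<phi>: "Linf_deriv \<phi> \<phi>'" "\<phi> 0 = 0"
    and S: "solution_P T \<phi> C\<phi> u0 u v" and T: "0 \<le> T"
    and w: "continuous_on UNIV w" and g: "\<And>t. t \<in> {0..T} \<Longrightarrow> (g has_real_derivative w t) (at t)"
    and gT: "g T = 0"
  shows "(LINT t|lebesgue_on {0<..<T}. Mnorm (v t) * w t) = - g 0 * Mnorm u0"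
proof -
  let ?s = "\<lambda>t. sing_part lborel (v t)"
  let ?M = "lebesgue_on {0<..<T}"
  have L: "Linf_Mplus T u v" using S unfolding solution_P_def by blast
  have uM: "u \<in> Mplus (strip T)" using L by (simp add: Linf_Mplus_def)
  interpret M: finite_measure ?M by (rule finite_measure_lebesgue_on_interval)
  have cw: "continuous_on {0..T} w" using w by (rule continuous_on_subset) simp
  have cg: "continuous_on {0..T} g" using g by (meson DERIV_isCont continuous_at_imp_continuous_on)
  have "bounded (w ` {0..T})" "bounded (g ` {0..T})"
    using cw cg by (auto intro!: compact_imp_bounded compact_continuous_image)
  then obtain bw0 bg0 where b0: "\<And>t. t \<in> {0..T} \<Longrightarrow> \<bar>w t\<bar> \<le> bw0" "\<And>t. t \<in> {0..T} \<Longrightarrow> \<bar>g t\<bar> \<le> bg0"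
    unfolding bounded_iff by (metis imageI real_norm_def)
  define bw where "bw = max bw0 0"
  define bg where "bg = max bg0 0"
  have b: "\<bar>w t\<bar> \<le> bw" "\<bar>g t\<bar> \<le> bg" if "t \<in> {0..T}" for t
    using b0[OF that] by (auto simp: bw_def bg_def)
  have b0: "0 \<le> bw" "0 \<le> bg" by (auto simp: bw_def bg_def)
  have cc: "continuous_on UNIV (cutoff n)" "continuous_on UNIV (deriv (cutoff n))" for n
    by (rule C2D(4)[OF C2_cutoff], rule C2D(5)[OF C2_cutoff])
  have g': "\<forall>t\<in>{0..T}. (g has_real_derivative w t) (at t)" using g by blast
  note test = travelling_test_function[OF C2_cutoff cutoff_support cw g', where c = 0, simplified]
  define z where "z n = (\<lambda>t x. cutoff n x * g t)" for n
  define ZT where "ZT n = (\<lambda>t x. cutoff n x * w t)" for n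
  define ZX where "ZX n = (\<lambda>t x. deriv (cutoff n) x * g t)" for n
  have ZTC: "ZT n \<in> C_Cc T" and ZXC: "ZX n \<in> C_Cc T" and zC: "z n \<in> C1_Cc1 T" for n
    unfolding ZT_def ZX_def z_def by (rule test)+
  have dx: "dx (z n) t x = ZX n t x" for n t x unfolding ZX_def z_def by (rule test(4))
  have dt: "dt (z n) t x = ZT n t x" if "t \<in> {0..T}" for n t x
    unfolding ZT_def z_def using that by (intro test(5)) auto
  have zT: "\<forall>x. z n T x = 0" for n by (simp add: z_def gT)
  define D where "D n p = indicator (strip T) p * (reg T u p * ZT n (snd p) (fst p) + \<phi> (reg T u p) * ZX n (snd p) (fst p))" for n p
  define J where "J n t = (LINT x|?s t. ZT n t x + C\<phi> * ZX n t x)" for n t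
  have eq: "integral\<^sup>L lebesgue (D n) + integral\<^sup>L ?M (J n) = - (LINT x|u0. z n 0 x)" for n
  proof -
    have "(LINT (x,t):strip T|lebesgue. reg T u (x,t) * dt (z n) t x + \<phi> (reg T u (x,t)) * dx (z n) t x)
        + (LINT t:{0<..<T}|lebesgue. LINT x|?s t. dt (z n) t x + C\<phi> * dx (z n) t x)
        = - (LINT x|u0. z n 0 x)"
      using S zC[of n] zT[of n] unfolding solution_P_def by blast
    moreover have "(LINT (x,t):strip T|lebesgue. reg T u (x,t) * dt (z n) t x + \<phi> (reg T u (x,t)) * dx (z n) t x)
        = integral\<^sup>L lebesgue (D n)"
      unfolding set_lebesgue_integral_def
      by (intro Bochner_Integration.integral_cong) (auto simp: D_def strip_def dx dt indicator_def)
    moreover have "(LINT t:{0<..<T}|lebesgue. LINT x|?s t. dt (z n) t x + C\<phi> * dx (z n) t x)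
        = integral\<^sup>L ?M (J n)"
      unfolding set_lebesgue_integral_def J_def
      by (subst integral_restrict_space) (auto simp: dx dt indicator_def intro!: Bochner_Integration.integral_cong)
    ultimately show ?thesis by simp
  qed
  have limD: "(\<lambda>n. integral\<^sup>L lebesgue (D n)) \<longlonglongrightarrow> integral\<^sup>L lebesgue (\<lambda>p. indicator (strip T) p * (reg T u p * w (snd p)))"
  proof -
    obtain L where L: "0 \<le> L" "\<And>a b. 0 \<le> a \<Longrightarrow> a \<le> b \<Longrightarrow> \<bar>\<phi> b - \<phi> a\<bar> \<le> L * (b - a)"
      using Linf_deriv_Lipschitz[OF \<phi>(1)] by blast
    have \<phi>r: "\<bar>\<phi> (reg T u p)\<bar> \<le> L * reg T u p" for p
      using L(2)[of 0 "reg T u p"] reg_nonneg[OF uM] \<phi>(2) by simp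
    have regm: "reg T u \<in> borel_measurable (lebesgue_on (strip T))"
      using borel_measurable_integrable[OF integrable_reg_lebesgue[OF uM]] strip_borel
      by (subst borel_measurable_restrict_space_iff) auto
    have "(\<lambda>v. indicator {0..} v *\<^sub>R \<phi> v) \<in> borel_measurable borel"
      using Linf_deriv_continuous[OF \<phi>(1)] by (intro borel_measurable_continuous_on_indicator) auto
    from measurable_compose[OF regm this]
    have \<phi>m: "(\<lambda>p. \<phi> (reg T u p)) \<in> borel_measurable (lebesgue_on (strip T))"
      using reg_nonneg[OF uM] by simp
    have wm: "(\<lambda>p. w (snd p)) \<in> borel_measurable (lebesgue_on (strip T))"
      using strip_borel
      by (intro continuous_imp_measurable_on_sets_lebesgue continuous_on_compose2[OF w]) (auto intro!: continuous_intros)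
    show ?thesis
    proof (rule integral_dominated_convergence[where w = "\<lambda>p. (bw + 6 * L * bg) * (indicator (strip T) p * reg T u p)"])
      show "integrable lebesgue (\<lambda>p. (bw + 6 * L * bg) * (indicator (strip T) p * reg T u p))"
        by (rule integrable_mult_right[OF integrable_reg_lebesgue[OF uM]])
      show "(\<lambda>p. indicator (strip T) p * (reg T u p * w (snd p))) \<in> borel_measurable lebesgue"
        using borel_measurable_times[OF regm wm] strip_borel
        by (subst (asm) borel_measurable_restrict_space_iff) auto
      show "D n \<in> borel_measurable lebesgue" for n
      proof -
        have "(\<lambda>p. reg T u p * ZT n (snd p) (fst p) + \<phi> (reg T u p) * ZX n (snd p) (fst p)) \<in> borel_measurable (lebesgue_on (strip T))"
          by (intro borel_measurable_add borel_measurable_times regm \<phi>m measurable_C_Cc_on_strip ZTC ZXC)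
        then show ?thesis
          using strip_borel unfolding D_def[abs_def] by (subst (asm) borel_measurable_restrict_space_iff) auto
      qed
      have "(\<lambda>n. D n p) \<longlonglongrightarrow> indicator (strip T) p * (reg T u p * (1 * w (snd p)) + \<phi> (reg T u p) * (0 * g (snd p)))" for p
        unfolding D_def ZT_def ZX_def by (intro tendsto_intros cutoff_tendsto cutoff_deriv_tendsto)
      then show "AE p in lebesgue. (\<lambda>n. D n p) \<longlonglongrightarrow> indicator (strip T) p * (reg T u p * w (snd p))"
        by simp
      show "AE p in lebesgue. norm (D n p) \<le> (bw + 6 * L * bg) * (indicator (strip T) p * reg T u p)" for n
      proof (rule AE_I2)
        fix p
        show "norm (D n p) \<le> (bw + 6 * L * bg) * (indicator (strip T) p * reg T u p)"
        proof (cases "p \<in> strip T")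
          case True
          then have t: "snd p \<in> {0..T}" by (auto simp: strip_def)
          have c1: "\<bar>cutoff n (fst p)\<bar> \<le> 1" using cutoff_bounds[of n "fst p"] by simp
          have "\<bar>reg T u p * ZT n (snd p) (fst p)\<bar> \<le> reg T u p * (1 * bw)"
            unfolding ZT_def abs_mult using b(1)[OF t] c1 reg_nonneg[OF uM, of p] by (intro mult_mono) auto
          moreover have "\<bar>\<phi> (reg T u p) * ZX n (snd p) (fst p)\<bar> \<le> (L * reg T u p) * (6 * bg)"
            unfolding ZX_def abs_mult
            using b(2)[OF t] cutoff_deriv_bound_6 \<phi>r[of p] reg_nonneg[OF uM, of p] L(1) b0 by (intro mult_mono) auto
          ultimately show ?thesis using True by (simp add: D_def algebra_simps)
        qed (simp add: D_def)
      qed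
    qed
  qed
  define R where "R t = (LINT x|lborel. reg T u (x, t)) * w t" for t
  have iR: "integrable ?M R" unfolding R_def by (rule integral_reg_slices(1)[OF uM w])
  obtain C where C0: "0 \<le> C" and C: "AE t in ?M.
      ?s t \<in> Mplus UNIV \<and> Mnorm (?s t) \<le> C"
    using sing_part_slice_bound[OF L] by blast
  have split: "AE t in ?M. Mnorm (v t) * w t - R t = w t * Mnorm (?s t)"
  proof -
    have "AE t in ?M. \<forall>f b. f \<in> borel_measurable borel \<longrightarrow> (\<forall>x. \<bar>f x\<bar> \<le> b) \<longrightarrow>
      (LINT x|v t. f x) = (LINT x|lborel. f x * reg T u (x, t)) + (LINT x|?s t. f x)"
      using slice_integral[OF L] by (simp add: AE_strip_time_iff)
    then show ?thesis
    proof eventually_elim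
      case (elim t)
      have "(\<lambda>_. 1::real) \<in> borel_measurable borel" "\<forall>x::real. \<bar>1::real\<bar> \<le> 1" by auto
      with elim have "(LINT x|v t. (1::real)) = (LINT x|lborel. 1 * reg T u (x, t)) + (LINT x|?s t. 1)"
        by blast
      then show ?case by (simp add: Mnorm_def R_def algebra_simps)
    qed
  qed
  have mN: "(\<lambda>t. Mnorm (v t)) \<in> borel_measurable ?M" using L by (simp add: Linf_Mplus_def)
  have wm: "w \<in> borel_measurable ?M" by (rule continuous_borel_measurable_lebesgue_on[OF w])
  have mH: "(\<lambda>t. Mnorm (v t) * w t - R t) \<in> borel_measurable ?M"
    by (intro borel_measurable_diff borel_measurable_times mN wm borel_measurable_integrable[OF iR])
  have mJ: "J n \<in> borel_measurable ?M" for n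
    using measurable_sing_part_slice[OF L C_Cc_linear[OF ZTC ZXC, of 1 n C\<phi> n]] by (simp add: J_def[abs_def])
  have intt: "AE t in ?M. t \<in> {0..T}" by (rule AE_I2) auto
  have iw: "integrable ?M (\<lambda>_. (bw + 6 * \<bar>C\<phi>\<bar> * bg) * C)" by simp
  have Jb: "AE t in ?M. norm (J n t) \<le> (bw + 6 * \<bar>C\<phi>\<bar> * bg) * C" for n
    using C intt
  proof eventually_elim
    case (elim t)
    have "\<bar>J n t\<bar> \<le> (bw + 6 * \<bar>C\<phi>\<bar> * bg) * Mnorm (?s t)"
      unfolding J_def
    proof (rule integral_le_bound_times_Mnorm)
      show "(\<lambda>x. ZT n t x + C\<phi> * ZX n t x) \<in> borel_measurable borel"
        unfolding ZT_def ZX_def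
        by (intro borel_measurable_continuous_onI continuous_intros continuous_on_compose2[OF cc(1)] continuous_on_compose2[OF cc(2)]) auto
      fix x
      have "\<bar>cutoff n x\<bar> * \<bar>w t\<bar> \<le> 1 * bw" using cutoff_bounds[of n x] b(1) elim(2) by (intro mult_mono) auto
      moreover have "\<bar>C\<phi>\<bar> * (\<bar>deriv (cutoff n) x\<bar> * \<bar>g t\<bar>) \<le> \<bar>C\<phi>\<bar> * (6 * bg)"
        using cutoff_deriv_bound_6[of n x] b(2) elim(2) by (intro mult_left_mono mult_mono) auto
      moreover have "\<bar>ZT n t x + C\<phi> * ZX n t x\<bar> \<le> \<bar>cutoff n x\<bar> * \<bar>w t\<bar> + \<bar>C\<phi>\<bar> * (\<bar>deriv (cutoff n) x\<bar> * \<bar>g t\<bar>)"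
        using abs_triangle_ineq[of "ZT n t x" "C\<phi> * ZX n t x"] by (simp add: ZT_def ZX_def abs_mult)
      ultimately show "\<bar>ZT n t x + C\<phi> * ZX n t x\<bar> \<le> bw + 6 * \<bar>C\<phi>\<bar> * bg" by simp
    qed (use elim in auto)
    also have "\<dots> \<le> (bw + 6 * \<bar>C\<phi>\<bar> * bg) * C"
      using elim b0 by (intro mult_left_mono) auto
    finally show ?case by simp
  qed
  have Jlim: "AE t in ?M. (\<lambda>n. J n t) \<longlonglongrightarrow> Mnorm (v t) * w t - R t"
    using C split
  proof eventually_elim
    case (elim t)
    have "(\<lambda>n. LINT x|?s t. cutoff n x * w t + deriv (cutoff n) x * (C\<phi> * g t)) \<longlonglongrightarrow> w t * Mnorm (?s t)"
      using elim by (intro integral_cutoff_tendsto) auto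
    moreover have "(LINT x|?s t. cutoff n x * w t + deriv (cutoff n) x * (C\<phi> * g t)) = J n t" for n
      unfolding J_def by (intro Bochner_Integration.integral_cong) (auto simp: ZT_def ZX_def)
    ultimately show ?case using elim(2) by simp
  qed
  have limJ: "(\<lambda>n. integral\<^sup>L ?M (J n)) \<longlonglongrightarrow> integral\<^sup>L ?M (\<lambda>t. Mnorm (v t) * w t - R t)"
    by (rule integral_dominated_convergence[OF mH mJ iw Jlim Jb])
  have iH: "integrable ?M (\<lambda>t. Mnorm (v t) * w t - R t)"
    by (rule integrable_dominated_convergence[OF mH, of J, OF mJ iw Jlim Jb])
  have lim0: "(\<lambda>n. - (LINT x|u0. z n 0 x)) \<longlonglongrightarrow> - (g 0 * Mnorm u0)"
    using tendsto_minus[OF integral_cutoff_tendsto[OF u0, of "g 0" 0]] by (simp add: z_def)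
  have "(LINT t|?M. R t) + integral\<^sup>L ?M (\<lambda>t. Mnorm (v t) * w t - R t) = - (g 0 * Mnorm u0)"
    using LIMSEQ_unique[OF tendsto_add[OF limD limJ, unfolded eq] lim0]
    unfolding integral_reg_slices(2)[OF uM w] R_def[symmetric] .
  moreover have "(LINT t|?M. Mnorm (v t) * w t) = (LINT t|?M. R t + (Mnorm (v t) * w t - R t))" by simp
  moreover have "\<dots> = (LINT t|?M. R t) + integral\<^sup>L ?M (\<lambda>t. Mnorm (v t) * w t - R t)"
    using iR iH by (rule Bochner_Integration.integral_add)
  ultimately show ?thesis by simp
qed

text \<open>
  Mass and its negative are both weakly nonincreasing, the identity for the mass being linear in the
  test function.
\<close>

theorem solution_conserves_mass:
  assumes u0: "u0 \<in> Mplus UNIV" and \<phi>: "Linf_deriv \<phi> \<phi>'" "\<phi> 0 = 0"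
    and S: "solution_P T \<phi> C\<phi> u0 u v" and T: "0 \<le> T"
  shows "AE t in lebesgue_on {0<..<T}. Mnorm (v t) = Mnorm u0"
proof -
  let ?M = "lebesgue_on {0<..<T}"
  have L: "Linf_Mplus T u v" using S unfolding solution_P_def by blast
  obtain C where C: "AE t in ?M. Mnorm (v t) \<le> C" using L unfolding Linf_Mplus_def by blast
  have mN: "(\<lambda>t. Mnorm (v t)) \<in> borel_measurable ?M" using L by (simp add: Linf_Mplus_def)
  have bnd: "AE t in ?M. \<bar>Mnorm (v t)\<bar> \<le> C"
    using C by eventually_elim (simp add: Mnorm_def)
  have le: "weakly_nonincreasing T (Mnorm u0) C (\<lambda>t. Mnorm (v t))"
  proof
    show "- g 0 * Mnorm u0 \<le> (LINT t|?M. Mnorm (v t) * w t)"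
      if "continuous_on UNIV w" "\<And>t. t \<in> {0..T} \<Longrightarrow> (g has_real_derivative w t) (at t)" "g T = 0" for w g
      using mass_identity[OF u0 \<phi> S T that] by simp
  qed (rule mN bnd)+
  have ge: "weakly_nonincreasing T (- Mnorm u0) C (\<lambda>t. - Mnorm (v t))"
  proof
    show "- g 0 * - Mnorm u0 \<le> (LINT t|?M. - Mnorm (v t) * w t)"
      if "continuous_on UNIV w" "\<And>t. t \<in> {0..T} \<Longrightarrow> (g has_real_derivative w t) (at t)" "g T = 0" for w g
      using mass_identity[OF u0 \<phi> S T that] by simp
  qed (use mN bnd in auto)
  from weakly_nonincreasing.AE_le_initial[OF le] weakly_nonincreasing.AE_le_initial[OF ge]
  show ?thesis by eventually_elim simp
qed

section \<open>The singular part and the mass\<close>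

theorem proposition3p3:
  fixes T C\<phi> :: real and u0 :: "real measure" and \<phi> :: "real \<Rightarrow> real"
  assumes "T > 0"
    and "u0 \<in> Mplus UNIV"
    and "continuous_on {0..} \<phi>"
    and "\<phi> 0 = 0"
    and "\<exists>\<phi>'. Linf_deriv \<phi> \<phi>'"
    and "((\<lambda>v. \<phi> v / v) \<longlongrightarrow> C\<phi>) at_top"
  shows "(\<forall>u v \<tau>. entropy_subsolution_Y T \<phi> u0 u v \<tau> \<longrightarrow>
            (\<exists>N\<in>null_sets lebesgue. \<forall>t1\<in>{0..T} - N. \<forall>t2\<in>{0..T} - N. t1 \<le> t2 \<longrightarrow>
               Mplus_le (sing_part lborel (v t2))
                 (translate (C\<phi> * (t2 - t1)) (sing_part lborel (v t1)))) \<and>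
            (AE t in lebesgue_on {0<..<T}.
               Mplus_le (sing_part lborel (v t)) (translate (C\<phi> * t) (sing_part lborel u0))) \<and>
            (AE t in lebesgue_on {0<..<T}.
               Mnorm (sing_part lborel (v t)) \<le> Mnorm (sing_part lborel u0))) \<and>
         (\<forall>u v. solution_P T \<phi> C\<phi> u0 u v \<longrightarrow>
            (AE t in lebesgue_on {0<..<T}. Mnorm (v t) = Mnorm u0))"
proof -
  obtain \<phi>' where \<phi>': "Linf_deriv \<phi> \<phi>'" using assms(5) by blast
  have T: "0 \<le> T" using assms(1) by simp
  have u0s: "sing_part lborel u0 \<in> Mplus UNIV" by (rule sing_part_Mplus[OF assms(2)])
  show ?thesis
  proof (intro conjI allI impI)
    fix u v \<tau> assume S: "entropy_subsolution_Y T \<phi> u0 u v \<tau>"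
    note sub = entropy_subsolution_singular_part[OF assms(2) \<phi>' assms(6) S T]
    show "\<exists>N\<in>null_sets lebesgue. \<forall>t1\<in>{0..T} - N. \<forall>t2\<in>{0..T} - N. t1 \<le> t2 \<longrightarrow>
      Mplus_le (sing_part lborel (v t2)) (translate (C\<phi> * (t2 - t1)) (sing_part lborel (v t1)))"
      by (rule sub(1))
    show "AE t in lebesgue_on {0<..<T}.
      Mplus_le (sing_part lborel (v t)) (translate (C\<phi> * t) (sing_part lborel u0))"
      by (rule sub(2))
    with sub(2) show "AE t in lebesgue_on {0<..<T}. Mnorm (sing_part lborel (v t)) \<le> Mnorm (sing_part lborel u0)"
      by eventually_elim (rule Mplus_le_translate_Mnorm[OF _ u0s])
  next
    fix u v assume "solution_P T \<phi> C\<phi> u0 u v"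
    then show "AE t in lebesgue_on {0<..<T}. Mnorm (v t) = Mnorm u0"
      using solution_conserves_mass[OF assms(2) \<phi>' assms(4) _ T] by blast
  qed
qed

end
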